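(* Let $J=(J_t)_{t\ge0}$ be a continuous-time Markov chain on $E=\{1,\dots,N\}$ with intensity matrix $Q=(q_{ij})$, and let $(X,J)$ be the Markov modulated risk process \[X_t=x+\int_0^t p_{J_u}\,\mathrm d u-\sum_{k=1}^{N_t}C_k-\sum_{T_k\le t}C_k^{(J_{T_k-},J_{T_k})},\] where: - $p_i>0$ are premium rates; - $N$ is a Markov modulated Poisson process with intensity $\lambda_i$ while $J$ is in state $i$; - claims arriving while $J=i$ have distribution $F_C^{(i)}$ on $[0,\infty)$; - the $T_k$ are the jump epochs of $J$, and a jump from $i$ to $j$ produces an extra claim with distribution $F_C^{(ij)}$ on $[0,\infty)$. Assume the net profit condition $\mathbb E_{0,i}X_1>0$ for all $i\in E$. Fix $q\ge0$ and let $W^{(q)},Z^{(q)}$ be the scale matrices described in the context. Let $\tau_0^-=\inf\{t\ge0:X_t<0\}$, and let $\phi_1^{(q)}(x)$ be the $N\times N$ matrix with entries \[\phi^{(q)}_{1,ij}(x)=\mathbb E_{x,i}[e^{-q\tau_0^-};J_{\tau_0^-}=j,\tau_0^-<\infty].\] Then the limit \[\mathbf C_{W(\infty)^{-1}Z(\infty)}:=\lim_{a\to\infty}W^{(q)}(a)^{-1}Z^{(q)}(a)\] exists and is finite, and for $x\ge0$, \[\phi_1^{(q)}(x)=Z^{(q)}(x)-W^{(q)}(x)\,\mathbf C_{W(\infty)^{-1}Z(\infty)}.\]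
   Context: $\mathbb P_{x,i}$ and $\mathbb E_{x,i}$ denote the law and expectation given $X_0=x$, $J_0=i$. The claims are conditionally independent given $J$. The matrix exponent is \[F(\alpha)=\mathrm{diag}\big(p_i\alpha+\lambda_i(\mathbb E e^{-\alpha C^{(i)}}-1)\big)_{i\in E}+\big(q_{ij}\mathbb E e^{-\alpha C^{(ij)}}\big)_{i,j\in E},\] where $C^{(i)}\sim F_C^{(i)}$, $C^{(ij)}\sim F_C^{(ij)}$ and $C^{(ii)}:=0$. It satisfies $\mathbb E_{0,i}[e^{\alpha X_t};J_t=j]=(e^{F(\alpha)t})_{ij}$. The scale matrix $W^{(q)}:[0,\infty)\to\mathbb R^{N\times N}$ is the continuous function determined by \[\int_0^\infty e^{-\alpha x}W^{(q)}(x)\,\mathrm d x=(F(\alpha)-q\mathbb I)^{-1}\] for all sufficiently large $\alpha$. The second scale matrix is \[Z^{(q)}(x)=\mathbb I-\int_0^xW^{(q)}(y)\,\mathrm d y\,(Q-q\mathbb I).\] *)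

theory Defs
  imports "HOL-Analysis.Analysis" "HOL-Probability.Probability"
begin

text \<open>States E are the elements of a finite type 'n (so N = CARD('n)).
  Matrices are real^'n^'n. Parameters: premium rates p, claim intensities lam,
  intensity matrix Q, claim distributions FC i (in state i), FCC i j (at a jump i to j).\<close>

definition laplace :: "real measure \<Rightarrow> real \<Rightarrow> real" where
  "laplace M \<alpha> = (\<integral>c. exp (- \<alpha> * c) \<partial>M)"

definition Fexp :: "('n::finite \<Rightarrow> real) \<Rightarrow> ('n \<Rightarrow> real) \<Rightarrow> real^'n^'n \<Rightarrow>
    ('n \<Rightarrow> real measure) \<Rightarrow> ('n \<Rightarrow> 'n \<Rightarrow> real measure) \<Rightarrow> real \<Rightarrow> real^'n^'n" where
  "Fexp p lam Q FC FCC \<alpha> =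
     (\<chi> i j. if i = j then p i * \<alpha> + lam i * (laplace (FC i) \<alpha> - 1) + Q$i$i
             else Q$i$j * laplace (FCC i j) \<alpha>)"

definition scaleW :: "('n::finite \<Rightarrow> real) \<Rightarrow> ('n \<Rightarrow> real) \<Rightarrow> real^'n^'n \<Rightarrow>
    ('n \<Rightarrow> real measure) \<Rightarrow> ('n \<Rightarrow> 'n \<Rightarrow> real measure) \<Rightarrow> real \<Rightarrow> real \<Rightarrow> real^'n^'n" where
  "scaleW p lam Q FC FCC q = (THE W. continuous_on {0..} W \<and> (\<forall>x<0. W x = 0) \<and>
     (\<forall>\<^sub>F \<alpha> in at_top. invertible (Fexp p lam Q FC FCC \<alpha> - q *\<^sub>R mat 1) \<and>
        ((\<lambda>x. exp (- \<alpha> * x) *\<^sub>R W x) has_integral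
            matrix_inv (Fexp p lam Q FC FCC \<alpha> - q *\<^sub>R mat 1)) {0..}))"

definition scaleZ :: "('n::finite \<Rightarrow> real) \<Rightarrow> ('n \<Rightarrow> real) \<Rightarrow> real^'n^'n \<Rightarrow>
    ('n \<Rightarrow> real measure) \<Rightarrow> ('n \<Rightarrow> 'n \<Rightarrow> real measure) \<Rightarrow> real \<Rightarrow> real \<Rightarrow> real^'n^'n" where
  "scaleZ p lam Q FC FCC q x =
     mat 1 - integral {0..x} (scaleW p lam Q FC FCC q) ** (Q - q *\<^sub>R mat 1)"

text \<open>Standard construction via the embedded event chain (competing exponential clocks):
  in state i the next event occurs after an Exp(r_i) time, r_i = lam_i - q_ii; it is a claim
  (state unchanged, size ~ FC i) with probability lam_i/r_i, or a jump to j != i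
  (with an extra claim ~ FCC i j) with probability q_ij/r_i.  If r_i = 0 there are no
  further events.  For every step k and every state i an independent draw of
  (holding time, choice, claim, extra claims) is provided; the step-k draw of the current
  state is used.  Between events X grows linearly at rate p_{J}.\<close>

definition rate :: "('n::finite \<Rightarrow> real) \<Rightarrow> real^'n^'n \<Rightarrow> 'n \<Rightarrow> real" where
  "rate lam Q i = lam i - Q$i$i"

definition hold_dist :: "real \<Rightarrow> ereal measure" where
  "hold_dist r = (if 0 < r then distr (density lborel (\<lambda>x. ennreal (exponential_density r x))) borel ereal
                  else return borel \<infinity>)"

definition choice_dist :: "('n::finite \<Rightarrow> real) \<Rightarrow> real^'n^'n \<Rightarrow> 'n \<Rightarrow> 'n measure" where
  "choice_dist lam Q i = (if 0 < rate lam Q i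
      then density (count_space UNIV)
             (\<lambda>j. ennreal ((if j = i then lam i else Q$i$j) / rate lam Q i))
      else return (count_space UNIV) i)"

definition jump_dist :: "('n::finite \<Rightarrow> real) \<Rightarrow> real^'n^'n \<Rightarrow> ('n \<Rightarrow> real measure) \<Rightarrow>
    ('n \<Rightarrow> 'n \<Rightarrow> real measure) \<Rightarrow> 'n \<Rightarrow> (ereal \<times> 'n \<times> real \<times> ('n \<Rightarrow> real)) measure" where
  "jump_dist lam Q FC FCC i =
     hold_dist (rate lam Q i) \<Otimes>\<^sub>M (choice_dist lam Q i \<Otimes>\<^sub>M (FC i \<Otimes>\<^sub>M
       (\<Pi>\<^sub>M j\<in>UNIV. if j = i then return borel 0 else FCC i j)))"

type_synonym 'n sample = "nat \<Rightarrow> 'n \<Rightarrow> ereal \<times> 'n \<times> real \<times> ('n \<Rightarrow> real)"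

definition sample_space :: "('n::finite \<Rightarrow> real) \<Rightarrow> real^'n^'n \<Rightarrow> ('n \<Rightarrow> real measure) \<Rightarrow>
    ('n \<Rightarrow> 'n \<Rightarrow> real measure) \<Rightarrow> 'n sample measure" where
  "sample_space lam Q FC FCC = (\<Pi>\<^sub>M k\<in>(UNIV::nat set). \<Pi>\<^sub>M i\<in>UNIV. jump_dist lam Q FC FCC i)"

fun ev_state :: "'n sample \<Rightarrow> 'n \<Rightarrow> nat \<Rightarrow> 'n" where
  "ev_state \<omega> i 0 = i"
| "ev_state \<omega> i (Suc k) = fst (snd (\<omega> k (ev_state \<omega> i k)))"

fun ev_time :: "'n sample \<Rightarrow> 'n \<Rightarrow> nat \<Rightarrow> ereal" where
  "ev_time \<omega> i 0 = 0"
| "ev_time \<omega> i (Suc k) = ev_time \<omega> i k + fst (\<omega> k (ev_state \<omega> i k))"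

definition claim_at :: "ereal \<times> 'n \<times> real \<times> ('n \<Rightarrow> real) \<Rightarrow> 'n \<Rightarrow> real" where
  "claim_at d s = (case d of (h, j, c, cv) \<Rightarrow> if j = s then c else cv j)"

fun ev_level :: "('n \<Rightarrow> real) \<Rightarrow> 'n sample \<Rightarrow> real \<Rightarrow> 'n \<Rightarrow> nat \<Rightarrow> real" where
  "ev_level p \<omega> x i 0 = x"
| "ev_level p \<omega> x i (Suc k) = ev_level p \<omega> x i k
     + p (ev_state \<omega> i k) * real_of_ereal (fst (\<omega> k (ev_state \<omega> i k)))
     - claim_at (\<omega> k (ev_state \<omega> i k)) (ev_state \<omega> i k)"

definition ev_index :: "'n sample \<Rightarrow> 'n \<Rightarrow> real \<Rightarrow> nat" where
  "ev_index \<omega> i t = (LEAST k. ereal t < ev_time \<omega> i (Suc k))"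

definition Jproc :: "'n sample \<Rightarrow> 'n \<Rightarrow> real \<Rightarrow> 'n" where
  "Jproc \<omega> i t = ev_state \<omega> i (ev_index \<omega> i t)"

definition Xproc :: "('n \<Rightarrow> real) \<Rightarrow> 'n sample \<Rightarrow> real \<Rightarrow> 'n \<Rightarrow> real \<Rightarrow> real" where
  "Xproc p \<omega> x i t = ev_level p \<omega> x i (ev_index \<omega> i t)
     + p (Jproc \<omega> i t) * (t - real_of_ereal (ev_time \<omega> i (ev_index \<omega> i t)))"

definition ruin_time :: "('n \<Rightarrow> real) \<Rightarrow> 'n sample \<Rightarrow> real \<Rightarrow> 'n \<Rightarrow> ereal" where
  "ruin_time p \<omega> x i = Inf (ereal ` {t. 0 \<le> t \<and> Xproc p \<omega> x i t < 0})"

definition phi1 :: "('n::finite \<Rightarrow> real) \<Rightarrow> ('n \<Rightarrow> real) \<Rightarrow> real^'n^'n \<Rightarrow>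
    ('n \<Rightarrow> real measure) \<Rightarrow> ('n \<Rightarrow> 'n \<Rightarrow> real measure) \<Rightarrow> real \<Rightarrow> real \<Rightarrow> real^'n^'n" where
  "phi1 p lam Q FC FCC q x = (\<chi> i j. \<integral>\<omega>.
      (if ruin_time p \<omega> x i < \<infinity> \<and> Jproc \<omega> i (real_of_ereal (ruin_time p \<omega> x i)) = j
       then exp (- q * real_of_ereal (ruin_time p \<omega> x i)) else 0) \<partial>sample_space lam Q FC FCC)"

text \<open>Net profit condition: E_{0,i} X_1 > 0 (X_1 is bounded above, so this means
  X_1 is integrable with positive mean).\<close>
definition net_profit :: "('n::finite \<Rightarrow> real) \<Rightarrow> ('n \<Rightarrow> real) \<Rightarrow> real^'n^'n \<Rightarrow>
    ('n \<Rightarrow> real measure) \<Rightarrow> ('n \<Rightarrow> 'n \<Rightarrow> real measure) \<Rightarrow> bool" where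
  "net_profit p lam Q FC FCC \<longleftrightarrow> (\<forall>i.
     integrable (sample_space lam Q FC FCC) (\<lambda>\<omega>. Xproc p \<omega> 0 i 1) \<and>
     0 < (\<integral>\<omega>. Xproc p \<omega> 0 i 1 \<partial>sample_space lam Q FC FCC))"

end

theory Submission
  imports Defs
begin

text \<open>
  Conditioning on the first event, the ruin transform \<open>\<phi>\<close> (extended by \<open>\<phi>(x) = I\<close> for \<open>x < 0\<close>)
  satisfies the Volterra equation
  \<open>\<phi>\<^sub>i(x) = e\<^bsup>\<kappa>\<^sub>ix\<^esup> \<phi>\<^sub>i(0) - (1/p\<^sub>i) \<integral>\<^sub>0\<^sup>x e\<^bsup>\<kappa>\<^sub>i(x-y)\<^esup> (G \<phi>)\<^sub>i(y) dy\<close>, where \<open>\<kappa>\<^sub>i = (r\<^sub>i + q)/p\<^sub>i\<close>,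
  \<open>r\<^sub>i\<close> is the total event rate in state \<open>i\<close> and \<open>G\<close> convolves with the claim measures weighted by
  the event rates. The scale matrix \<open>W\<close> is the solution that vanishes on the negative half-line and
  has \<open>W(0) = diag(1/p\<^sub>i)\<close>. Comparing Laplace transforms gives \<open>\<phi> = Z - W C\<close> with
  \<open>C = diag(p\<^sub>i) (I - \<phi>(0))\<close>.

  Solving the equation backwards from a level \<open>a\<close> shows that solutions on \<open>[0, a]\<close> obey a minimum
  principle. Hence \<open>W(a)\<close> is invertible, and \<open>W(a)\<^sup>-\<^sup>1 Z(a) = C + W(a)\<^sup>-\<^sup>1 \<phi>(a)\<close>. Up to the factor \<open>W(0)\<close> the last
  term is the transform of ruin after reaching \<open>a\<close>. For \<open>s > q\<close> the minimum principle bounds it by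
  \<open>\<phi>\<^sup>q(0) - \<phi>\<^sup>s(0) + e\<^bsup>-\<epsilon>a\<^esup>\<close>, so it tends to \<open>0\<close> by letting first \<open>a \<rightarrow> \<infinity>\<close> and then \<open>s \<down> q\<close>.
\<close>

text \<open>Conditioning on the first event gives an integral over all higher levels y >= x.
  Subtracting the same identity at 0 trades this tail for an integral over [0, x] and the unknown
  value phi_i(0); hence the growing exponential and the minus sign, and hence one free vector of
  initial values. The forward equation mixes signs, so positivity is read off the backward form,
  whose coefficients are all nonnegative. For q = 0 discounting gives no decay of W(a)^-1 phi(a). At
  a rate s > 0 it does: level a is not reached before time a / max p_i, whence any eps with eps p_i
  <= s. The mass of ruin before a decreases in the rate, so replacing q by s costs at most phi^q(0)
  - phi^s(0). This is small because a path that is never ruined counts as 0 for every rate, q = 0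
  included. The analysis of the limit uses phi only through its equation, the bounds 0 <= phi <= 1,
  its values below 0 and right continuity in the rate.\<close>

section \<open>Uniqueness of Laplace transforms\<close>

text \<open>The transform in \<open>scaleW\<close> is a gauge integral, so for a competitor of W it
  may converge only conditionally. The limit of the truncated integrals is the information that
  survives.\<close>

lemma has_integral_atLeast_imp_tendsto:
  fixes f :: "real \<Rightarrow> real"
  assumes "(f has_integral I) {0..}"
  shows "((\<lambda>b. integral {0..b} f) \<longlongrightarrow> I) at_top"
proof (rule tendstoI)
  fix e :: real assume "e > 0"
  then obtain B where B: "B > 0" and *: "\<And>a b. ball 0 B \<subseteq> cbox a b \<Longrightarrow>
      norm (integral (cbox a b) (\<lambda>x. if x \<in> {0..} then f x else 0) - I) < e"
    using assms unfolding has_integral_alt' by meson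
  have "dist (integral {0..b} f) I < e" if "b \<ge> B" for b
  proof -
    have "integral (cbox (-b) b) (\<lambda>x. if x \<in> {0..} then f x else 0)
        = integral (cbox (-b) b \<inter> {0..}) f"
      by (simp only: Int_commute integral_restrict_Int)
    also have "cbox (-b) b \<inter> {0..} = {0..b}" using B that by auto
    finally show ?thesis
      using *[of "-b" b] that by (force simp: dist_norm ball_def dist_real_def)
  qed
  then show "\<forall>\<^sub>F b in at_top. dist (integral {0..b} f) I < e"
    using eventually_at_top_linorder by blast
qed

text \<open>Lerch's theorem. With \<open>g(y) = \<integral>\<^sub>0\<^sup>y e\<^bsup>-Az\<^esup> f(z) dz\<close>, all moments of \<open>g(- ln u)\<close> on \<open>[0, 1]\<close> vanish; the
  Weierstrass theorem then gives \<open>\<integral> e\<^bsup>-y\<^esup> g(y)\<^sup>2 dy = 0\<close>.\<close>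

lemma Laplace_transform_eq_0_imp_eq_0:
  fixes f :: "real \<Rightarrow> real"
  assumes cont: "continuous_on {0..} f"
    and lt: "\<forall>\<^sub>F \<alpha> in at_top. ((\<lambda>x. exp (- \<alpha> * x) * f x) has_integral 0) {0..}"
    and "0 \<le> x"
  shows "f x = 0"
proof -
  obtain A where A: "\<And>\<alpha>. \<alpha> \<ge> A \<Longrightarrow> ((\<lambda>x. exp (- \<alpha> * x) * f x) has_integral 0) {0..}"
    using lt unfolding eventually_at_top_linorder by blast
  define k where "k y = exp (- A * y) * f y" for y
  \<comment> \<open>The primitive is bounded and tends to 0 even when the integral of
    \<open>k\<close> converges only conditionally, so its own transforms converge absolutely at
    every s > 0.\<close>
  define g where "g y = integral {0..y} k" for y
  have contk: "continuous_on {0..} k" unfolding k_def by (intro continuous_intros cont)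
  have deriv: "(g has_vector_derivative k y) (at y within {0..b})" if "0 \<le> y" "y \<le> b" for y b
    unfolding g_def using that
    by (intro integral_has_vector_derivative continuous_on_subset[OF contk]) auto
  have deriv': "(g has_real_derivative k y) (at y)" if "0 < y" for y
    unfolding has_real_derivative_iff_has_vector_derivative using deriv[of y "y + 1"] at_within_Icc_at[of 0 y "y + 1"] that by auto
  have contg: "continuous_on {0..b} g" for b
    unfolding g_def
    by (intro indefinite_integral_continuous_1 integrable_continuous_real
        continuous_on_subset[OF contk]) auto
  have contg': "continuous_on {0..} g"
    unfolding continuous_on_eq_continuous_within
  proof
    fix y :: real assume "y \<in> {0..}"
    then have "continuous (at y within {0..y+1}) g"
      using contg[of "y+1"] by (auto simp: continuous_on_eq_continuous_within)
    moreover have "at y within {0..} = at y within {0..y+1}"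
      by (rule at_within_nhd[of _ "{..<y+1}"]) auto
    ultimately show "continuous (at y within {0..}) g" by simp
  qed
  have g_lim: "(g \<longlongrightarrow> 0) at_top"
    unfolding g_def k_def using has_integral_atLeast_imp_tendsto[OF A[OF order_refl]] .
  \<comment> \<open>The transform of \<open>f\<close> at \<open>A + s\<close> is thus
    \<open>s\<close> times that of \<open>g\<close> at \<open>s\<close>, up to a boundary term
    vanishing at infinity; the hypothesis passes from \<open>f\<close> to \<open>g\<close>.\<close>
  have parts: "integral {0..b} (\<lambda>y. exp (-(A + s) * y) * f y) =
      exp (- s * b) * g b + s * integral {0..b} (\<lambda>y. exp (- s * y) * g y)" if "b \<ge> 0" for s b
  proof -
    have [simp]: "g 0 = 0" by (simp add: g_def)
    have "((\<lambda>y. g y * (- s * exp (- s * y))) has_integral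
        integral {0..b} (\<lambda>y. g y * (- s * exp (- s * y)))) {0..b}"
      by (intro integrable_integral integrable_continuous_real continuous_intros contg)
    then have "((\<lambda>y. k y * exp (- s * y)) has_integral
        (g b * exp (- s * b) - g 0 * exp (- s * 0) -
          integral {0..b} (\<lambda>y. g y * (- s * exp (- s * y))))) {0..b}"
      using that
      by (intro integration_by_parts_interior[OF bounded_bilinear_mult, of 0 b g "\<lambda>y. exp (- s * y)"
          k "\<lambda>y. - s * exp (- s * y)"])
         (auto intro!: contg continuous_intros derivative_eq_intros dest: deriv'
           simp: has_real_derivative_iff_has_vector_derivative[symmetric])
    then have "integral {0..b} (\<lambda>y. k y * exp (- s * y)) =
        g b * exp (- s * b) - integral {0..b} (\<lambda>y. (- s) * (exp (- s * y) * g y))"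
      by (auto dest!: integral_unique simp: mult_ac)
    also have "integral {0..b} (\<lambda>y. (- s) * (exp (- s * y) * g y)) =
        - s * integral {0..b} (\<lambda>y. exp (- s * y) * g y)" by (rule integral_mult_right)
    also have "(\<lambda>y. k y * exp (- s * y)) = (\<lambda>y. exp (-(A + s) * y) * f y)"
      by (auto simp: k_def algebra_simps exp_add[symmetric] exp_diff exp_minus field_simps)
    finally show ?thesis by (simp add: mult_ac)
  qed
  have moments: "((\<lambda>b. integral {0..b} (\<lambda>y. exp (- s * y) * g y)) \<longlongrightarrow> 0) at_top" if "s > 0" for s
  proof -
    have "((\<lambda>b. exp (- s * b)) \<longlongrightarrow> 0) at_top" using that
      by (intro filterlim_compose[OF exp_at_bot] filterlim_tendsto_neg_mult_at_bot[of _ "-s"])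
         (auto intro: filterlim_ident tendsto_const)
    then have "((\<lambda>b. (integral {0..b} (\<lambda>y. exp (-(A + s) * y) * f y) - exp (- s * b) * g b) / s)
        \<longlongrightarrow> (0 - 0 * 0) / s) at_top"
      using that by (intro tendsto_intros g_lim has_integral_atLeast_imp_tendsto A) auto
    moreover have "\<forall>\<^sub>F b in at_top. (integral {0..b} (\<lambda>y. exp (-(A + s) * y) * f y) -
        exp (- s * b) * g b) / s = integral {0..b} (\<lambda>y. exp (- s * y) * g y)"
      using eventually_ge_at_top[of 0] by eventually_elim (use that parts in auto)
    ultimately show ?thesis by (simp add: tendsto_cong)
  qed
  obtain M where M: "\<And>y. y \<ge> 0 \<Longrightarrow> \<bar>g y\<bar> \<le> M"
  proof -
    have "\<forall>\<^sub>F y in at_top. \<bar>g y\<bar> < 1"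
      using tendstoD[OF g_lim, of 1] by (simp add: dist_real_def)
    then obtain b where b: "\<And>y. y \<ge> b \<Longrightarrow> \<bar>g y\<bar> < 1"
      unfolding eventually_at_top_linorder by blast
    have "bounded (g ` {0..b})"
      by (intro compact_imp_bounded compact_continuous_image contg) auto
    then obtain M where "\<And>y. y \<in> {0..b} \<Longrightarrow> \<bar>g y\<bar> \<le> M"
      unfolding bounded_iff by (metis image_eqI real_norm_def)
    then have "\<bar>g y\<bar> \<le> max M 1" if "y \<ge> 0" for y
      using b[of y] that by (cases "y \<le> b") (force simp: le_max_iff_disj)+
    then show ?thesis by (rule that)
  qed
  have Mnn: "M \<ge> 0" using M[of 0] by auto
  \<comment> \<open>Under u = e^(-y) the limit of \<open>g\<close> at infinity becomes continuity of
    \<open>h\<close> at 0, so polynomial approximation can be used on a compact interval.\<close>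
  define h where "h u = (if u \<le> 0 then 0 else g (- ln u))" for u :: real
  have conth: "continuous_on {0..1} h"
    unfolding continuous_on_eq_continuous_within
  proof
    fix u :: real assume u: "u \<in> {0..1}"
    show "continuous (at u within {0..1}) h"
    proof (cases "u = 0")
      case True
      have "((\<lambda>u. g (- ln u)) \<longlongrightarrow> 0) (at_right 0)"
        by (rule filterlim_compose[OF g_lim])
           (simp add: filterlim_uminus_at_bot[symmetric] ln_at_0 flip: filterlim_uminus_at_top)
      moreover have "\<forall>\<^sub>F u in at_right 0. g (- ln u) = h u"
        using eventually_at_right_less[of 0] by eventually_elim (auto simp: h_def)
      ultimately have "(h \<longlongrightarrow> 0) (at_right 0)" using tendsto_cong by force
      then have "(h \<longlongrightarrow> 0) (at 0 within {0..1})"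
        using at_within_Icc_at_right[of 0 "1::real"] by simp
      then show ?thesis using True by (simp add: continuous_within h_def)
    next
      case False
      have "continuous_on {0<..1} (\<lambda>u. g (- ln u))"
        by (rule continuous_on_compose2[OF contg']) (auto intro!: continuous_intros)
      then have "continuous_on {0<..1} h"
        by (rule continuous_on_eq) (auto simp: h_def)
      then have "continuous (at u within {0<..1}) h" using u False
        by (auto simp: continuous_on_eq_continuous_within)
      moreover have "at u within {0..1} = at u within {0<..1}"
        by (rule at_within_nhd[of _ "{0<..}"]) (use u False in auto)
      ultimately show ?thesis by simp
    qed
  qed
  have hg: "h (exp (- y)) = g y" for y by (simp add: h_def)
  have small: "integral {0..b} (\<lambda>y. exp (- y) * (g y)\<^sup>2) \<le> e * M" if "e > 0" "b \<ge> 0" for e b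
  proof -
    obtain P where P: "real_polynomial_function P" "\<And>u. u \<in> {0..1} \<Longrightarrow> \<bar>h u - P u\<bar> < e"
      using Stone_Weierstrass_real_polynomial_function[of "{0..1::real}" h e] conth \<open>e > 0\<close> by auto
    obtain a n where Pa: "P = (\<lambda>u. \<Sum>i\<le>n. a i * u ^ i)"
      using P(1) real_polynomial_function_iff_sum by auto
    have contP: "continuous_on S (\<lambda>y. P (exp (- y)))" for S
      unfolding Pa by (intro continuous_intros)
    have lim: "((\<lambda>c. integral {0..c} (\<lambda>y. exp (- y) * g y * P (exp (- y)))) \<longlongrightarrow> 0) at_top"
    proof -
      \<comment> \<open>The weight e^(-y) raises every exponent to at least 1
        (\<open>Suc i\<close>), so only transforms of \<open>g\<close> at s > 0 occur, constant term
        of \<open>P\<close> included.\<close>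
      have eq: "integral {0..c} (\<lambda>y. exp (- y) * g y * P (exp (- y))) =
         (\<Sum>i\<le>n. a i * integral {0..c} (\<lambda>y. exp (- real (Suc i) * y) * g y))" for c
      proof -
        have "(\<lambda>y. exp (- y) * g y * P (exp (- y))) =
            (\<lambda>y. \<Sum>i\<le>n. a i * (exp (- real (Suc i) * y) * g y))"
        proof
          fix y
          have "exp (- y) * exp (- y) ^ i = exp (- real (Suc i) * y)" for i
            by (simp only: power_Suc[symmetric] exp_of_nat_mult[symmetric]) (simp add: algebra_simps mult_exp_exp)
          then have "a i * exp (- y) ^ i * (exp (- y) * g y) = a i * (exp (- real (Suc i) * y) * g y)" for i
            by (metis (no_types, opaque_lifting) mult.assoc mult.commute)
          moreover have "exp (- y) * g y * P (exp (- y)) = (\<Sum>i\<le>n. a i * exp (- y) ^ i * (exp (- y) * g y))"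
            unfolding Pa by (subst mult.commute) (simp only: sum_distrib_right)
          ultimately show "exp (- y) * g y * P (exp (- y)) =
            (\<Sum>i\<le>n. a i * (exp (- real (Suc i) * y) * g y))"
            by (simp only:)
        qed
        then have "integral {0..c} (\<lambda>y. exp (- y) * g y * P (exp (- y))) =
            integral {0..c} (\<lambda>y. \<Sum>i\<le>n. a i * (exp (- real (Suc i) * y) * g y))"
          by (simp only:)
        also have "\<dots> = (\<Sum>i\<le>n. integral {0..c} (\<lambda>y. a i * (exp (- real (Suc i) * y) * g y)))"
          by (intro integral_sum integrable_continuous_real continuous_intros contg) auto
        finally show ?thesis by (simp only: integral_mult_right)
      qed
      have "((\<lambda>c. \<Sum>i\<le>n. a i * integral {0..c} (\<lambda>y. exp (- real (Suc i) * y) * g y)) \<longlongrightarrow>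
          (\<Sum>i\<le>n. a i * 0)) at_top"
        by (intro tendsto_intros moments) auto
      then show ?thesis unfolding eq by simp
    qed
    have le: "integral {0..b} (\<lambda>y. exp (- y) * (g y)\<^sup>2) \<le>
        e * M + integral {0..c} (\<lambda>y. exp (- y) * g y * P (exp (- y)))" if "c \<ge> b" for c
    proof -
      have "integral {0..b} (\<lambda>y. exp (- y) * (g y)\<^sup>2) \<le> integral {0..c} (\<lambda>y. exp (- y) * (g y)\<^sup>2)"
        using that \<open>b \<ge> 0\<close>
        by (intro integral_subset_le integrable_continuous_real continuous_intros contg) auto
      also have "\<dots> \<le> integral {0..c} (\<lambda>y. e * M * exp (- y) + exp (- y) * g y * P (exp (- y)))"
      proof (intro integral_le integrable_continuous_real continuous_intros contg contP)
        fix y assume y: "y \<in> {0..c}"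
        have "g y * (g y - P (exp (- y))) \<le> \<bar>g y\<bar> * \<bar>h (exp (- y)) - P (exp (- y))\<bar>"
          by (metis abs_ge_self abs_mult hg)
        also have "\<dots> \<le> M * e" using y by (intro mult_mono M less_imp_le[OF P(2)]) (auto simp: Mnn)
        finally have "exp (- y) * (g y * (g y - P (exp (- y)))) \<le> exp (- y) * (M * e)"
          by (intro mult_left_mono) auto
        then show "exp (- y) * (g y)\<^sup>2 \<le> e * M * exp (- y) + exp (- y) * g y * P (exp (- y))"
          by (simp add: algebra_simps power2_eq_square)
      qed
      also have "\<dots> = integral {0..c} (\<lambda>y. e * M * exp (- y)) +
          integral {0..c} (\<lambda>y. exp (- y) * g y * P (exp (- y)))"
        by (intro integral_add integrable_continuous_real continuous_intros contg contP)
      also have "integral {0..c} (\<lambda>y. e * M * exp (- y)) = e * M * integral {0..c} (\<lambda>y. exp (- y))"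
        by (rule integral_mult_right)
      also have "integral {0..c} (\<lambda>y. exp (- y)) = 1 - exp (- c)"
      proof -
        have "((\<lambda>y. exp (- y)) has_integral (- exp (- c) - (- exp (- 0)))) {0..c}"
          using that \<open>b \<ge> 0\<close>
          by (intro fundamental_theorem_of_calculus)
             (auto intro!: derivative_eq_intros simp: has_real_derivative_iff_has_vector_derivative[symmetric])
        then show ?thesis by (simp add: integral_unique)
      qed
      also have "e * M * (1 - exp (- c)) \<le> e * M * 1"
        using \<open>e > 0\<close> Mnn by (intro mult_left_mono) auto
      finally show ?thesis by simp
    qed
    have "((\<lambda>c. e * M + integral {0..c} (\<lambda>y. exp (- y) * g y * P (exp (- y)))) \<longlongrightarrow> e * M + 0) at_top"
      by (intro tendsto_intros lim)
    moreover have "\<forall>\<^sub>F c in at_top. integral {0..b} (\<lambda>y. exp (- y) * (g y)\<^sup>2) \<le>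
        e * M + integral {0..c} (\<lambda>y. exp (- y) * g y * P (exp (- y)))"
      using eventually_ge_at_top[of b] by eventually_elim (rule le)
    ultimately show ?thesis using tendsto_lowerbound by fastforce
  qed
  have g0: "g y = 0" if "y > 0" for y
  proof -
    let ?f = "\<lambda>y. exp (- y) * (g y)\<^sup>2"
    have "((\<lambda>e. e * M) \<longlongrightarrow> 0 * M) (at_right 0)" by (intro tendsto_intros)
    moreover have "\<forall>\<^sub>F e in at_right 0. integral {0..y} ?f \<le> e * M"
      using eventually_at_right_less[of 0] by eventually_elim (use small that in auto)
    ultimately have "integral {0..y} ?f \<le> 0" using tendsto_lowerbound[of "\<lambda>e. e * M"] by force
    moreover have "integral {0..y} ?f \<ge> 0" by (intro integral_nonneg integrable_continuous_real
          continuous_intros contg) auto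
    moreover have "?f integrable_on {0..y}"
      by (intro integrable_continuous_real continuous_intros contg)
    ultimately have "(?f has_integral 0) (cbox 0 y)"
      by (simp add: has_integral_iff)
    then have "?f y = 0" using that
      by (intro has_integral_0_cbox_imp_0[of 0 y ?f]) (auto intro!: continuous_intros contg)
    then show ?thesis by simp
  qed
  have k0: "k y = 0" if "y > 0" for y
  proof -
    have "((\<lambda>_. 0) has_vector_derivative k y) (at y)"
      by (rule has_vector_derivative_transform_within_open[OF
        deriv'[OF that, unfolded has_real_derivative_iff_has_vector_derivative], of "{0<..}"])
         (use that g0 in auto)
    then show ?thesis using vector_derivative_unique_at has_vector_derivative_const by blast
  qed
  have f0: "f y = 0" if "y > 0" for y using k0[OF that] by (simp add: k_def)
  show ?thesis
  proof (cases "x = 0")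
    case True
    have "(f \<longlongrightarrow> f 0) (at 0 within {0..1})"
      using cont by (auto simp: continuous_on_def intro: tendsto_within_subset)
    then have "(f \<longlongrightarrow> f 0) (at_right 0)" by (simp add: at_within_Icc_at_right)
    moreover have "\<forall>\<^sub>F u in at_right 0. f u = 0"
      using eventually_at_right_less[of 0] by eventually_elim (auto simp: f0)
    ultimately have "((\<lambda>_. 0) \<longlongrightarrow> f 0) (at_right (0::real))" using tendsto_cong by force
    then show ?thesis using True by (simp add: tendsto_const_iff)
  qed (use f0 assms in auto)
qed

section \<open>Exponentially bounded functions\<close>

text \<open>The bound is nondecreasing and constant below 0, so it survives translation by a
  nonnegative claim. The class contains both the bounded ruin transform and the growing scale
  matrix, and its members have Laplace transforms at all large arguments.\<close>

definition exp_bounded :: "(real \<Rightarrow> real) \<Rightarrow> bool" where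
  "exp_bounded f \<longleftrightarrow> f \<in> borel_measurable borel \<and>
     (\<exists>B \<beta>. 0 \<le> \<beta> \<and> (\<forall>x. \<bar>f x\<bar> \<le> B * exp (\<beta> * max 0 x)))"

lemma exp_boundedI:
  assumes "f \<in> borel_measurable borel" "0 \<le> \<beta>" "\<And>x. \<bar>f x\<bar> \<le> B * exp (\<beta> * max 0 x)"
  shows "exp_bounded f"
  using assms unfolding exp_bounded_def by blast

lemma exp_bounded_measurable [measurable_dest]: "exp_bounded f \<Longrightarrow> f \<in> borel_measurable borel"
  by (simp add: exp_bounded_def)

text \<open>Besides nonnegative constants this provides a growth rate above any prescribed \<beta>0,
  as needed to put two functions under one rate or to exceed the rate \<kappa> of a kernel.\<close>

lemma exp_boundedE:
  assumes "exp_bounded f"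
  obtains B \<beta> where "0 \<le> B" "\<beta>0 \<le> \<beta>" "0 \<le> \<beta>" "\<And>x. \<bar>f x\<bar> \<le> B * exp (\<beta> * max 0 x)"
proof -
  obtain B \<beta> where *: "0 \<le> \<beta>" "\<And>x. \<bar>f x\<bar> \<le> B * exp (\<beta> * max 0 x)"
    using assms unfolding exp_bounded_def by blast
  have B: "0 \<le> B" using *(2)[of 0] by auto
  show ?thesis
  proof (rule that[of B "max \<beta>0 \<beta>"])
    fix x
    have "\<bar>f x\<bar> \<le> B * exp (\<beta> * max 0 x)" by (rule *)
    also have "\<dots> \<le> B * exp (max \<beta>0 \<beta> * max 0 x)"
      using B by (intro mult_left_mono) (auto intro: mult_right_mono)
    finally show "\<bar>f x\<bar> \<le> B * exp (max \<beta>0 \<beta> * max 0 x)" .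
  qed (use * B in auto)
qed

lemma exp_bounded_const [simp, intro]: "exp_bounded (\<lambda>_. c)"
  by (rule exp_boundedI[of _ 0 "\<bar>c\<bar>"]) auto

lemma exp_bounded_add:
  assumes f: "exp_bounded f" and g: "exp_bounded g"
  shows "exp_bounded (\<lambda>x. f x + g x)"
proof -
  obtain B b where B: "0 \<le> B" "0 \<le> b" "\<And>x. \<bar>f x\<bar> \<le> B * exp (b * max 0 x)"
    using exp_boundedE[OF f] by metis
  obtain C c where C: "0 \<le> C" "b \<le> c" "0 \<le> c" "\<And>x. \<bar>g x\<bar> \<le> C * exp (c * max 0 x)"
    using exp_boundedE[OF g] by metis
  show ?thesis
  proof (rule exp_boundedI[of _ c "B + C"])
    fix x
    have "\<bar>f x + g x\<bar> \<le> B * exp (b * max 0 x) + C * exp (c * max 0 x)"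
      using B(3)[of x] C(4)[of x] by linarith
    also have "B * exp (b * max 0 x) \<le> B * exp (c * max 0 x)"
      using B C by (intro mult_left_mono) (auto intro: mult_right_mono)
    finally show "\<bar>f x + g x\<bar> \<le> (B + C) * exp (c * max 0 x)" by (simp add: algebra_simps)
  qed (use f g C in measurable)
qed

lemma exp_bounded_cmult:
  assumes f: "exp_bounded f"
  shows "exp_bounded (\<lambda>x. c * f x)"
proof -
  obtain B b where B: "0 \<le> B" "0 \<le> b" "\<And>x. \<bar>f x\<bar> \<le> B * exp (b * max 0 x)"
    using exp_boundedE[OF f] by metis
  show ?thesis
  proof (rule exp_boundedI[of _ b "\<bar>c\<bar> * B"])
    show "\<bar>c * f x\<bar> \<le> \<bar>c\<bar> * B * exp (b * max 0 x)" for x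
      using mult_left_mono[OF B(3)[of x], of "\<bar>c\<bar>"] by (simp add: abs_mult mult_ac)
  qed (use f B in measurable)
qed

lemma exp_bounded_diff:
  "exp_bounded f \<Longrightarrow> exp_bounded g \<Longrightarrow> exp_bounded (\<lambda>x. f x - g x)"
  using exp_bounded_add[of f "\<lambda>x. - 1 * g x"] exp_bounded_cmult[of g "- 1"] by simp

lemma exp_bounded_sum:
  "(\<And>k. k \<in> A \<Longrightarrow> exp_bounded (f k)) \<Longrightarrow> exp_bounded (\<lambda>x. \<Sum>k\<in>A. f k x)"
  by (induction A rule: infinite_finite_induct) (auto intro: exp_bounded_add)

lemma exp_bounded_exp: "0 \<le> \<kappa> \<Longrightarrow> exp_bounded (\<lambda>x. exp (\<kappa> * x))"
  by (rule exp_boundedI[of _ \<kappa> 1]) (auto intro: mult_left_mono)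

section \<open>Integrals with exponential weights\<close>

lemma has_bochner_integral_exp_tail:
  fixes a y :: real
  assumes "0 < a"
  shows "has_bochner_integral lborel (\<lambda>x. if y \<le> x then exp (- a * (x - y)) else 0) (1 / a)"
proof -
  have "((\<lambda>x. - exp (- a * (x - y)) / a) \<longlongrightarrow> - 0 / a) at_top"
  proof (intro tendsto_intros filterlim_compose[OF exp_at_bot])
    show "filterlim (\<lambda>x. - a * (x - y)) at_bot at_top"
      using assms by (intro filterlim_tendsto_neg_mult_at_bot[of _ "-a"] tendsto_const)
        (auto simp: filterlim_at_top_add_at_top intro!: filterlim_at_top_mono
          [OF filterlim_tendsto_add_at_top[OF tendsto_const filterlim_ident, of "-y"]])
  qed (use assms in auto)
  then have "(\<integral>\<^sup>+x. ennreal (exp (- a * (x - y))) * indicator {y..} x \<partial>lborel) =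
      ennreal (0 - (- exp (- a * (y - y)) / a))"
    using assms
    by (intro nn_integral_FTC_atLeast[where F = "\<lambda>x. - exp (- a * (x - y)) / a"])
       (auto intro!: derivative_eq_intros)
  also have "(\<lambda>x. ennreal (exp (- a * (x - y))) * indicator {y..} x) =
      (\<lambda>x. ennreal (if y \<le> x then exp (- a * (x - y)) else 0))"
    by (auto simp: indicator_def)
  finally show ?thesis using assms
    by (intro has_bochner_integral_nn_integral) auto
qed

lemma integrable_bounded_Icc:
  fixes g :: "real \<Rightarrow> real"
  assumes [measurable]: "g \<in> borel_measurable borel"
    and B: "\<And>y. a \<le> y \<Longrightarrow> y \<le> b \<Longrightarrow> \<bar>g y\<bar> \<le> B"
  shows "integrable lborel (\<lambda>y. if a \<le> y \<and> y \<le> b then g y else 0)"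
proof (rule Bochner_Integration.integrable_bound[of _ "\<lambda>y. indicator {a..b} y * B"])
  show "integrable lborel (\<lambda>y. indicator {a..b} y * B)"
    by (intro integrable_mult_left) (auto simp: integrable_indicator_iff emeasure_lborel_Icc_eq)
  show "AE x in lborel. norm (if a \<le> x \<and> x \<le> b then g x else 0) \<le> norm (indicator {a..b} x * B)"
  proof (rule AE_I2)
    fix x show "norm (if a \<le> x \<and> x \<le> b then g x else 0) \<le> norm (indicator {a..b} x * B)"
      using B[of x] by (auto simp: indicator_def)
  qed
qed measurable

lemma exp_bounded_integrable_Icc:
  assumes f: "exp_bounded f"
  shows "integrable lborel (\<lambda>y. if a \<le> y \<and> y \<le> b then exp (c * (y - d)) * f y else 0)"
proof -
  obtain B \<beta> where B: "0 \<le> B" "0 \<le> \<beta>" "\<And>x. \<bar>f x\<bar> \<le> B * exp (\<beta> * max 0 x)"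
    using exp_boundedE[OF f] by metis
  have [measurable]: "f \<in> borel_measurable borel" using f by (rule exp_bounded_measurable)
  show ?thesis
  proof (rule integrable_bounded_Icc[where B = "exp (\<bar>c\<bar> * (\<bar>a\<bar> + \<bar>b\<bar> + \<bar>d\<bar>)) * (B * exp (\<beta> * max 0 b))"])
    fix y assume y: "a \<le> y" "y \<le> b"
    have "c * (y - d) \<le> \<bar>c\<bar> * \<bar>y - d\<bar>" by (metis abs_ge_self abs_mult)
    also have "\<dots> \<le> \<bar>c\<bar> * (\<bar>a\<bar> + \<bar>b\<bar> + \<bar>d\<bar>)" using y by (intro mult_left_mono) auto
    finally have 1: "c * (y - d) \<le> \<bar>c\<bar> * (\<bar>a\<bar> + \<bar>b\<bar> + \<bar>d\<bar>)" .
    have "\<bar>f y\<bar> \<le> B * exp (\<beta> * max 0 y)" by (rule B)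
    also have "\<dots> \<le> B * exp (\<beta> * max 0 b)" using B y by (auto intro!: mult_left_mono)
    finally show "\<bar>exp (c * (y - d)) * f y\<bar> \<le> exp (\<bar>c\<bar> * (\<bar>a\<bar> + \<bar>b\<bar> + \<bar>d\<bar>)) * (B * exp (\<beta> * max 0 b))"
      using 1 by (auto simp: abs_mult intro!: mult_mono)
  qed measurable
qed

lemma integral_Icc_eq_HK:
  fixes g :: "real \<Rightarrow> real"
  assumes "integrable lborel (\<lambda>y. if a \<le> y \<and> y \<le> b then g y else 0)"
  shows "g integrable_on {a..b}"
    "(\<integral>y. (if a \<le> y \<and> y \<le> b then g y else 0) \<partial>lborel) = integral {a..b} g"
proof -
  have eq: "(\<lambda>y. if a \<le> y \<and> y \<le> b then g y else 0) = (\<lambda>y. indicator {a..b} y *\<^sub>R g y)"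
    by (auto simp: indicator_def)
  have "set_integrable lborel {a..b} g" using assms unfolding set_integrable_def eq .
  from set_borel_integral_eq_integral[OF this]
  show "g integrable_on {a..b}"
    "(\<integral>y. (if a \<le> y \<and> y \<le> b then g y else 0) \<partial>lborel) = integral {a..b} g"
    unfolding eq set_lebesgue_integral_def by auto
qed

text \<open>The variation-of-constants integral for f' = \<kappa> f + g. It is a Lebesgue integral
  over the whole line with the range built into the integrand, so that Fubini applies
  directly.\<close>

definition econv :: "real \<Rightarrow> (real \<Rightarrow> real) \<Rightarrow> real \<Rightarrow> real" where
  "econv \<kappa> g x = (\<integral>y. (if 0 \<le> y \<and> y \<le> x then exp (\<kappa> * (x - y)) * g y else 0) \<partial>lborel)"

lemma econv_eq_HK:
  assumes g: "exp_bounded g"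
  shows "econv \<kappa> g x = exp (\<kappa> * x) * integral {0..x} (\<lambda>y. exp (- \<kappa> * y) * g y)"
    "(\<lambda>y. exp (- \<kappa> * y) * g y) integrable_on {0..x}"
proof -
  have "integrable lborel (\<lambda>y. if 0 \<le> y \<and> y \<le> x then exp (- \<kappa> * (y - 0)) * g y else 0)"
    by (rule exp_bounded_integrable_Icc[OF g])
  then have i: "integrable lborel (\<lambda>y. if 0 \<le> y \<and> y \<le> x then exp (- \<kappa> * y) * g y else 0)" by (simp cong: if_cong)
  show "(\<lambda>y. exp (- \<kappa> * y) * g y) integrable_on {0..x}" by (rule integral_Icc_eq_HK(1)[OF i])
  have "econv \<kappa> g x = (\<integral>y. exp (\<kappa> * x) * (if 0 \<le> y \<and> y \<le> x then exp (- \<kappa> * y) * g y else 0) \<partial>lborel)"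
    unfolding econv_def
    by (intro Bochner_Integration.integral_cong) (auto simp: exp_diff exp_minus field_simps)
  also have "\<dots> = exp (\<kappa> * x) * integral {0..x} (\<lambda>y. exp (- \<kappa> * y) * g y)"
    using integral_Icc_eq_HK(2)[OF i] by simp
  finally show "econv \<kappa> g x = exp (\<kappa> * x) * integral {0..x} (\<lambda>y. exp (- \<kappa> * y) * g y)" .
qed

lemma continuous_on_econv:
  assumes g: "exp_bounded g"
  shows "continuous_on {0..} (econv \<kappa> g)"
  unfolding continuous_on_eq_continuous_within
proof
  fix y :: real assume y: "y \<in> {0..}"
  have "continuous_on {0..y+1} (econv \<kappa> g)"
    unfolding econv_eq_HK(1)[OF g, abs_def]
    by (intro continuous_intros indefinite_integral_continuous_1 econv_eq_HK(2)[OF g])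
  then have "continuous (at y within {0..y+1}) (econv \<kappa> g)"
    using y by (auto simp: continuous_on_eq_continuous_within)
  moreover have "at y within {0..} = at y within {0..y+1}"
    by (rule at_within_nhd[of _ "{..<y+1}"]) auto
  ultimately show "continuous (at y within {0..}) (econv \<kappa> g)" by simp
qed

lemma econv_measurable [measurable]:
  assumes [measurable]: "g \<in> borel_measurable borel"
  shows "econv \<kappa> g \<in> borel_measurable borel"
  unfolding econv_def[abs_def] by measurable

text \<open>In the norm weighted by e^(-\<beta> x) the operator has size at most 1/(\<beta> -
  \<kappa>), which tends to 0 as the weight grows; the contraction in \<open>sol_exists\<close>
  rests on this.\<close>

lemma econv_bound:
  assumes [measurable]: "g \<in> borel_measurable borel" and "0 \<le> x" "0 \<le> B" "\<kappa> < \<beta>"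
    and B: "\<And>y. 0 \<le> y \<Longrightarrow> y \<le> x \<Longrightarrow> \<bar>g y\<bar> \<le> B * exp (\<beta> * y)"
  shows "\<bar>econv \<kappa> g x\<bar> \<le> B / (\<beta> - \<kappa>) * exp (\<beta> * x)"
proof -
  have "\<bar>econv \<kappa> g x\<bar> \<le> (\<integral>y. \<bar>if 0 \<le> y \<and> y \<le> x then exp (\<kappa> * (x - y)) * g y else 0\<bar> \<partial>lborel)"
    unfolding econv_def by (rule integral_abs_bound)
  \<comment> \<open>The constraint 0 <= y is dropped, and the substitution y -> -y turns y <= x into
    the upper tail evaluated by \<open>has_bochner_integral_exp_tail\<close>.\<close>
  also have "\<dots> \<le> (\<integral>y. (B * exp (\<beta> * x)) * (if -x \<le> -y then exp (- (\<beta> - \<kappa>) * (- y - (- x))) else 0) \<partial>lborel)"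
  proof (rule integral_mono_AE)
    let ?h = "\<lambda>y. if -x \<le> y then exp (- (\<beta> - \<kappa>) * (y - (-x))) else 0"
    have "integrable lborel ?h"
      using has_bochner_integral_exp_tail[of "\<beta> - \<kappa>" "-x"] assms
      by (auto simp: has_bochner_integral_iff)
    from lborel_integrable_real_affine[OF this, of "-1" 0]
    have h: "integrable lborel (\<lambda>y. ?h (- y))" by (simp cong: if_cong)
    then show i: "integrable lborel (\<lambda>y. (B * exp (\<beta> * x)) * ?h (- y))"
      by (rule integrable_mult_right)
    have le: "\<bar>if 0 \<le> y \<and> y \<le> x then exp (\<kappa> * (x - y)) * g y else 0\<bar> \<le> (B * exp (\<beta> * x)) * ?h (- y)" for y
    proof (cases "0 \<le> y \<and> y \<le> x")
      case True
      then have "exp (\<kappa> * (x - y)) * \<bar>g y\<bar> \<le> exp (\<kappa> * (x - y)) * (B * exp (\<beta> * y))"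
        by (intro mult_left_mono B) auto
      also have "\<dots> = B * exp (\<beta> * x) * exp (- (\<beta> - \<kappa>) * (- y - (- x)))"
        by (simp add: algebra_simps mult_exp_exp)
      finally show ?thesis using True by (simp add: abs_mult)
    qed (use assms in auto)
    show "AE y in lborel. \<bar>if 0 \<le> y \<and> y \<le> x then exp (\<kappa> * (x - y)) * g y else 0\<bar>
        \<le> (B * exp (\<beta> * x)) * ?h (- y)" using le by blast
    show "integrable lborel (\<lambda>y. \<bar>if 0 \<le> y \<and> y \<le> x then exp (\<kappa> * (x - y)) * g y else 0\<bar>)"
    proof (rule Bochner_Integration.integrable_bound[OF i])
      show "AE y in lborel. norm \<bar>if 0 \<le> y \<and> y \<le> x then exp (\<kappa> * (x - y)) * g y else 0\<bar>
          \<le> norm ((B * exp (\<beta> * x)) * ?h (- y))"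
        using le by (intro AE_I2) (metis abs_ge_self order_trans real_norm_def abs_idempotent)
    qed measurable
  qed
  also have "\<dots> = (B * exp (\<beta> * x)) * (1 / (\<beta> - \<kappa>))"
    using has_bochner_integral_exp_tail[of "\<beta> - \<kappa>" "-x"] assms
      lborel_integral_real_affine[of "-1" "\<lambda>y. if -x \<le> y then exp (- (\<beta> - \<kappa>) * (y - (-x))) else 0" 0]
    by (simp add: has_bochner_integral_iff cong: if_cong)
  finally show ?thesis by simp
qed

lemma exp_bounded_econv:
  assumes g: "exp_bounded g"
  shows "exp_bounded (econv \<kappa> g)"
proof -
  obtain B \<beta> where B: "0 \<le> B" "\<kappa> + 1 \<le> \<beta>" "0 \<le> \<beta>" "\<And>x. \<bar>g x\<bar> \<le> B * exp (\<beta> * max 0 x)"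
    using exp_boundedE[OF g] by metis
  show ?thesis
  proof (rule exp_boundedI[of _ \<beta> "B / (\<beta> - \<kappa>)"])
    fix x
    show "\<bar>econv \<kappa> g x\<bar> \<le> B / (\<beta> - \<kappa>) * exp (\<beta> * max 0 x)"
    proof (cases "0 \<le> x")
      case True
      have "\<bar>g y\<bar> \<le> B * exp (\<beta> * y)" if "0 \<le> y" for y using B(4)[of y] that by simp
      then have "\<bar>econv \<kappa> g x\<bar> \<le> B / (\<beta> - \<kappa>) * exp (\<beta> * x)"
        using True B by (intro econv_bound exp_bounded_measurable[OF g]) auto
      then show ?thesis using True by (simp add: max_absorb2)
    next
      case False
      then have "(\<lambda>y. if 0 \<le> y \<and> y \<le> x then exp (\<kappa> * (x - y)) * g y else 0) = (\<lambda>_. 0)" by auto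
      then have "econv \<kappa> g x = 0" unfolding econv_def by simp
      then show ?thesis using B by auto
    qed
  qed (use B g in \<open>auto dest: exp_bounded_measurable\<close>)
qed

section \<open>Laplace transforms of exponentially bounded functions\<close>

definition LT :: "(real \<Rightarrow> real) \<Rightarrow> real \<Rightarrow> real" where
  "LT f \<alpha> = (\<integral>x. (if 0 \<le> x then exp (- \<alpha> * x) * f x else 0) \<partial>lborel)"

lemma LT_integrable:
  assumes f: "exp_bounded f"
  shows "\<forall>\<^sub>F \<alpha> in at_top. integrable lborel (\<lambda>x. if 0 \<le> x then exp (- \<alpha> * x) * f x else 0)"
proof -
  obtain B \<beta> where B: "0 \<le> B" "0 \<le> \<beta>" "\<And>x. \<bar>f x\<bar> \<le> B * exp (\<beta> * max 0 x)"
    using exp_boundedE[OF f] by metis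
  have [measurable]: "f \<in> borel_measurable borel" using f by (rule exp_bounded_measurable)
  show ?thesis using eventually_gt_at_top[of \<beta>]
  proof eventually_elim
    case (elim \<alpha>)
    have "integrable lborel (\<lambda>x. if 0 \<le> x then exp (- (\<alpha> - \<beta>) * (x - 0)) else 0)"
      using has_bochner_integral_exp_tail[of "\<alpha> - \<beta>" 0] elim by (simp add: has_bochner_integral_iff)
    then have "integrable lborel (\<lambda>x. B * (if 0 \<le> x then exp (- (\<alpha> - \<beta>) * (x - 0)) else 0))"
      by (rule integrable_mult_right)
    then show ?case
    proof (rule Bochner_Integration.integrable_bound)
      show "AE x in lborel. norm (if 0 \<le> x then exp (- \<alpha> * x) * f x else 0)
          \<le> norm (B * (if 0 \<le> x then exp (- (\<alpha> - \<beta>) * (x - 0)) else 0))"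
      proof (rule AE_I2)
        fix x :: real
        show "norm (if 0 \<le> x then exp (- \<alpha> * x) * f x else 0)
          \<le> norm (B * (if 0 \<le> x then exp (- (\<alpha> - \<beta>) * (x - 0)) else 0))"
        proof (cases "0 \<le> x")
          case True
          then have "exp (- \<alpha> * x) * \<bar>f x\<bar> \<le> exp (- \<alpha> * x) * (B * exp (\<beta> * x))"
            using B(3)[of x] by (intro mult_left_mono) (auto simp: max_absorb2)
          also have "\<dots> = B * exp (- (\<alpha> - \<beta>) * (x - 0))"
            by (simp add: algebra_simps mult_exp_exp)
          finally show ?thesis using True B by (simp add: abs_mult)
        qed auto
      qed
    qed measurable
  qed
qed

lemma LT_has_integral:
  assumes f: "exp_bounded f"
  shows "\<forall>\<^sub>F \<alpha> in at_top. ((\<lambda>x. exp (- \<alpha> * x) * f x) has_integral LT f \<alpha>) {0..}"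
  using LT_integrable[OF f]
proof eventually_elim
  case (elim \<alpha>)
  have eq: "(\<lambda>x. if 0 \<le> x then exp (- \<alpha> * x) * f x else 0) =
      (\<lambda>x. indicator {0..} x *\<^sub>R (exp (- \<alpha> * x) * f x))" by (auto simp: indicator_def)
  have "set_integrable lborel {0..} (\<lambda>x. exp (- \<alpha> * x) * f x)"
    using elim unfolding set_integrable_def eq .
  from set_borel_integral_eq_integral[OF this] show ?case
    unfolding LT_def eq set_lebesgue_integral_def has_integral_iff by auto
qed

lemma LT_add:
  assumes "exp_bounded f" "exp_bounded g"
  shows "\<forall>\<^sub>F \<alpha> in at_top. LT (\<lambda>x. f x + g x) \<alpha> = LT f \<alpha> + LT g \<alpha>"
  using LT_integrable[OF assms(1)] LT_integrable[OF assms(2)]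
proof eventually_elim
  case (elim \<alpha>)
  show ?case unfolding LT_def Bochner_Integration.integral_add[OF elim, symmetric]
    by (intro Bochner_Integration.integral_cong) (auto simp: algebra_simps)
qed

lemma LT_cmult: "LT (\<lambda>x. c * f x) \<alpha> = c * LT f \<alpha>"
proof -
  have "LT (\<lambda>x. c * f x) \<alpha> = (\<integral>x. c * (if 0 \<le> x then exp (- \<alpha> * x) * f x else 0) \<partial>lborel)"
    unfolding LT_def by (intro Bochner_Integration.integral_cong) auto
  then show ?thesis by (simp add: LT_def)
qed

lemma LT_sum:
  assumes "finite A" "\<And>k. k \<in> A \<Longrightarrow> exp_bounded (f k)"
  shows "\<forall>\<^sub>F \<alpha> in at_top. LT (\<lambda>x. \<Sum>k\<in>A. f k x) \<alpha> = (\<Sum>k\<in>A. LT (f k) \<alpha>)"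
  using assms
proof (induction A)
  case (insert a A)
  then have "\<forall>\<^sub>F \<alpha> in at_top. LT (\<lambda>x. \<Sum>k\<in>A. f k x) \<alpha> = (\<Sum>k\<in>A. LT (f k) \<alpha>)" by auto
  moreover have "\<forall>\<^sub>F \<alpha> in at_top. LT (\<lambda>x. f a x + (\<Sum>k\<in>A. f k x)) \<alpha>
      = LT (f a) \<alpha> + LT (\<lambda>x. \<Sum>k\<in>A. f k x) \<alpha>"
    using insert by (intro LT_add exp_bounded_sum) auto
  ultimately show ?case by eventually_elim (use insert in auto)
qed (simp add: LT_def cong: if_cong)

lemma LT_exp:
  assumes "\<kappa> < \<alpha>" shows "LT (\<lambda>x. exp (\<kappa> * x)) \<alpha> = 1 / (\<alpha> - \<kappa>)"
proof -
  have "LT (\<lambda>x. exp (\<kappa> * x)) \<alpha> = (\<integral>x. (if 0 \<le> x then exp (- (\<alpha> - \<kappa>) * (x - 0)) else 0) \<partial>lborel)"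
    unfolding LT_def
    by (intro Bochner_Integration.integral_cong)
       (auto simp: algebra_simps mult_exp_exp)
  then show ?thesis using has_bochner_integral_exp_tail[of "\<alpha> - \<kappa>" 0] assms
    by (simp add: has_bochner_integral_iff)
qed

lemma LT_const: "0 < \<alpha> \<Longrightarrow> LT (\<lambda>x. c) \<alpha> = c / \<alpha>"
  using LT_exp[of 0 \<alpha>] LT_cmult[of c "\<lambda>_. 1" \<alpha>] by simp

text \<open>Fubini on the triangle 0 <= y <= x: for fixed y the integral over x is an exponential
  tail started at y, with value 1/(\<alpha> - \<kappa>) independent of y.\<close>

lemma LT_econv:
  assumes g: "exp_bounded g"
  shows "\<forall>\<^sub>F \<alpha> in at_top. LT (econv \<kappa> g) \<alpha> = LT g \<alpha> / (\<alpha> - \<kappa>)"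
  using LT_integrable[OF g] eventually_gt_at_top[of \<kappa>]
proof eventually_elim
  case (elim \<alpha>)
  have [measurable]: "g \<in> borel_measurable borel" using g by (rule exp_bounded_measurable)
  define F where "F y x = (if 0 \<le> y \<and> y \<le> x then exp (- \<alpha> * x) * (exp (\<kappa> * (x - y)) * g y) else 0)" for y x
  have F_eq: "F y x = (if 0 \<le> y then exp (- \<alpha> * y) * g y else 0) *
      (if y \<le> x then exp (- (\<alpha> - \<kappa>) * (x - y)) else 0)" for x y
    by (auto simp: F_def algebra_simps mult_exp_exp)
  note tail = has_bochner_integral_exp_tail[of "\<alpha> - \<kappa>", unfolded has_bochner_integral_iff]
  have [measurable]: "(\<lambda>(y, x). F y x) \<in> borel_measurable (lborel \<Otimes>\<^sub>M lborel)"
    unfolding F_def by measurable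
  have int: "integrable (lborel \<Otimes>\<^sub>M lborel) (\<lambda>(y, x). F y x)"
  proof (rule lborel_pair.Fubini_integrable)
    have "(\<integral>x. norm (F y x) \<partial>lborel) = \<bar>if 0 \<le> y then exp (- \<alpha> * y) * g y else 0\<bar> / (\<alpha> - \<kappa>)" for y
    proof -
      have "(\<lambda>x. norm (F y x)) = (\<lambda>x. \<bar>if 0 \<le> y then exp (- \<alpha> * y) * g y else 0\<bar> *
         (if y \<le> x then exp (- (\<alpha> - \<kappa>) * (x - y)) else 0))"
        unfolding F_eq by (auto simp: abs_mult)
      then show ?thesis using tail[of y] elim by simp
    qed
    then show "integrable lborel (\<lambda>y. \<integral>x. norm (case (y, x) of (y, x) \<Rightarrow> F y x) \<partial>lborel)"
      using elim by (auto intro!: integrable_divide integrable_abs)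
    show "AE y in lborel. integrable lborel (\<lambda>x. case (y, x) of (y, x) \<Rightarrow> F y x)"
      unfolding F_eq using tail elim by (auto intro!: integrable_mult_right)
  qed measurable
  have "LT (econv \<kappa> g) \<alpha> = (\<integral>x. (\<integral>y. F y x \<partial>lborel) \<partial>lborel)"
    unfolding LT_def
  proof (intro Bochner_Integration.integral_cong refl)
    fix x :: real
    show "(if 0 \<le> x then exp (- \<alpha> * x) * econv \<kappa> g x else 0) = (\<integral>y. F y x \<partial>lborel)"
    proof (cases "0 \<le> x")
      case True
      then have "exp (- \<alpha> * x) * econv \<kappa> g x =
        (\<integral>y. exp (- \<alpha> * x) * (if 0 \<le> y \<and> y \<le> x then exp (\<kappa> * (x - y)) * g y else 0) \<partial>lborel)"
        unfolding econv_def by simp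
      also have "\<dots> = (\<integral>y. F y x \<partial>lborel)"
        by (intro Bochner_Integration.integral_cong) (auto simp: F_def)
      finally show ?thesis using True by simp
    next
      case False
      then have "(\<lambda>y. F y x) = (\<lambda>_. 0)" by (auto simp: F_def)
      then show ?thesis using False by simp
    qed
  qed
  also have "\<dots> = (\<integral>y. (\<integral>x. F y x \<partial>lborel) \<partial>lborel)"
    by (rule lborel_pair.Fubini_integral[OF int])
  also have "\<dots> = (\<integral>y. (if 0 \<le> y then exp (- \<alpha> * y) * g y else 0) / (\<alpha> - \<kappa>) \<partial>lborel)"
    unfolding F_eq using tail elim by simp
  finally show ?case by (simp add: LT_def)
qed

lemma econv_lincomb:
  assumes "exp_bounded f" "exp_bounded g"
  shows "econv k (\<lambda>x. a * f x + b * g x) x = a * econv k f x + b * econv k g x"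
proof -
  have "integral {0..x} (\<lambda>y. exp (- k * y) * (a * f y + b * g y)) =
      integral {0..x} (\<lambda>y. a * (exp (- k * y) * f y) + b * (exp (- k * y) * g y))"
    by (simp add: algebra_simps)
  also have "\<dots> = a * integral {0..x} (\<lambda>y. exp (- k * y) * f y) + b * integral {0..x} (\<lambda>y. exp (- k * y) * g y)"
    using econv_eq_HK(2)[OF assms(1), of k x] econv_eq_HK(2)[OF assms(2), of k x]
    by (subst integral_add) (auto intro: integrable_on_mult_right)
  finally show ?thesis
    using assms by (simp add: econv_eq_HK(1) exp_bounded_add exp_bounded_cmult algebra_simps)
qed

lemma econv_0: "exp_bounded g \<Longrightarrow> econv k g 0 = 0"
  by (simp add: econv_eq_HK(1))

lemma econv_0_eq: "exp_bounded g \<Longrightarrow> econv 0 g x = integral {0..x} g"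
  by (simp add: econv_eq_HK(1))

lemma LT_cong: "(\<And>x. 0 \<le> x \<Longrightarrow> f x = g x) \<Longrightarrow> LT f \<alpha> = LT g \<alpha>"
  unfolding LT_def by (intro Bochner_Integration.integral_cong) auto

lemma LT_diff:
  assumes "exp_bounded f" "exp_bounded g"
  shows "\<forall>\<^sub>F \<alpha> in at_top. LT (\<lambda>x. f x - g x) \<alpha> = LT f \<alpha> - LT g \<alpha>"
  using LT_add[OF assms(1) exp_bounded_cmult[OF assms(2), of "- 1"]]
  by eventually_elim (use LT_cmult[of "- 1" g] in simp)

lemma exp_bounded_LT_unique:
  assumes "exp_bounded f" "exp_bounded g" "continuous_on {0..} f" "continuous_on {0..} g"
    and "\<forall>\<^sub>F \<alpha> in at_top. LT f \<alpha> = LT g \<alpha>" "0 \<le> x"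
  shows "f x = g x"
proof -
  have eb: "exp_bounded (\<lambda>x. f x - g x)" by (intro exp_bounded_diff assms)
  have "\<forall>\<^sub>F \<alpha> in at_top. ((\<lambda>x. exp (- \<alpha> * x) * (f x - g x)) has_integral 0) {0..}"
    using LT_has_integral[OF eb] LT_diff[OF assms(1,2)] assms(5)
    by eventually_elim simp
  then have "f x - g x = 0"
    by (intro Laplace_transform_eq_0_imp_eq_0[of "\<lambda>x. f x - g x"] continuous_intros assms)
  then show ?thesis by simp
qed

section \<open>The Volterra equation\<close>

text \<open>Events leading from \<open>i\<close> to \<open>k\<close> have rate \<open>m i k\<close>
  and claim law \<open>\<mu> i k\<close>; \<open>k = i\<close> stands for a claim without a change
  of state. The analysis is kept apart from the sample space because it also concerns solutions that
  are not ruin transforms, such as the columns of W.\<close>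

locale volterra =
  fixes p :: "'n::finite \<Rightarrow> real" and m :: "'n \<Rightarrow> 'n \<Rightarrow> real" and \<mu> :: "'n \<Rightarrow> 'n \<Rightarrow> real measure"
  assumes p_pos: "\<And>i. 0 < p i"
    and m_nonneg: "\<And>i k. 0 \<le> m i k"
    and mu_prob: "\<And>i k. prob_space (\<mu> i k)"
    and mu_sets [measurable_cong]: "\<And>i k. sets (\<mu> i k) = sets borel"
    and mu_nonneg: "\<And>i k. AE c in \<mu> i k. 0 \<le> c"
begin

definition r :: "'n \<Rightarrow> real" where "r i = (\<Sum>k\<in>UNIV. m i k)"

definition \<kappa> :: "real \<Rightarrow> 'n \<Rightarrow> real" where "\<kappa> q i = (r i + q) / p i"

definition G :: "('n \<Rightarrow> real \<Rightarrow> real) \<Rightarrow> 'n \<Rightarrow> real \<Rightarrow> real" where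
  "G f i y = (\<Sum>k\<in>UNIV. m i k * (\<integral>c. f k (y - c) \<partial>\<mu> i k))"

lemma r_nonneg: "0 \<le> r i"
  unfolding r_def by (intro sum_nonneg m_nonneg)

lemma \<kappa>_nonneg: "0 \<le> q \<Longrightarrow> 0 \<le> \<kappa> q i"
  unfolding \<kappa>_def using p_pos[of i] r_nonneg[of i] by simp

lemma conv_measurable [measurable]:
  fixes f :: "real \<Rightarrow> real"
  assumes [measurable]: "f \<in> borel_measurable borel"
  shows "(\<lambda>y. \<integral>c. f (y - c) \<partial>\<mu> i k) \<in> borel_measurable borel"
proof -
  interpret prob_space "\<mu> i k" by (rule mu_prob)
  show ?thesis by (rule borel_measurable_lebesgue_integral) measurable
qed

lemma AE_bound_translate:
  assumes "\<And>x. \<bar>f x\<bar> \<le> B * exp (\<beta> * max 0 x)" "0 \<le> \<beta>"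
  shows "AE c in \<mu> i k. \<bar>f (y - c)\<bar> \<le> B * exp (\<beta> * max 0 y)"
  using mu_nonneg[of i k]
proof eventually_elim
  case (elim c)
  have "0 \<le> B" using order_trans[OF abs_ge_zero assms(1)[of 0]] by simp
  have "\<bar>f (y - c)\<bar> \<le> B * exp (\<beta> * max 0 (y - c))" by (rule assms)
  also have "\<dots> \<le> B * exp (\<beta> * max 0 y)"
    using elim \<open>0 \<le> B\<close> \<open>0 \<le> \<beta>\<close> by (auto intro!: mult_left_mono)
  finally show ?case .
qed

lemma translate_integrable:
  assumes "exp_bounded f"
  shows "integrable (\<mu> i k) (\<lambda>c. f (y - c))"
proof -
  interpret prob_space "\<mu> i k" by (rule mu_prob)
  have [measurable]: "f \<in> borel_measurable borel" using assms by (rule exp_bounded_measurable)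
  obtain B \<beta> where B: "0 \<le> B" "0 \<le> \<beta>" "\<And>x. \<bar>f x\<bar> \<le> B * exp (\<beta> * max 0 x)"
    using exp_boundedE[OF assms] by metis
  show ?thesis
    by (rule integrable_const_bound) (use AE_bound_translate[OF B(3,2)] in auto)
qed

lemma conv_bound:
  assumes [measurable]: "f \<in> borel_measurable borel"
    and "\<And>x. \<bar>f x\<bar> \<le> B * exp (\<beta> * max 0 x)" "0 \<le> \<beta>"
  shows "\<bar>\<integral>c. f (y - c) \<partial>\<mu> i k\<bar> \<le> B * exp (\<beta> * max 0 y)"
proof -
  interpret prob_space "\<mu> i k" by (rule mu_prob)
  have i: "integrable (\<mu> i k) (\<lambda>c. \<bar>f (y - c)\<bar>)"
    using assms by (intro integrable_abs translate_integrable exp_boundedI[of f \<beta> B]) auto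
  have "\<bar>\<integral>c. f (y - c) \<partial>\<mu> i k\<bar> \<le> (\<integral>c. \<bar>f (y - c)\<bar> \<partial>\<mu> i k)" by (rule integral_abs_bound)
  also have "\<dots> \<le> (\<integral>c. B * exp (\<beta> * max 0 y) \<partial>\<mu> i k)"
    using AE_bound_translate[OF assms(2,3)] by (intro integral_mono_AE i) auto
  finally show ?thesis by (simp add: prob_space)
qed

lemma exp_bounded_conv:
  assumes "exp_bounded f"
  shows "exp_bounded (\<lambda>y. \<integral>c. f (y - c) \<partial>\<mu> i k)"
proof -
  have [measurable]: "f \<in> borel_measurable borel" using assms by (rule exp_bounded_measurable)
  obtain B \<beta> where B: "0 \<le> B" "0 \<le> \<beta>" "\<And>x. \<bar>f x\<bar> \<le> B * exp (\<beta> * max 0 x)"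
    using exp_boundedE[OF assms] by metis
  show ?thesis
    by (rule exp_boundedI[OF conv_measurable B(2) conv_bound[OF _ B(3,2)]]) measurable
qed

lemma exp_bounded_G:
  "(\<And>k. exp_bounded (f k)) \<Longrightarrow> exp_bounded (G f i)"
  unfolding G_def[abs_def] by (intro exp_bounded_sum exp_bounded_cmult exp_bounded_conv)

lemma G_bound:
  assumes "\<And>k. f k \<in> borel_measurable borel" "\<And>k x. \<bar>f k x\<bar> \<le> B * exp (\<beta> * max 0 x)" "0 \<le> \<beta>"
  shows "\<bar>G f i y\<bar> \<le> r i * B * exp (\<beta> * max 0 y)"
proof -
  have "\<bar>G f i y\<bar> \<le> (\<Sum>k\<in>UNIV. \<bar>m i k * (\<integral>c. f k (y - c) \<partial>\<mu> i k)\<bar>)"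
    unfolding G_def by (rule sum_abs)
  also have "\<dots> \<le> (\<Sum>k\<in>UNIV. m i k * (B * exp (\<beta> * max 0 y)))"
    unfolding abs_mult using m_nonneg
    by (intro sum_mono mult_mono conv_bound assms) auto
  finally show ?thesis by (simp add: r_def sum_distrib_right mult.assoc)
qed

lemma G_lincomb:
  assumes "\<And>k. exp_bounded (f k)" "\<And>k. exp_bounded (g k)"
  shows "G (\<lambda>k x. a * f k x + b * g k x) i y = a * G f i y + b * G g i y"
  unfolding G_def
  by (simp add: translate_integrable assms sum_distrib_left sum.distrib distrib_left mult_ac)

lemma G_const: "G (\<lambda>k x. b k) i y = (\<Sum>k\<in>UNIV. m i k * b k)"
  unfolding G_def using prob_space.prob_space[OF mu_prob] by simp

text \<open>Claims are nonnegative, so \<open>G\<close> at level y sees only levels up to y. A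
  comparison of two functions up to y is therefore enough.\<close>

lemma G_mono:
  assumes "\<And>k. exp_bounded (f k)" "\<And>k. exp_bounded (g k)" "\<And>k x. x \<le> y \<Longrightarrow> f k x \<le> g k x"
  shows "G f i y \<le> G g i y"
  unfolding G_def
proof (intro sum_mono mult_left_mono m_nonneg integral_mono_AE translate_integrable assms)
  fix k show "AE c in \<mu> i k. f k (y - c) \<le> g k (y - c)"
    using mu_nonneg[of i k] by eventually_elim (auto intro: assms)
qed

text \<open>When f vanishes below 0, its translate by c has transform e^(-\<alpha> c) times that of
  f. Nonzero values below 0 would be shifted into [0, c) and add a term; this is why
  \<open>LT_sol\<close> first subtracts them.\<close>

lemma LT_conv:
  assumes f: "exp_bounded f" and neg: "\<And>x. x < 0 \<Longrightarrow> f x = 0"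
  shows "\<forall>\<^sub>F \<alpha> in at_top. LT (\<lambda>y. \<integral>c. f (y - c) \<partial>\<mu> i k) \<alpha> = laplace (\<mu> i k) \<alpha> * LT f \<alpha>"
  using LT_integrable[OF f] eventually_ge_at_top[of 0]
proof eventually_elim
  case (elim \<alpha>)
  interpret prob_space "\<mu> i k" by (rule mu_prob)
  interpret P: pair_sigma_finite "\<mu> i k" lborel ..
  have [measurable]: "f \<in> borel_measurable borel" using f by (rule exp_bounded_measurable)
  define g where "g x = (if 0 \<le> x then exp (- \<alpha> * x) * f x else 0)" for x
  have [measurable]: "g \<in> borel_measurable borel" unfolding g_def by measurable
  have g_int: "integrable lborel g" using elim(1) unfolding g_def .
  define F where "F c x = exp (- \<alpha> * c) * g (x - c)" for c x
  have shift: "integrable lborel (\<lambda>x. h (x - c))" "(\<integral>x. h (x - c) \<partial>lborel) = (\<integral>x. h x \<partial>lborel)"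
    if "integrable lborel h" for h :: "real \<Rightarrow> real" and c
    using lborel_integrable_real_affine[OF that, of 1 "- c"] lborel_integral_real_affine[of 1 h "- c"]
    by (simp_all add: add.commute)
  have e_int: "integrable (\<mu> i k) (\<lambda>c. exp (- \<alpha> * c))"
    by (rule integrable_const_bound[of _ 1]) (use mu_nonneg[of i k] elim in auto)
  have [measurable]: "(\<lambda>(c, x). F c x) \<in> borel_measurable (\<mu> i k \<Otimes>\<^sub>M lborel)"
    unfolding F_def by measurable
  have int: "integrable (\<mu> i k \<Otimes>\<^sub>M lborel) (\<lambda>(c, x). F c x)"
  proof (rule P.Fubini_integrable)
    have "(\<integral>x. norm (F c x) \<partial>lborel) = exp (- \<alpha> * c) * (\<integral>x. \<bar>g x\<bar> \<partial>lborel)" for c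
      unfolding F_def using shift(2)[OF integrable_abs[OF g_int], of c] by (simp add: abs_mult)
    then show "integrable (\<mu> i k) (\<lambda>c. \<integral>x. norm (case (c, x) of (c, x) \<Rightarrow> F c x) \<partial>lborel)"
      using e_int by simp
    show "AE c in \<mu> i k. integrable lborel (\<lambda>x. case (c, x) of (c, x) \<Rightarrow> F c x)"
      unfolding F_def using shift(1)[OF g_int] by simp
  qed measurable
  have "LT (\<lambda>y. \<integral>c. f (y - c) \<partial>\<mu> i k) \<alpha> = (\<integral>x. (\<integral>c. F c x \<partial>\<mu> i k) \<partial>lborel)"
    unfolding LT_def
  proof (intro Bochner_Integration.integral_cong refl)
    fix x :: real
    show "(if 0 \<le> x then exp (- \<alpha> * x) * (\<integral>c. f (x - c) \<partial>\<mu> i k) else 0) = (\<integral>c. F c x \<partial>\<mu> i k)"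
    proof (cases "0 \<le> x")
      case True
      have "exp (- \<alpha> * x) * f (x - c) = F c x" for c
        using neg[of "x - c"]
        by (auto simp: F_def g_def algebra_simps mult_exp_exp)
      then have "exp (- \<alpha> * x) * (\<integral>c. f (x - c) \<partial>\<mu> i k) = (\<integral>c. F c x \<partial>\<mu> i k)"
        by (subst integral_mult_right_zero[symmetric]) (simp only:)
      then show ?thesis using True by simp
    next
      case False
      have "AE c in \<mu> i k. F c x = 0"
        using mu_nonneg[of i k] by eventually_elim (use False in \<open>auto simp: F_def g_def\<close>)
      then show ?thesis using False integral_eq_zero_AE by auto
    qed
  qed
  also have "\<dots> = (\<integral>c. (\<integral>x. F c x \<partial>lborel) \<partial>\<mu> i k)"
    by (rule P.Fubini_integral[OF int])
  also have "\<dots> = (\<integral>c. exp (- \<alpha> * c) * LT f \<alpha> \<partial>\<mu> i k)"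
    unfolding F_def using shift(2)[OF g_int] by (simp add: LT_def g_def cong: if_cong)
  finally show ?case by (simp add: laplace_def)
qed

text \<open>The integrated form of p_i f_i' = (r_i + q) f_i - (G f)_i on the half-line, used because
  \<open>G f\<close> may jump. Values below 0 enter only through \<open>G\<close> and act as
  boundary data, while the values at 0 are the free initial values.\<close>

definition sol :: "real \<Rightarrow> ('n \<Rightarrow> real \<Rightarrow> real) \<Rightarrow> bool" where
  "sol q f \<longleftrightarrow> (\<forall>i. exp_bounded (f i)) \<and>
     (\<forall>i. \<forall>x\<ge>0. f i x = exp (\<kappa> q i * x) * f i 0 - econv (\<kappa> q i) (G f i) x / p i)"

lemma sol_exp_bounded: "sol q f \<Longrightarrow> exp_bounded (f i)"
  by (simp add: sol_def)

lemma sol_eq: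
  "sol q f \<Longrightarrow> 0 \<le> x \<Longrightarrow> f i x = exp (\<kappa> q i * x) * f i 0 - econv (\<kappa> q i) (G f i) x / p i"
  unfolding sol_def by blast

lemma sol_continuous:
  assumes "sol q f" shows "continuous_on {0..} (f i)"
proof -
  have "continuous_on {0..} (\<lambda>x. exp (\<kappa> q i * x) * f i 0 - econv (\<kappa> q i) (G f i) x / p i)"
    using p_pos[of i] by (intro continuous_intros continuous_on_econv exp_bounded_G sol_exp_bounded[OF assms]) auto
  then show ?thesis by (rule continuous_on_eq) (metis sol_eq[OF assms] atLeast_iff)
qed

lemma sol_lincomb:
  assumes f: "sol q f" and g: "sol q g"
  shows "sol q (\<lambda>k x. a * f k x + b * g k x)"
  unfolding sol_def
proof safe
  note eb = sol_exp_bounded[OF f] sol_exp_bounded[OF g]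
  show "exp_bounded (\<lambda>x. a * f i x + b * g i x)" for i
    by (intro exp_bounded_add exp_bounded_cmult eb)
  fix i and x :: real assume x: "0 \<le> x"
  show "a * f i x + b * g i x = exp (\<kappa> q i * x) * (a * f i 0 + b * g i 0) -
      econv (\<kappa> q i) (G (\<lambda>k x. a * f k x + b * g k x) i) x / p i"
    unfolding G_lincomb[OF eb, abs_def] econv_lincomb[OF exp_bounded_G[OF eb(1)] exp_bounded_G[OF eb(2)]]
    by (subst sol_eq[OF f x], subst sol_eq[OF g x]) (simp add: algebra_simps add_divide_distrib)
qed

lemma sol_zero: "sol q (\<lambda>k x. 0)"
  unfolding sol_def G_const econv_def by (simp cong: if_cong)

lemma sol_sum:
  "finite A \<Longrightarrow> (\<And>l. l \<in> A \<Longrightarrow> sol q (f l)) \<Longrightarrow> sol q (\<lambda>k x. \<Sum>l\<in>A. c l * f l k x)"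
proof (induction A rule: finite_induct)
  case (insert l A)
  then show ?case using sol_lincomb[of q "f l" "\<lambda>k x. \<Sum>l\<in>A. c l * f l k x" "c l" 1] by simp
qed (simp add: sol_zero)


text \<open>The right-hand side of the equation is a contraction for the norm \<open>sup e\<^bsup>-\<beta>x\<^esup>|f(x)|\<close> with \<open>\<beta>\<close> large.\<close>

lemma sol_exists:
  fixes v :: "'n \<Rightarrow> real"
  assumes "0 \<le> q"
  shows "\<exists>f. sol q f \<and> (\<forall>i x. x < 0 \<longrightarrow> f i x = 0) \<and> (\<forall>i. f i 0 = v i)"
proof -
  define N where "N = real CARD('n)"
  have N: "N \<ge> 1" unfolding N_def by (simp add: Suc_leI)
  \<comment> \<open>Chosen so that each component of the integral operator shrinks by the factor
    1/(2N); estimating the norm by the sum of N components then leaves the contraction constant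
    1/2.\<close>
  define \<beta> where "\<beta> = (\<Sum>i\<in>UNIV. \<kappa> q i + 2 * N * r i / p i) + 1"
  have \<beta>_ge: "\<kappa> q i + 2 * N * r i / p i + 1 \<le> \<beta>" for i
  proof -
    have "\<kappa> q i + 2 * N * r i / p i \<le> (\<Sum>i\<in>UNIV. \<kappa> q i + 2 * N * r i / p i)"
      using \<kappa>_nonneg[OF assms] N r_nonneg p_pos
      by (intro member_le_sum) (auto intro!: add_nonneg_nonneg divide_nonneg_pos)
    then show ?thesis by (simp add: \<beta>_def)
  qed
  have frac: "0 \<le> 2 * N * r i / p i" for i using N r_nonneg p_pos by (auto intro!: divide_nonneg_pos)
  have \<beta>_gt: "\<kappa> q i < \<beta>" for i using \<beta>_ge[of i] frac[of i] by linarith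
  have \<beta>_nonneg: "0 \<le> \<beta>" using \<beta>_gt \<kappa>_nonneg[OF assms] by (meson less_imp_le order_trans)
  have coef: "r i / (\<beta> - \<kappa> q i) / p i \<le> 1 / (2 * N)" for i
  proof -
    have "2 * N * r i / p i \<le> \<beta> - \<kappa> q i" using \<beta>_ge[of i] by linarith
    then show ?thesis using N p_pos[of i] \<beta>_gt[of i] by (simp add: field_simps)
  qed
  \<comment> \<open>The fixed point is sought among bounded continuous functions on the whole line,
    whereas the solution itself may jump at 0. So \<open>ext\<close> removes the weight and discards
    negative arguments, and \<open>max 0 x\<close> below makes the images constant there.\<close>
  define ext :: "(real \<Rightarrow> real^'n) \<Rightarrow> 'n \<Rightarrow> real \<Rightarrow> real" where
    "ext V i x = (if x < 0 then 0 else exp (\<beta> * x) * (V x $ i))" for V i x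
  have ext_meas: "ext V i \<in> borel_measurable borel" if "continuous_on UNIV V" for V i
  proof -
    have "(\<lambda>x. V x $ i) \<in> borel_measurable borel"
      using that by (intro borel_measurable_continuous_onI continuous_intros)
    then show ?thesis unfolding ext_def by measurable
  qed
  have ext_bound: "\<bar>ext V i x\<bar> \<le> B * exp (\<beta> * max 0 x)" if "\<And>x. norm (V x) \<le> B" for V B i x
  proof -
    have "\<bar>V x $ i\<bar> \<le> B" using component_le_norm_cart[of "V x" i] that[of x] by linarith
    moreover have "0 \<le> B" using that norm_ge_zero order_trans by blast
    ultimately show ?thesis
      by (auto simp: ext_def abs_mult mult.commute[of B] max_absorb2 intro!: mult_left_mono)
  qed
  have ext_eb: "exp_bounded (ext V k)" if V: "continuous_on UNIV V" "\<And>x. norm (V x) \<le> B" for V B k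
    by (rule exp_boundedI[OF ext_meas[OF V(1)] \<beta>_nonneg ext_bound[OF V(2)]])
  define S where "S V i x = exp (- \<beta> * max 0 x) *
      (econv (\<kappa> q i) (G (ext V) i) (max 0 x) / p i)" for V i x
  have S_bound: "\<bar>S V i x\<bar> \<le> B / (2 * N)" if V: "continuous_on UNIV V" "\<And>x. norm (V x) \<le> B" for V B i x
  proof -
    have B: "0 \<le> B" using V norm_ge_zero order_trans by blast
    have GB: "\<bar>G (ext V) i y\<bar> \<le> r i * B * exp (\<beta> * max 0 y)" for y
      by (intro G_bound ext_meas ext_bound V \<beta>_nonneg)
    have "exp_bounded (G (ext V) i)"
      by (intro exp_bounded_G ext_eb[OF V])
    then have [measurable]: "G (ext V) i \<in> borel_measurable borel" by (rule exp_bounded_measurable)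
    have "\<bar>econv (\<kappa> q i) (G (ext V) i) (max 0 x)\<bar> \<le> r i * B / (\<beta> - \<kappa> q i) * exp (\<beta> * max 0 x)"
    proof (rule econv_bound)
      show "\<bar>G (ext V) i y\<bar> \<le> r i * B * exp (\<beta> * y)" if "0 \<le> y" for y
        using GB[of y] that by (simp add: max_absorb2)
    qed (use \<beta>_gt r_nonneg B in auto)
    then have "exp (- \<beta> * max 0 x) * (\<bar>econv (\<kappa> q i) (G (ext V) i) (max 0 x)\<bar> / p i) \<le>
       exp (- \<beta> * max 0 x) * (r i * B / (\<beta> - \<kappa> q i) * exp (\<beta> * max 0 x) / p i)"
      using p_pos[of i] by (intro mult_left_mono divide_right_mono) auto
    also have "\<dots> = exp (- \<beta> * max 0 x) * exp (\<beta> * max 0 x) * (r i / (\<beta> - \<kappa> q i) / p i) * B"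
      by simp
    also have "exp (- \<beta> * max 0 x) * exp (\<beta> * max 0 x) = 1" by (simp add: mult_exp_exp)
    also have "1 * (r i / (\<beta> - \<kappa> q i) / p i) * B \<le> 1 / (2 * N) * B"
      using coef[of i] B by (intro mult_right_mono) auto
    finally show ?thesis using p_pos[of i] by (simp add: S_def abs_mult)
  qed
  have S_cont: "continuous_on UNIV (S V i)" if V: "continuous_on UNIV V" "\<And>x. norm (V x) \<le> B" for V B i
    unfolding S_def using p_pos[of i]
    by (intro continuous_intros continuous_on_compose2[OF continuous_on_econv] exp_bounded_G
        ext_eb[OF V]) (auto intro: less_imp_neq)
  define TT :: "(real \<Rightarrow> real^'n) \<Rightarrow> real \<Rightarrow> real^'n" where
    "TT V x = (\<chi> i. exp (- \<beta> * max 0 x) * (exp (\<kappa> q i * max 0 x) * v i) - S V i x)" for V x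
  have TT_in: "TT V \<in> bcontfun" if V: "continuous_on UNIV V" "\<And>x. norm (V x) \<le> B" for V B
  proof (rule bcontfun_normI)
    show "continuous_on UNIV (TT V)"
      unfolding TT_def by (intro continuous_on_vec_lambda continuous_intros S_cont[OF V])
    fix x
    have "\<bar>TT V x $ i\<bar> \<le> \<bar>v i\<bar> + B / (2 * N)" for i
    proof -
      have "exp (- \<beta> * max 0 x) * exp (\<kappa> q i * max 0 x) = exp ((\<kappa> q i - \<beta>) * max 0 x)"
        by (simp add: mult_exp_exp algebra_simps)
      also have "\<dots> \<le> 1" using \<beta>_gt[of i] by (simp add: mult_nonpos_nonneg)
      finally have "(exp (- \<beta> * max 0 x) * exp (\<kappa> q i * max 0 x)) * \<bar>v i\<bar> \<le> 1 * \<bar>v i\<bar>"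
        by (intro mult_right_mono) auto
      then have "\<bar>exp (- \<beta> * max 0 x) * (exp (\<kappa> q i * max 0 x) * v i)\<bar> \<le> \<bar>v i\<bar>"
        by (simp add: abs_mult mult.assoc)
      then show ?thesis using S_bound[OF V, of i x] by (simp add: TT_def)
    qed
    then have "(\<Sum>i\<in>UNIV. \<bar>TT V x $ i\<bar>) \<le> (\<Sum>i\<in>UNIV. \<bar>v i\<bar> + B / (2 * N))"
      by (intro sum_mono)
    then show "norm (TT V x) \<le> (\<Sum>i\<in>UNIV. \<bar>v i\<bar> + B / (2 * N))"
      using norm_le_l1_cart[of "TT V x"] by linarith
  qed
  define T where "T V = Bcontfun (TT (apply_bcontfun V))" for V :: "real \<Rightarrow>\<^sub>C (real^'n)"
  have T_apply: "apply_bcontfun (T V) = TT (apply_bcontfun V)" for V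
    unfolding T_def
    by (intro Bcontfun_inverse TT_in[of _ "norm V"] continuous_on_apply_bcontfun norm_bounded)
  have S_diff: "S V i x - S U i x = S (\<lambda>x. V x - U x) i x"
    if V: "continuous_on UNIV V" "\<And>x. norm (V x) \<le> B" and U: "continuous_on UNIV U" "\<And>x. norm (U x) \<le> C"
    for V U B C i x
  proof -
    have eb: "exp_bounded (ext V k)" "exp_bounded (ext U k)" for k
      by (rule ext_eb[OF V], rule ext_eb[OF U])
    have "ext (\<lambda>x. V x - U x) = (\<lambda>k x. 1 * ext V k x + (-1) * ext U k x)"
      by (auto simp: ext_def fun_eq_iff algebra_simps)
    then have "G (ext (\<lambda>x. V x - U x)) i y = 1 * G (ext V) i y + (- 1) * G (ext U) i y" for y
      by (simp only:) (intro G_lincomb eb)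
    then have "econv (\<kappa> q i) (G (ext (\<lambda>x. V x - U x)) i) (max 0 x) =
       econv (\<kappa> q i) (\<lambda>y. 1 * G (ext V) i y + (- 1) * G (ext U) i y) (max 0 x)"
      by presburger
    also have "\<dots> = 1 * econv (\<kappa> q i) (G (ext V) i) (max 0 x) + (- 1) * econv (\<kappa> q i) (G (ext U) i) (max 0 x)"
      by (intro econv_lincomb exp_bounded_G eb)
    finally have e: "econv (\<kappa> q i) (G (ext (\<lambda>x. V x - U x)) i) (max 0 x) =
        econv (\<kappa> q i) (G (ext V) i) (max 0 x) - econv (\<kappa> q i) (G (ext U) i) (max 0 x)" by simp
    show ?thesis unfolding S_def e by (simp add: algebra_simps diff_divide_distrib)
  qed
  have "\<exists>!V. T V = V"
  proof (rule banach_fix_type[of "1/2"])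
    show "\<forall>V U. dist (T V) (T U) \<le> 1 / 2 * dist V U"
    proof (intro allI dist_bound)
      fix V U :: "real \<Rightarrow>\<^sub>C (real^'n)" and x
      let ?V = "apply_bcontfun V" and ?U = "apply_bcontfun U"
      have "\<bar>(TT ?V x - TT ?U x) $ i\<bar> \<le> dist V U / (2 * N)" for i
      proof -
        have "(TT ?V x - TT ?U x) $ i = - (S ?V i x - S ?U i x)" by (simp add: TT_def)
        also have "S ?V i x - S ?U i x = S (\<lambda>x. ?V x - ?U x) i x"
          by (rule S_diff[of _ "norm V" _ "norm U"]) (auto intro: norm_bounded)
        finally have eq: "(TT ?V x - TT ?U x) $ i = - S (\<lambda>x. ?V x - ?U x) i x" .
        have "\<bar>S (\<lambda>x. ?V x - ?U x) i x\<bar> \<le> dist V U / (2 * N)"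
          by (rule S_bound) (auto intro!: continuous_intros simp: dist_norm[symmetric] dist_bounded)
        then show ?thesis unfolding eq by simp
      qed
      then have "(\<Sum>i\<in>UNIV. \<bar>(TT ?V x - TT ?U x) $ i\<bar>) \<le> (\<Sum>i\<in>(UNIV::'n set). dist V U / (2 * N))"
        by (intro sum_mono)
      also have "\<dots> = dist V U / 2" using N by (simp add: N_def)
      finally show "dist (apply_bcontfun (T V) x) (apply_bcontfun (T U) x) \<le> 1 / 2 * dist V U"
        using norm_le_l1_cart[of "TT ?V x - TT ?U x"] by (simp add: T_apply dist_norm)
    qed
  qed auto
  then obtain V where V: "T V = V" by blast
  let ?V = "apply_bcontfun V"
  have fix_eq: "?V x = TT ?V x" for x using T_apply[of V] V by simp
  have eb: "exp_bounded (ext ?V k)" for k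
    by (intro ext_eb[of _ "norm V"] norm_bounded continuous_on_apply_bcontfun)
  have eq: "ext ?V i x = exp (\<kappa> q i * x) * v i - econv (\<kappa> q i) (G (ext ?V) i) x / p i" if "0 \<le> x" for i x
  proof -
    have "ext ?V i x = exp (\<beta> * x) * (TT ?V x $ i)" using that by (simp add: ext_def flip: fix_eq)
    also have "\<dots> = (exp (\<beta> * x) * exp (- \<beta> * x)) *
        (exp (\<kappa> q i * x) * v i - econv (\<kappa> q i) (G (ext ?V) i) x / p i)"
      using that by (simp add: TT_def S_def max_absorb2 algebra_simps)
    also have "exp (\<beta> * x) * exp (- \<beta> * x) = 1" by (simp add: mult_exp_exp)
    finally show ?thesis by simp
  qed
  have eq0: "ext ?V i 0 = v i" for i
    by (subst eq) (simp_all add: econv_0 exp_bounded_G eb)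
  have "sol q (ext ?V)" unfolding sol_def eq0 using eb eq by blast
  moreover have "ext ?V i x = 0" if "x < 0" for i x using that by (simp add: ext_def)
  ultimately show ?thesis using eq0 by blast
qed

section \<open>Transforms of solutions and the scale matrix\<close>

definition Fm :: "real \<Rightarrow> real \<Rightarrow> real^'n^'n" where
  "Fm q \<alpha> = (\<chi> i j. (if i = j then p i * \<alpha> - r i - q else 0) + m i j * laplace (\<mu> i j) \<alpha>)"

definition Qm :: "real \<Rightarrow> real^'n^'n" where
  "Qm q = (\<chi> i j. m i j - (if i = j then r i + q else 0))"

text \<open>Here \<open>Fm q\<close> and \<open>Qm q\<close> are F - q I and Q - q I written in
  event rates. Subtracting b makes the function vanish below 0, so that \<open>LT_conv\<close>
  applies; the constant b itself passes through \<open>G\<close> as a constant and has transform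
  b/\<alpha>, which produces the term with \<open>Qm\<close>.\<close>

lemma LT_sol:
  assumes f: "sol q f" and neg: "\<And>k x. x < 0 \<Longrightarrow> f k x = b $ k" and q: "0 \<le> q"
  shows "\<forall>\<^sub>F \<alpha> in at_top. Fm q \<alpha> *v (\<chi> i. LT (\<lambda>x. f i x - b $ i) \<alpha>) =
    (\<chi> i. p i * (f i 0 - b $ i) - (Qm q *v b) $ i / \<alpha>)"
proof -
  define v where "v k x = f k x - b $ k" for k x
  have v: "exp_bounded (v k)" for k
    unfolding v_def by (intro exp_bounded_diff sol_exp_bounded[OF f] exp_bounded_const)
  have v_neg: "v k x = 0" if "x < 0" for k x using neg that by (simp add: v_def)
  have "\<forall>\<^sub>F \<alpha> in at_top. (Fm q \<alpha> *v (\<chi> i. LT (v i) \<alpha>)) $ i =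
    p i * (f i 0 - b $ i) - (Qm q *v b) $ i / \<alpha>" for i
  proof -
    define M where "M = (\<Sum>k\<in>UNIV. m i k * b $ k)"
    have Gf: "G f i = (\<lambda>y. G v i y + M)"
    proof
      fix y
      have "G f i y = G (\<lambda>k x. 1 * v k x + 1 * b $ k) i y" by (simp add: v_def)
      also have "\<dots> = 1 * G v i y + 1 * G (\<lambda>k x. b $ k) i y" by (intro G_lincomb v exp_bounded_const)
      finally show "G f i y = G v i y + M" by (simp add: G_const M_def)
    qed
    have GM: "exp_bounded (\<lambda>y. G v i y + M)" by (intro exp_bounded_add exp_bounded_G v exp_bounded_const)
    let ?e = "\<lambda>x. f i 0 * exp (\<kappa> q i * x)" and ?c = "\<lambda>x. (1 / p i) * econv (\<kappa> q i) (\<lambda>y. G v i y + M) x"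
    have eb: "exp_bounded ?e" "exp_bounded ?c"
      by (intro exp_bounded_cmult exp_bounded_exp \<kappa>_nonneg q, intro exp_bounded_cmult exp_bounded_econv GM)
    have v_eq: "v i x = (?e x - ?c x) - b $ i" if "0 \<le> x" for x
      unfolding v_def Gf[symmetric] by (subst sol_eq[OF f that]) simp
    have "\<forall>\<^sub>F \<alpha> in at_top. LT (\<lambda>x. (?e x - ?c x) - b $ i) \<alpha> = LT (\<lambda>x. ?e x - ?c x) \<alpha> - LT (\<lambda>_. b $ i) \<alpha>"
      by (intro LT_diff exp_bounded_diff eb exp_bounded_const)
    moreover have "\<forall>\<^sub>F \<alpha> in at_top. LT (\<lambda>x. ?e x - ?c x) \<alpha> = LT ?e \<alpha> - LT ?c \<alpha>"
      by (intro LT_diff eb)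
    moreover have "\<forall>\<^sub>F \<alpha> in at_top. LT (econv (\<kappa> q i) (\<lambda>y. G v i y + M)) \<alpha> = LT (\<lambda>y. G v i y + M) \<alpha> / (\<alpha> - \<kappa> q i)"
      by (rule LT_econv[OF GM])
    moreover have "\<forall>\<^sub>F \<alpha> in at_top. LT (\<lambda>y. G v i y + M) \<alpha> = LT (G v i) \<alpha> + LT (\<lambda>_. M) \<alpha>"
      by (intro LT_add exp_bounded_G v exp_bounded_const)
    moreover have "\<forall>\<^sub>F \<alpha> in at_top. LT (G v i) \<alpha> = (\<Sum>k\<in>UNIV. LT (\<lambda>y. m i k * (\<integral>c. v k (y - c) \<partial>\<mu> i k)) \<alpha>)"
      unfolding G_def[abs_def] by (intro LT_sum exp_bounded_cmult exp_bounded_conv v) auto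
    moreover have "\<forall>\<^sub>F \<alpha> in at_top. \<forall>k\<in>UNIV. LT (\<lambda>y. \<integral>c. v k (y - c) \<partial>\<mu> i k) \<alpha> = laplace (\<mu> i k) \<alpha> * LT (v k) \<alpha>"
      by (intro eventually_ball_finite) (auto intro!: LT_conv v v_neg)
    ultimately show ?thesis
      using eventually_gt_at_top[of "\<kappa> q i"] eventually_gt_at_top[of 0]
    proof eventually_elim
      case (elim \<alpha>)
      have "LT (v i) \<alpha> = LT (\<lambda>x. (?e x - ?c x) - b $ i) \<alpha>" by (intro LT_cong v_eq)
      also have "\<dots> = f i 0 / (\<alpha> - \<kappa> q i) - (1 / p i) * ((LT (G v i) \<alpha> + M / \<alpha>) / (\<alpha> - \<kappa> q i)) - b $ i / \<alpha>"
        using elim by (simp only: LT_cmult LT_exp LT_const) simp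
      finally have 1: "LT (v i) \<alpha> = f i 0 / (\<alpha> - \<kappa> q i) - (1 / p i) * ((LT (G v i) \<alpha> + M / \<alpha>) / (\<alpha> - \<kappa> q i)) - b $ i / \<alpha>" .
      have "p i * (\<alpha> - \<kappa> q i) * LT (v i) \<alpha> = p i * f i 0 - (LT (G v i) \<alpha> + M / \<alpha>) - p i * (\<alpha> - \<kappa> q i) * (b $ i / \<alpha>)"
      proof -
        have "P * a * (F / a - (1 / P) * (X / a) - B) = P * F - X - P * a * B" if "0 < P" "0 < a" for P a F X B :: real
          using that by (simp add: field_simps)
        from this[of "p i" "\<alpha> - \<kappa> q i"] show ?thesis using elim(7) p_pos[of i] unfolding 1 by simp
      qed
      moreover have "p i * (\<alpha> - \<kappa> q i) = p i * \<alpha> - r i - q" using p_pos[of i] by (simp add: \<kappa>_def field_simps)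
      ultimately have 2: "(p i * \<alpha> - r i - q) * LT (v i) \<alpha> + LT (G v i) \<alpha> =
          p i * f i 0 - M / \<alpha> - (p i * \<alpha> - r i - q) * (b $ i / \<alpha>)" by simp
      have 3: "LT (G v i) \<alpha> = (\<Sum>k\<in>UNIV. m i k * laplace (\<mu> i k) \<alpha> * LT (v k) \<alpha>)"
        using elim(5,6) by (simp add: LT_cmult mult.assoc)
      have "(Fm q \<alpha> *v (\<chi> i. LT (v i) \<alpha>)) $ i = (p i * \<alpha> - r i - q) * LT (v i) \<alpha> + LT (G v i) \<alpha>"
      proof -
        have "(Fm q \<alpha> *v (\<chi> i. LT (v i) \<alpha>)) $ i = (\<Sum>k\<in>UNIV.
            (if i = k then (p i * \<alpha> - r i - q) * LT (v k) \<alpha> else 0) + m i k * laplace (\<mu> i k) \<alpha> * LT (v k) \<alpha>)"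
          unfolding Fm_def matrix_vector_mult_def by (auto simp: distrib_right intro!: sum.cong)
        then show ?thesis unfolding 3 by (simp add: sum.distrib)
      qed
      moreover have "(Qm q *v b) $ i = M - (r i + q) * b $ i"
      proof -
        have "(Qm q *v b) $ i = (\<Sum>k\<in>UNIV. m i k * b $ k - (if i = k then (r i + q) * b $ k else 0))"
          unfolding Qm_def matrix_vector_mult_def by (auto simp: left_diff_distrib intro!: sum.cong)
        then show ?thesis by (simp add: sum_subtractf M_def)
      qed
      moreover have "p i * f i 0 - M / \<alpha> - (p i * \<alpha> - r i - q) * (b $ i / \<alpha>) =
          p i * (f i 0 - b $ i) - (M - (r i + q) * b $ i) / \<alpha>"
        using elim(8) by (simp add: field_simps)
      ultimately show ?case using 2 by simp
    qed
  qed
  then have "\<forall>\<^sub>F \<alpha> in at_top. \<forall>i\<in>UNIV. (Fm q \<alpha> *v (\<chi> i. LT (v i) \<alpha>)) $ i =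
    p i * (f i 0 - b $ i) - (Qm q *v b) $ i / \<alpha>"
    by (intro eventually_ball_finite) auto
  then show ?thesis by eventually_elim (simp add: vec_eq_iff v_def[abs_def])
qed

text \<open>The initial values are those for which p_i f_i(0) is the j-th unit vector. With zero
  data below 0, \<open>LT_sol\<close> then says that \<open>Fm\<close> maps the transform to that
  unit vector, so the columns together invert \<open>Fm\<close>.\<close>

definition Wcol :: "real \<Rightarrow> 'n \<Rightarrow> 'n \<Rightarrow> real \<Rightarrow> real" where
  "Wcol q j = (SOME f. sol q f \<and> (\<forall>i x. x < 0 \<longrightarrow> f i x = 0) \<and> (\<forall>i. f i 0 = (if i = j then 1 / p i else 0)))"

definition W :: "real \<Rightarrow> real \<Rightarrow> real^'n^'n" where
  "W q x = (\<chi> i j. Wcol q j i x)"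

lemma Wcol:
  assumes "0 \<le> q"
  shows "sol q (Wcol q j)" "x < 0 \<Longrightarrow> Wcol q j i x = 0" "Wcol q j i 0 = (if i = j then 1 / p i else 0)"
  using someI_ex[OF sol_exists[OF assms, of "\<lambda>i. if i = j then 1 / p i else 0"]]
  unfolding Wcol_def by auto

lemma sol_W:
  assumes "0 \<le> q" shows "sol q (\<lambda>i x. (W q x *v c) $ i)"
  using sol_sum[of UNIV q "Wcol q" "\<lambda>j. c $ j"] Wcol[OF assms]
  by (simp add: W_def matrix_vector_mult_def mult.commute)

lemma W_neg: "0 \<le> q \<Longrightarrow> x < 0 \<Longrightarrow> W q x = 0"
  by (simp add: W_def Wcol vec_eq_iff)

lemma W_0: "0 \<le> q \<Longrightarrow> W q 0 = (\<chi> i j. if i = j then 1 / p i else 0)"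
  by (simp add: W_def Wcol vec_eq_iff)

definition LTW :: "real \<Rightarrow> real \<Rightarrow> real^'n^'n" where
  "LTW q \<alpha> = (\<chi> i j. LT (\<lambda>x. W q x $ i $ j) \<alpha>)"

lemma LTW:
  assumes "0 \<le> q"
  shows "\<forall>\<^sub>F \<alpha> in at_top. Fm q \<alpha> ** LTW q \<alpha> = mat 1 \<and> LTW q \<alpha> ** Fm q \<alpha> = mat 1"
proof -
  have "\<forall>\<^sub>F \<alpha> in at_top. \<forall>j\<in>UNIV. Fm q \<alpha> *v (\<chi> i. LT (\<lambda>x. Wcol q j i x - (0 :: real^'n) $ i) \<alpha>) =
    (\<chi> i. p i * (Wcol q j i 0 - (0 :: real^'n) $ i) - (Qm q *v 0) $ i / \<alpha>)"
    using assms by (intro eventually_ball_finite ballI LT_sol Wcol) (auto simp: Wcol)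
  then show ?thesis
  proof eventually_elim
    case (elim \<alpha>)
    have "(Fm q \<alpha> ** LTW q \<alpha>) $ i $ j = mat 1 $ i $ j" for i j
    proof -
      have "(Fm q \<alpha> *v (\<chi> i. LT (Wcol q j i) \<alpha>)) $ i = (if i = j then 1 else 0)"
        using elim[rule_format, of j] p_pos[of j] assms by (simp add: Wcol)
      then show ?thesis
        by (simp add: matrix_matrix_mult_def matrix_vector_mult_def LTW_def W_def mat_def)
    qed
    then have "Fm q \<alpha> ** LTW q \<alpha> = mat 1" by (simp add: vec_eq_iff)
    then show ?case using matrix_left_right_inverse[of "LTW q \<alpha>" "Fm q \<alpha>"] by simp
  qed
qed

lemma exp_bounded_W: "0 \<le> q \<Longrightarrow> exp_bounded (\<lambda>x. W q x $ i $ j)"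
  unfolding W_def using sol_exp_bounded[OF Wcol(1)] by simp

lemma W_continuous: "0 \<le> q \<Longrightarrow> continuous_on {0..} (\<lambda>x. W q x $ i $ j)"
  unfolding W_def using sol_continuous[OF Wcol(1)] by simp

text \<open>Applying the inverse \<open>LTW\<close> to \<open>LT_sol\<close> leaves the transform of
  W times a constant vector, minus the same with a factor 1/\<alpha>. That factor is integration
  from 0, that is, \<open>econv\<close> with rate 0. For b a unit vector, b minus the last sum is a
  column of Z.\<close>

lemma sol_representation:
  assumes f: "sol q f" and neg: "\<And>k x. x < 0 \<Longrightarrow> f k x = b $ k" and q: "0 \<le> q" and x: "0 \<le> x"
  shows "f i x = b $ i + (W q x *v (\<chi> j. p j * (f j 0 - b $ j))) $ i
    - (\<Sum>j\<in>UNIV. integral {0..x} (\<lambda>y. W q y $ i $ j) * (Qm q *v b) $ j)"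
proof -
  let ?c = "\<lambda>j. p j * (f j 0 - b $ j)" and ?d = "\<lambda>j. (Qm q *v b) $ j"
  let ?w = "\<lambda>j x. W q x $ i $ j"
  let ?h = "\<lambda>j x. ?c j * ?w j x - ?d j * econv 0 (?w j) x"
  have ebh: "exp_bounded (?h j)" for j
    by (intro exp_bounded_diff exp_bounded_cmult exp_bounded_econv exp_bounded_W q)
  have ebf: "exp_bounded (\<lambda>x. f i x - b $ i)"
    by (intro exp_bounded_diff exp_bounded_const sol_exp_bounded[OF f])
  have "f i x - b $ i = (\<Sum>j\<in>UNIV. ?h j x)"
  proof (rule exp_bounded_LT_unique[OF ebf exp_bounded_sum[OF ebh] _ _ _ x])
    show "continuous_on {0..} (\<lambda>x. f i x - b $ i)" by (intro continuous_intros sol_continuous[OF f])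
    show "continuous_on {0..} (\<lambda>x. \<Sum>j\<in>UNIV. ?h j x)"
      by (intro continuous_intros W_continuous continuous_on_econv exp_bounded_W q)
    have "\<forall>\<^sub>F \<alpha> in at_top. LT (\<lambda>x. \<Sum>j\<in>UNIV. ?h j x) \<alpha> = (\<Sum>j\<in>UNIV. LT (?h j) \<alpha>)"
      by (intro LT_sum ebh) auto
    moreover have "\<forall>\<^sub>F \<alpha> in at_top. \<forall>j\<in>UNIV. LT (?h j) \<alpha> =
        LT (\<lambda>x. ?c j * ?w j x) \<alpha> - LT (\<lambda>x. ?d j * econv 0 (?w j) x) \<alpha>"
      by (intro eventually_ball_finite ballI LT_diff exp_bounded_cmult exp_bounded_econv exp_bounded_W q) auto
    moreover have "\<forall>\<^sub>F \<alpha> in at_top. \<forall>j\<in>UNIV. LT (econv 0 (?w j)) \<alpha> = LT (?w j) \<alpha> / (\<alpha> - 0)"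
      by (intro eventually_ball_finite ballI LT_econv exp_bounded_W q) auto
    moreover have "\<forall>\<^sub>F \<alpha> in at_top. Fm q \<alpha> *v (\<chi> i. LT (\<lambda>x. f i x - b $ i) \<alpha>) = (\<chi> i. ?c i - ?d i / \<alpha>)"
      by (rule LT_sol[OF f _ q]) (rule neg)
    ultimately show "\<forall>\<^sub>F \<alpha> in at_top. LT (\<lambda>x. f i x - b $ i) \<alpha> = LT (\<lambda>x. \<Sum>j\<in>UNIV. ?h j x) \<alpha>"
      using LTW[OF q]
    proof eventually_elim
      case (elim \<alpha>)
      let ?v = "\<chi> i. LT (\<lambda>x. f i x - b $ i) \<alpha>"
      have "?v = (LTW q \<alpha> ** Fm q \<alpha>) *v ?v" using elim(5) by simp
      also have "\<dots> = LTW q \<alpha> *v (\<chi> i. ?c i - ?d i / \<alpha>)"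
        using elim(4) by (simp only: matrix_vector_mul_assoc[symmetric])
      finally have "?v $ i = (LTW q \<alpha> *v (\<chi> i. ?c i - ?d i / \<alpha>)) $ i" by (rule arg_cong)
      also have "\<dots> = (\<Sum>j\<in>UNIV. LT (?w j) \<alpha> * (?c j - ?d j / \<alpha>))"
        by (simp add: matrix_vector_mult_def LTW_def)
      also have "\<dots> = (\<Sum>j\<in>UNIV. LT (?h j) \<alpha>)"
      proof (intro sum.cong refl)
        fix j
        have "LT (?h j) \<alpha> = ?c j * LT (?w j) \<alpha> - ?d j * (LT (?w j) \<alpha> / (\<alpha> - 0))"
          using elim(2,3) by (simp only: LT_cmult) simp
        then show "LT (?w j) \<alpha> * (?c j - ?d j / \<alpha>) = LT (?h j) \<alpha>" by (simp add: algebra_simps)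
      qed
      finally show ?case using elim(1) by simp
    qed
  qed
  also have "\<dots> = (W q x *v (\<chi> j. ?c j)) $ i - (\<Sum>j\<in>UNIV. integral {0..x} (?w j) * ?d j)"
    by (simp add: matrix_vector_mult_def econv_0_eq exp_bounded_W q sum_subtractf mult.commute)
  finally show ?thesis by simp
qed

end

section \<open>The minimum principle\<close>

lemma matrix_inv_inverse:
  fixes A :: "'a::semiring_1^'n^'m"
  assumes "invertible A"
  shows "A ** matrix_inv A = mat 1" "matrix_inv A ** A = mat 1"
  using someI_ex[OF assms[unfolded invertible_def]] unfolding matrix_inv_def by auto

lemma matrix_inv_eqI:
  fixes A :: "'a::semiring_1^'n^'m"
  assumes "A ** B = mat 1" "B ** A = mat 1"
  shows "matrix_inv A = B"
proof -
  have "invertible A" using assms unfolding invertible_def by blast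
  then have "matrix_inv A = matrix_inv A ** (A ** B)" by (simp add: assms)
  also have "\<dots> = B" using matrix_inv_inverse(2)[OF \<open>invertible A\<close>] by (simp add: matrix_mul_assoc)
  finally show ?thesis .
qed

lemma has_integral_exp_Icc:
  fixes k :: real
  assumes "x \<le> a"
  shows "((\<lambda>y. k * exp (- k * (y - x))) has_integral (1 - exp (- k * (a - x)))) {x..a}"
proof -
  have "((\<lambda>y. k * exp (- k * (y - x))) has_integral (- exp (- k * (a - x)) - (- exp (- k * (x - x))))) {x..a}"
    using assms by (intro fundamental_theorem_of_calculus)
       (auto intro!: derivative_eq_intros simp: has_real_derivative_iff_has_vector_derivative[symmetric])
  then show ?thesis by simp
qed

lemma exp_bounded_integrable_on:
  assumes "exp_bounded g"
  shows "(\<lambda>y. exp (c * (y - x)) * g y) integrable_on {x..a}"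
  by (rule integral_Icc_eq_HK(1)[OF exp_bounded_integrable_Icc[OF assms]])

context volterra begin

text \<open>Started at x in state i, the process climbs to a without an event, discounted, with
  weight e^(-\<kappa>(a - x)), and then the value at a counts; otherwise the first event occurs at a
  level y in between. All weights are nonnegative, which makes comparison possible.\<close>

definition Bk :: "real \<Rightarrow> real \<Rightarrow> ('n \<Rightarrow> real \<Rightarrow> real) \<Rightarrow> 'n \<Rightarrow> real \<Rightarrow> real" where
  "Bk q a f i x = exp (- \<kappa> q i * (a - x)) * f i a +
     integral {x..a} (\<lambda>y. exp (- \<kappa> q i * (y - x)) * G f i y) / p i"

text \<open>The initial value \<open>f i 0\<close> is eliminated between the forward equation at x
  and the one at a.\<close>

lemma sol_Bk:
  assumes f: "sol q f" and x: "0 \<le> x" "x \<le> a"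
  shows "Bk q a f i x = f i x"
proof -
  let ?k = "\<kappa> q i" and ?g = "\<lambda>y. exp (- \<kappa> q i * y) * G f i y"
  have eb: "exp_bounded (G f i)" by (intro exp_bounded_G sol_exp_bounded[OF f])
  have "integral {x..a} (\<lambda>y. exp (- ?k * (y - x)) * G f i y) = integral {x..a} (\<lambda>y. exp (?k * x) * ?g y)"
    by (simp add: algebra_simps mult_exp_exp flip: mult.assoc)
  also have "\<dots> = exp (?k * x) * integral {x..a} ?g" by (rule integral_mult_right)
  also have "integral {x..a} ?g = integral {0..a} ?g - integral {0..x} ?g"
    using Henstock_Kurzweil_Integration.integral_combine[OF x econv_eq_HK(2)[OF eb, of ?k]] by simp
  finally have 1: "integral {x..a} (\<lambda>y. exp (- ?k * (y - x)) * G f i y) =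
     exp (?k * x) * (integral {0..a} ?g - integral {0..x} ?g)" .
  have fa: "f i a = exp (?k * a) * (f i 0 - integral {0..a} ?g / p i)"
    using x by (subst sol_eq[OF f]) (auto simp: econv_eq_HK(1)[OF eb] algebra_simps)
  have "exp (- ?k * (a - x)) * f i a = exp (?k * x) * (f i 0 - integral {0..a} ?g / p i)"
    unfolding fa mult.assoc[symmetric] mult_exp_exp by (simp add: algebra_simps)
  moreover have "f i x = exp (?k * x) * (f i 0 - integral {0..x} ?g / p i)"
    using x by (subst sol_eq[OF f]) (auto simp: econv_eq_HK(1)[OF eb] algebra_simps)
  ultimately show ?thesis unfolding Bk_def 1 by (simp add: algebra_simps diff_divide_distrib)
qed

lemma Bk_diff:
  assumes "\<And>k. exp_bounded (f k)" "\<And>k. exp_bounded (g k)"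
  shows "Bk q a (\<lambda>k x. f k x - g k x) i x = Bk q a f i x - Bk q a g i x"
proof -
  have "G (\<lambda>k x. f k x - g k x) i y = G f i y - G g i y" for y
    using G_lincomb[where a = 1 and b = "- 1" and f = f and g = g] assms by simp
  then have "integral {x..a} (\<lambda>y. exp (- \<kappa> q i * (y - x)) * G (\<lambda>k x. f k x - g k x) i y) =
    integral {x..a} (\<lambda>y. exp (- \<kappa> q i * (y - x)) * G f i y - exp (- \<kappa> q i * (y - x)) * G g i y)"
    by (simp add: right_diff_distrib)
  also have "\<dots> = integral {x..a} (\<lambda>y. exp (- \<kappa> q i * (y - x)) * G f i y) -
      integral {x..a} (\<lambda>y. exp (- \<kappa> q i * (y - x)) * G g i y)"
    by (intro integral_diff exp_bounded_integrable_on exp_bounded_G assms)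
  finally have e: "integral {x..a} (\<lambda>y. exp (- \<kappa> q i * (y - x)) * G (\<lambda>k x. f k x - g k x) i y) =
      integral {x..a} (\<lambda>y. exp (- \<kappa> q i * (y - x)) * G f i y) -
      integral {x..a} (\<lambda>y. exp (- \<kappa> q i * (y - x)) * G g i y)" .
  show ?thesis unfolding Bk_def e by (simp add: right_diff_distrib diff_divide_distrib)
qed

lemma r_le_\<kappa>: "0 \<le> q \<Longrightarrow> r i / p i \<le> \<kappa> q i"
  unfolding \<kappa>_def using p_pos[of i] by (simp add: divide_right_mono)

text \<open>A lower bound \<open>- M\<close> improves to \<open>- \<theta> M\<close> with a fixed \<open>\<theta> < 1\<close>, hence to \<open>0\<close>.\<close>

lemma minimum_principle:
  assumes eb: "\<And>i. exp_bounded (f i)" and q: "0 \<le> q"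
    and super: "\<And>i x. 0 \<le> x \<Longrightarrow> x \<le> a \<Longrightarrow> Bk q a f i x \<le> f i x"
    and fa: "\<And>i. 0 \<le> f i a" and neg: "\<And>i x. x < 0 \<Longrightarrow> 0 \<le> f i x"
    and x: "0 \<le> x" "x \<le> a"
  shows "0 \<le> f i x"
proof -
  obtain M where M: "0 \<le> M" "\<And>i x. x \<le> a \<Longrightarrow> - M \<le> f i x"
  proof -
    have "\<exists>M\<ge>0. \<forall>x\<le>a. - M \<le> f i x" for i
    proof -
      obtain B \<beta> where B: "0 \<le> B" "0 \<le> \<beta>" "\<And>x. \<bar>f i x\<bar> \<le> B * exp (\<beta> * max 0 x)"
        using exp_boundedE[OF eb[of i]] by metis
      have "- (B * exp (\<beta> * max 0 a)) \<le> f i y" if "y \<le> a" for y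
      proof -
        have "\<bar>f i y\<bar> \<le> B * exp (\<beta> * max 0 y)" by (rule B)
        also have "\<dots> \<le> B * exp (\<beta> * max 0 a)" using B that by (auto intro!: mult_left_mono)
        finally show ?thesis by linarith
      qed
      then show ?thesis using B by (intro exI[of _ "B * exp (\<beta> * max 0 a)"]) auto
    qed
    then obtain m where m: "\<And>i. 0 \<le> m i" "\<And>i x. x \<le> a \<Longrightarrow> - m i \<le> f i x" by metis
    have le: "m i \<le> (\<Sum>i\<in>UNIV. m i)" for i using m by (intro member_le_sum) auto
    have "- (\<Sum>i\<in>UNIV. m i) \<le> f i x" if "x \<le> a" for i x
      using m(2)[OF that, of i] le[of i] by linarith
    then show ?thesis using m by (intro that[of "\<Sum>i\<in>UNIV. m i"] sum_nonneg) auto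
  qed
  \<comment> \<open>The complement 1 - \<theta> is a lower bound, uniform in i and in 0 <= x <= a,
    for the weight e^(-\<kappa>(a - x)) of the value at a. That value is nonnegative, so at most the
    fraction \<theta> of the bound is inherited.\<close>
  define \<theta> where "\<theta> = 1 - exp (- (\<Sum>i\<in>UNIV. \<kappa> q i) * a)"
  have \<theta>: "0 \<le> \<theta>" "\<theta> < 1"
    using x \<kappa>_nonneg[OF q] by (auto simp: \<theta>_def intro!: mult_nonneg_nonneg sum_nonneg)
  have step: "- (\<theta> * M) \<le> f i x" if M: "0 \<le> M" "\<And>i x. x \<le> a \<Longrightarrow> - M \<le> f i x" and xa: "x \<le> a" for M i x
  proof (cases "x < 0")
    case True
    have "- (\<theta> * M) \<le> 0" using \<theta> M(1) by simp
    then show ?thesis using neg[OF True, of i] by linarith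
  next
    case False
    let ?k = "\<kappa> q i"
    have Gge: "- (M * r i) \<le> G f i y" if "y \<le> a" for y
    proof -
      have "G (\<lambda>k x. - M) i y \<le> G f i y" using that by (intro G_mono eb exp_bounded_const M(2)) auto
      moreover have "G (\<lambda>k x. - M) i y = - (M * r i)"
        unfolding G_const r_def by (simp add: sum_negf sum_distrib_left mult.commute)
      ultimately show ?thesis by simp
    qed
    \<comment> \<open>The true kernel has density (r_i / p_i) e^(-\<kappa>(y - x)). Replacing r_i /
      p_i by the larger \<kappa> makes its integral explicit.\<close>
    have int: "(\<lambda>y. ?k * exp (- ?k * (y - x))) integrable_on {x..a}"
      "integral {x..a} (\<lambda>y. ?k * exp (- ?k * (y - x))) = 1 - exp (- ?k * (a - x))"
      using has_integral_exp_Icc[OF xa, of ?k] by (auto simp: has_integral_iff)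
    have "- M * (1 - exp (- ?k * (a - x))) = integral {x..a} (\<lambda>y. - M * (?k * exp (- ?k * (y - x))))"
      using int by simp
    also have "\<dots> \<le> integral {x..a} (\<lambda>y. (1 / p i) * (exp (- ?k * (y - x)) * G f i y))"
    proof (rule integral_le)
      show "(\<lambda>y. - M * (?k * exp (- ?k * (y - x)))) integrable_on {x..a}"
        by (intro integrable_on_mult_right int)
      show "(\<lambda>y. (1 / p i) * (exp (- ?k * (y - x)) * G f i y)) integrable_on {x..a}"
        by (intro integrable_on_mult_right exp_bounded_integrable_on exp_bounded_G eb)
      fix y assume y: "y \<in> {x..a}"
      have "- M * ?k \<le> - M * (r i / p i)" using mult_left_mono[OF r_le_\<kappa>[OF q, of i] M(1)] by simp
      also have "\<dots> = (1 / p i) * (- (M * r i))" by simp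
      also have "\<dots> \<le> (1 / p i) * G f i y" using y Gge[of y] p_pos[of i] by (intro mult_left_mono) auto
      finally have "(- M * ?k) * exp (- ?k * (y - x)) \<le> (1 / p i) * G f i y * exp (- ?k * (y - x))"
        by (intro mult_right_mono) auto
      then show "- M * (?k * exp (- ?k * (y - x))) \<le> (1 / p i) * (exp (- ?k * (y - x)) * G f i y)"
        by (simp add: mult_ac)
    qed
    also have "\<dots> = integral {x..a} (\<lambda>y. exp (- ?k * (y - x)) * G f i y) / p i"
      by (subst integral_mult_right) simp
    finally have 1: "- M * (1 - exp (- ?k * (a - x))) \<le> integral {x..a} (\<lambda>y. exp (- ?k * (y - x)) * G f i y) / p i" .
    have "?k \<le> (\<Sum>i\<in>UNIV. \<kappa> q i)" using \<kappa>_nonneg[OF q] by (intro member_le_sum) auto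
    then have "?k * (a - x) \<le> (\<Sum>i\<in>UNIV. \<kappa> q i) * a"
      using False xa \<kappa>_nonneg[OF q] by (intro mult_mono sum_nonneg) auto
    then have "1 - exp (- ?k * (a - x)) \<le> \<theta>" by (simp add: \<theta>_def)
    then have 2: "M * (1 - exp (- ?k * (a - x))) \<le> \<theta> * M"
      using M(1) by (metis mult.commute mult_left_mono)
    have "Bk q a f i x \<le> f i x" using False xa by (intro super) auto
    moreover have "0 \<le> exp (- ?k * (a - x)) * f i a" using fa[of i] by simp
    ultimately show ?thesis using 1 2 unfolding Bk_def by linarith
  qed
  have iter: "\<forall>i. \<forall>x\<le>a. - (\<theta> ^ n * M) \<le> f i x" for n
  proof (induction n)
    case (Suc n)
    then show ?case using step[of "\<theta> ^ n * M"] \<theta> M(1) by (auto simp: mult.assoc)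
  qed (use M in auto)
  have "(\<lambda>n. - (\<theta> ^ n * M)) \<longlonglongrightarrow> - (0 * M)"
    using \<theta> by (intro tendsto_intros LIMSEQ_realpow_zero) auto
  moreover have "\<forall>n. - (\<theta> ^ n * M) \<le> f i x" using iter x by blast
  ultimately show ?thesis using LIMSEQ_le_const2[of "\<lambda>n. - (\<theta> ^ n * M)"] by fastforce
qed

text \<open>A barrier for the discounted event of reaching a. The condition on \<epsilon> leaves a
  rate \<kappa> - \<epsilon> that still dominates r_i / p_i, so the integrand lies below an explicit
  kernel of rate \<kappa> - \<epsilon>, and the terminal term fills up the remaining mass
  exactly.\<close>

lemma Bk_exp_le:
  assumes \<epsilon>: "0 \<le> \<epsilon>" "\<And>i. \<epsilon> * p i \<le> q" and x: "0 \<le> x" "x \<le> a"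
  shows "Bk q a (\<lambda>_ x. exp (- \<epsilon> * (a - x))) i x \<le> exp (- \<epsilon> * (a - x))"
proof -
  let ?E = "\<lambda>x. exp (- \<epsilon> * (a - x))" and ?k = "\<kappa> q i"
  have eb: "exp_bounded ?E"
    using exp_bounded_cmult[OF exp_bounded_exp[OF \<epsilon>(1)], of "exp (- \<epsilon> * a)"]
    by (simp add: mult_exp_exp algebra_simps)
  have GE: "G (\<lambda>_. ?E) i y \<le> r i * ?E y" for y
  proof -
    have "G (\<lambda>_. ?E) i y \<le> G (\<lambda>_ _. ?E y) i y"
      using \<epsilon> by (intro G_mono eb exp_bounded_const) (auto intro: mult_left_mono)
    then show ?thesis by (simp add: G_const r_def sum_distrib_right)
  qed
  let ?d = "?k - \<epsilon>"
  have d: "r i / p i \<le> ?d" using \<epsilon>(2)[of i] p_pos[of i] by (simp add: \<kappa>_def field_simps)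
  have int: "(\<lambda>y. ?d * exp (- ?d * (y - x))) integrable_on {x..a}"
    "integral {x..a} (\<lambda>y. ?d * exp (- ?d * (y - x))) = 1 - exp (- ?d * (a - x))"
    using has_integral_exp_Icc[OF x(2), of ?d] by (auto simp: has_integral_iff)
  have "integral {x..a} (\<lambda>y. exp (- ?k * (y - x)) * G (\<lambda>_. ?E) i y) / p i =
     integral {x..a} (\<lambda>y. (1 / p i) * (exp (- ?k * (y - x)) * G (\<lambda>_. ?E) i y))"
    by (subst integral_mult_right) simp
  also have "\<dots> \<le> integral {x..a} (\<lambda>y. ?E x * (?d * exp (- ?d * (y - x))))"
  proof (rule integral_le)
    show "(\<lambda>y. (1 / p i) * (exp (- ?k * (y - x)) * G (\<lambda>_. ?E) i y)) integrable_on {x..a}"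
      by (intro integrable_on_mult_right exp_bounded_integrable_on exp_bounded_G eb)
    show "(\<lambda>y. ?E x * (?d * exp (- ?d * (y - x)))) integrable_on {x..a}"
      by (intro integrable_on_mult_right int)
    fix y
    have "(1 / p i) * (exp (- ?k * (y - x)) * G (\<lambda>_. ?E) i y) \<le> (1 / p i) * (exp (- ?k * (y - x)) * (r i * ?E y))"
      using GE[of y] p_pos[of i] by (intro mult_left_mono) auto
    also have "\<dots> = (r i / p i) * (exp (- ?k * (y - x)) * ?E y)" by simp
    also have "\<dots> \<le> ?d * (exp (- ?k * (y - x)) * ?E y)" by (intro mult_right_mono d) auto
    also have "exp (- ?k * (y - x)) * ?E y = ?E x * exp (- ?d * (y - x))"
      by (simp add: mult_exp_exp algebra_simps)
    finally show "(1 / p i) * (exp (- ?k * (y - x)) * G (\<lambda>_. ?E) i y) \<le> ?E x * (?d * exp (- ?d * (y - x)))"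
      by (simp add: mult_ac)
  qed
  also have "\<dots> = ?E x * (1 - exp (- ?d * (a - x)))" using int by simp
  also have "\<dots> = ?E x - exp (- ?k * (a - x))" by (simp add: algebra_simps mult_exp_exp)
  finally show ?thesis unfolding Bk_def by simp
qed

section \<open>Invertibility of the scale matrix and the limit of its inverse against phi\<close>

lemma W_0_mult: "0 \<le> q \<Longrightarrow> (W q 0 *v c) $ i = c $ i / p i"
  by (simp add: W_0 matrix_vector_mult_def if_distrib if_distribR cong: if_cong)

text \<open>If W(a) d = 0, then x -> W(x) d is a solution with zero values at a and below 0, so the
  minimum principle gives W(0) d >= 0. Applied to c and -c this forces W(0) c = 0, and W(0) is
  diagonal with positive entries.\<close>

lemma W_injective:
  assumes q: "0 \<le> q" and a: "0 \<le> a" and "W q a *v c = 0"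
  shows "c = 0"
proof -
  have nonneg: "0 \<le> (W q 0 *v d) $ i" if "W q a *v d = 0" for d i
  proof (rule minimum_principle[OF _ q, where f = "\<lambda>i x. (W q x *v d) $ i" and a = a])
    show "exp_bounded (\<lambda>x. (W q x *v d) $ i)" for i by (rule sol_exp_bounded[OF sol_W[OF q]])
    show "Bk q a (\<lambda>i x. (W q x *v d) $ i) i x \<le> (W q x *v d) $ i" if "0 \<le> x" "x \<le> a" for i x
      using sol_Bk[OF sol_W[OF q] that] by simp
  qed (use that a W_neg[OF q] in auto)
  have "(W q 0 *v c) $ i = 0" for i
    using nonneg[of c i] nonneg[of "0 - c" i] assms(3) by (simp only: matrix_vector_mult_diff_distrib) simp
  then show ?thesis using p_pos by (simp add: W_0_mult[OF q] vec_eq_iff less_imp_neq[symmetric])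
qed

lemma W_invertible: "0 \<le> q \<Longrightarrow> 0 \<le> a \<Longrightarrow> invertible (W q a)"
  using W_injective matrix_left_invertible_ker invertible_left_inverse by blast

text \<open>One column of the ruin transform is treated at a time: \<open>b\<close> is its data
  below 0, and \<open>lim\<close> is right continuity in the discount rate.\<close>

lemma matrix_inv_W_tendsto_0:
  fixes \<phi> :: "real \<Rightarrow> 'n \<Rightarrow> real \<Rightarrow> real"
  assumes q: "0 \<le> q"
    and sol: "\<And>s. 0 \<le> s \<Longrightarrow> sol s (\<phi> s)"
    and neg: "\<And>s i x. 0 \<le> s \<Longrightarrow> x < 0 \<Longrightarrow> \<phi> s i x = b i"
    and bounds: "\<And>s i x. 0 \<le> s \<Longrightarrow> 0 \<le> \<phi> s i x \<and> \<phi> s i x \<le> 1"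
    and lim: "\<And>i. (\<lambda>n. \<phi> (q + inverse (real (Suc n))) i 0) \<longlonglongrightarrow> \<phi> q i 0"
  shows "((\<lambda>a. matrix_inv (W q a) *v (\<chi> i. \<phi> q i a)) \<longlongrightarrow> 0) at_top"
proof -
  \<comment> \<open>Probabilistically, \<open>g\<close> is the part of phi due to paths that reach a
    before ruin, and \<open>h\<close> below the part due to ruin before a. Both are handled through
    their boundary values alone: \<open>g\<close> is phi at a and 0 below 0, \<open>h\<close> is 0
    at a and \<open>b\<close> below 0.\<close>
  define g where "g s a i x = (W s x *v (matrix_inv (W s a) *v (\<chi> k. \<phi> s k a))) $ i" for s a i x
  have sol_g: "sol s (g s a)" if "0 \<le> s" for s a unfolding g_def by (rule sol_W[OF that])
  have g_a: "g s a i a = \<phi> s i a" if "0 \<le> s" "0 \<le> a" for s a i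
    using W_invertible[OF that] by (simp add: g_def matrix_vector_mul_assoc matrix_inv_inverse)
  have g_neg: "g s a i x = 0" if "0 \<le> s" "x < 0" for s a i x
    using W_neg[OF that] by (simp add: g_def)
  have g_nonneg: "0 \<le> g s a i x" if "0 \<le> s" "0 \<le> x" "x \<le> a" for s a i x
    by (rule minimum_principle[of "g s a" s a])
       (use that bounds[of s] in \<open>auto simp: sol_exp_bounded[OF sol_g] sol_Bk[OF sol_g] g_a g_neg\<close>)
  define h where "h s a i x = \<phi> s i x - g s a i x" for s a i x
  have sol_h: "sol s (h s a)" if "0 \<le> s" for s a
    using sol_lincomb[OF sol[OF that] sol_g[OF that], of 1 "- 1" a] by (simp add: h_def[abs_def])
  have h_a: "h s a i a = 0" if "0 \<le> s" "0 \<le> a" for s a i using g_a[OF that] by (simp add: h_def)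
  have h_neg: "h s a i x = b i" if "0 \<le> s" "x < 0" for s a i x using neg g_neg that by (simp add: h_def)
  have b: "0 \<le> b i" for i using neg[of 0 "-1" i] bounds[of 0 i "-1"] by simp
  have h_nonneg: "0 \<le> h s a i x" if "0 \<le> s" "0 \<le> x" "x \<le> a" for s a i x
    by (rule minimum_principle[of "h s a" s a])
       (use that b in \<open>auto simp: sol_exp_bounded[OF sol_h] sol_Bk[OF sol_h] h_a h_neg\<close>)
  \<comment> \<open>Since \<open>h\<close> is nonnegative and vanishes at a, lowering the rate from
    s to q enlarges the kernel: \<open>h s a\<close> lies below its image under \<open>Bk q\<close>.
    The difference of the two \<open>h\<close> is then a supersolution for q with zero boundary
    values.\<close>
  have h_mono: "h s a i 0 \<le> h q a i 0" if s: "q \<le> s" and a: "0 \<le> a" for s a i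
  proof -
    have s0: "0 \<le> s" using q s by simp
    have "0 \<le> h q a i 0 - h s a i 0"
    proof (rule minimum_principle[OF _ q, where f = "\<lambda>i x. h q a i x - h s a i x" and a = a])
      show "exp_bounded (\<lambda>x. h q a i x - h s a i x)" for i
        by (intro exp_bounded_diff sol_exp_bounded[OF sol_h] q s0)
      fix i x assume x: "0 \<le> (x::real)" "x \<le> a"
      have h_nonneg': "0 \<le> h s a k y" if "y \<le> a" for k y
        using h_nonneg[OF s0, of y a k] h_neg[OF s0, of y a k] b[of k] that by (cases "y < 0") auto
      have G_nonneg: "0 \<le> G (h s a) i y" if "y \<le> a" for y
        using G_mono[of "\<lambda>_ _. 0" "h s a" y i] h_nonneg' that
        by (simp add: G_const sol_exp_bounded[OF sol_h[OF s0]])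
      have "h s a i x = Bk s a (h s a) i x" using sol_Bk[OF sol_h[OF s0] x] by simp
      also have "\<dots> = integral {x..a} (\<lambda>y. exp (- \<kappa> s i * (y - x)) * G (h s a) i y) / p i"
        using h_a[OF s0 a] by (simp add: Bk_def)
      also have "\<dots> \<le> integral {x..a} (\<lambda>y. exp (- \<kappa> q i * (y - x)) * G (h s a) i y) / p i"
      proof (intro divide_right_mono integral_le exp_bounded_integrable_on exp_bounded_G
          sol_exp_bounded[OF sol_h[OF s0]])
        fix y assume y: "y \<in> {x..a}"
        have "\<kappa> q i \<le> \<kappa> s i" unfolding \<kappa>_def using s p_pos[of i] by (intro divide_right_mono) auto
        then have "\<kappa> q i * (y - x) \<le> \<kappa> s i * (y - x)" using y by (intro mult_right_mono) auto
        then show "exp (- \<kappa> s i * (y - x)) * G (h s a) i y \<le> exp (- \<kappa> q i * (y - x)) * G (h s a) i y"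
          using y G_nonneg[of y] by (intro mult_right_mono) auto
      qed (use p_pos[of i] in auto)
      also have "\<dots> = Bk q a (h s a) i x" using h_a[OF s0 a] by (simp add: Bk_def)
      finally have "Bk q a (h q a) i x - Bk q a (h s a) i x \<le> h q a i x - h s a i x"
        using sol_Bk[OF sol_h[OF q] x] by simp
      then show "Bk q a (\<lambda>i x. h q a i x - h s a i x) i x \<le> h q a i x - h s a i x"
        by (subst Bk_diff) (auto intro: sol_exp_bounded[OF sol_h] q s0)
    qed (use a h_a h_neg q s0 in auto)
    then show ?thesis by simp
  qed
  \<comment> \<open>The barrier equals 1 at a, where \<open>g\<close> is phi <= 1, and is positive
    below 0, where \<open>g\<close> vanishes. The difference thus meets the boundary conditions of
    the minimum principle.\<close>
  have g_le: "g s a i 0 \<le> exp (- \<epsilon> * a)" if \<epsilon>: "0 \<le> \<epsilon>" "\<And>i. \<epsilon> * p i \<le> s" and s: "0 \<le> s" and a: "0 \<le> a" for s a \<epsilon> i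
  proof -
    have eb: "exp_bounded (\<lambda>x. exp (- \<epsilon> * (a - x)))"
      using exp_bounded_cmult[OF exp_bounded_exp[OF \<epsilon>(1)], of "exp (- \<epsilon> * a)"]
      by (simp add: mult_exp_exp algebra_simps)
    have "0 \<le> exp (- \<epsilon> * (a - 0)) - g s a i 0"
    proof (rule minimum_principle[OF _ s, where f = "\<lambda>i x. exp (- \<epsilon> * (a - x)) - g s a i x" and a = a])
      show "exp_bounded (\<lambda>x. exp (- \<epsilon> * (a - x)) - g s a i x)" for i
        by (intro exp_bounded_diff eb sol_exp_bounded[OF sol_g] s)
      fix i x assume x: "0 \<le> (x::real)" "x \<le> a"
      show "Bk s a (\<lambda>i x. exp (- \<epsilon> * (a - x)) - g s a i x) i x \<le> exp (- \<epsilon> * (a - x)) - g s a i x"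
        using eb Bk_exp_le[OF \<epsilon> x, of i] sol_Bk[OF sol_g[OF s] x, of a i]
        by (subst Bk_diff) (auto intro: eb sol_exp_bounded[OF sol_g[OF s]])
    qed (use a g_a[OF s a] bounds[OF s] g_neg[OF s] in auto)
    then show ?thesis by simp
  qed
  have g_lim: "((\<lambda>a. g q a i 0) \<longlongrightarrow> 0) at_top" for i
  proof (rule tendstoI)
    fix e :: real assume e: "0 < e"
    have "\<forall>\<^sub>F n in sequentially. dist (\<phi> (q + inverse (real (Suc n))) i 0) (\<phi> q i 0) < e / 2"
      using tendstoD[OF lim, of "e / 2" i] e by simp
    then obtain n where n: "dist (\<phi> (q + inverse (real (Suc n))) i 0) (\<phi> q i 0) < e / 2"
      using eventually_happens'[OF sequentially_bot] by blast
    define s where "s = q + inverse (real (Suc n))"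
    have s: "0 < s" "q \<le> s" using q by (auto simp: s_def add_nonneg_pos)
    \<comment> \<open>The sum of the premium rates stands in for their maximum, so that \<epsilon>
      p_k <= s for every state at once.\<close>
    define \<epsilon> where "\<epsilon> = s / (\<Sum>i\<in>UNIV. p i)"
    have p_le: "p k \<le> (\<Sum>i\<in>UNIV. p i)" for k using p_pos by (intro member_le_sum) (auto intro: less_imp_le)
    have P: "0 < (\<Sum>i\<in>UNIV. p i)" using p_le[of undefined] p_pos[of undefined] by linarith
    have \<epsilon>: "0 < \<epsilon>" "\<epsilon> * p k \<le> s" for k
      using s P p_le[of k] by (auto simp: \<epsilon>_def field_simps intro: mult_left_mono)
    have "((\<lambda>a. exp (- \<epsilon> * a)) \<longlongrightarrow> 0) at_top" using \<epsilon>
      by (intro filterlim_compose[OF exp_at_bot] filterlim_tendsto_neg_mult_at_bot[of _ "-\<epsilon>"])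
         (auto intro: filterlim_ident tendsto_const)
    then have "\<forall>\<^sub>F a in at_top. dist (exp (- \<epsilon> * a)) 0 < e / 2" using e by (intro tendstoD) auto
    then show "\<forall>\<^sub>F a in at_top. dist (g q a i 0) 0 < e"
      using eventually_ge_at_top[of 0]
    proof eventually_elim
      case (elim a)
      have "g q a i 0 \<le> \<phi> q i 0 - \<phi> s i 0 + g s a i 0"
        using h_mono[OF s(2) elim(2), of i] by (simp add: h_def)
      also have "\<dots> \<le> \<phi> q i 0 - \<phi> s i 0 + exp (- \<epsilon> * a)"
        using g_le[of \<epsilon> s a i] \<epsilon> s elim(2) by (simp add: less_imp_le)
      also have "\<dots> < e / 2 + e / 2"
        using n[folded s_def] elim(1) unfolding dist_real_def by linarith
      finally show ?case using g_nonneg[OF q, of 0 a i] elim(2) by (simp add: dist_real_def)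
    qed
  qed
  have "((\<lambda>a. \<chi> i. p i * g q a i 0) \<longlongrightarrow> (\<chi> i. p i * 0)) at_top"
    by (intro tendsto_intros g_lim)
  moreover have "(\<chi> i. p i * g q a i 0) = matrix_inv (W q a) *v (\<chi> i. \<phi> q i a)" for a
    using p_pos by (simp add: vec_eq_iff g_def W_0_mult[OF q] less_imp_neq[symmetric])
  ultimately show ?thesis by (simp add: zero_vec_def)
qed

end

section \<open>Paths of the risk process\<close>

text \<open>The level rises between events, so ruin from x >= 0 can happen only at an event, and the
  embedded chain suffices to detect it.\<close>

definition ruin_index :: "('n \<Rightarrow> real) \<Rightarrow> 'n sample \<Rightarrow> real \<Rightarrow> 'n \<Rightarrow> nat" where
  "ruin_index p \<omega> x i = (LEAST k. ev_level p \<omega> x i k < 0)"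

text \<open>Finiteness of the event time matters: after an infinite holding time
  \<open>ev_level\<close> goes on with \<open>real_of_ereal\<close> of infinity, which is 0, and
  subtracts a claim, so the chain may turn negative at an event that never takes place.\<close>

definition ruin_value :: "('n \<Rightarrow> real) \<Rightarrow> real \<Rightarrow> 'n sample \<Rightarrow> real \<Rightarrow> 'n \<Rightarrow> 'n \<Rightarrow> real" where
  "ruin_value p q \<omega> x i j =
     (if (\<exists>k. ev_level p \<omega> x i k < 0) \<and> ev_time \<omega> i (ruin_index p \<omega> x i) < \<infinity> \<and>
         ev_state \<omega> i (ruin_index p \<omega> x i) = j
      then exp (- q * real_of_ereal (ev_time \<omega> i (ruin_index p \<omega> x i))) else 0)"

definition pos_holds :: "'n sample \<Rightarrow> bool" where
  "pos_holds \<omega> \<longleftrightarrow> (\<forall>k s. 0 < fst (\<omega> k s))"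

lemma ev_time_Suc_ge:
  assumes "pos_holds \<omega>"
  shows "ev_time \<omega> i k \<le> ev_time \<omega> i (Suc k)"
  using ereal_le_add_self[of "fst (\<omega> k (ev_state \<omega> i k))" "ev_time \<omega> i k"] assms
  unfolding pos_holds_def ev_time.simps by (meson less_imp_le)

lemma ev_time_mono: "pos_holds \<omega> \<Longrightarrow> k \<le> l \<Longrightarrow> ev_time \<omega> i k \<le> ev_time \<omega> i l"
  by (rule lift_Suc_mono_le[of "ev_time \<omega> i", OF ev_time_Suc_ge])

lemma ev_time_nonneg: "pos_holds \<omega> \<Longrightarrow> 0 \<le> ev_time \<omega> i k"
  using ev_time_mono[of \<omega> 0 k i] by simp

lemma ev_time_Suc_gt: "pos_holds \<omega> \<Longrightarrow> ev_time \<omega> i k < \<infinity> \<Longrightarrow> ev_time \<omega> i k < ev_time \<omega> i (Suc k)"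
proof -
  assume "pos_holds \<omega>" and fin: "ev_time \<omega> i k < \<infinity>"
  then have h: "0 < fst (\<omega> k (ev_state \<omega> i k))" unfolding pos_holds_def by blast
  have "0 \<le> ev_time \<omega> i k" by (rule ev_time_nonneg) fact
  then show ?thesis using h fin
    by (cases "ev_time \<omega> i k"; cases "fst (\<omega> k (ev_state \<omega> i k))") auto
qed

lemma ev_level_start: "ev_level p \<omega> x i k = x + ev_level p \<omega> 0 i k"
  by (induction k) auto

text \<open>Under a sample with one draw prepended, the chain after its first event is the chain of
  the remaining sample started from the new state. This and the two lemmas below are the pathwise
  form of the Markov property at the first event.\<close>

lemma ev_state_case_nat: "ev_state (case_nat d \<omega>) i (Suc k) = ev_state \<omega> (fst (snd (d i))) k"
  by (induction k) auto

lemma ev_time_case_nat: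
  "ev_time (case_nat d \<omega>) i (Suc k) = fst (d i) + ev_time \<omega> (fst (snd (d i))) k"
proof (induction k)
  case (Suc k)
  then show ?case using ev_state_case_nat[of d \<omega> i k] by (simp add: add.assoc)
qed simp

lemma ev_level_case_nat:
  "ev_level p (case_nat d \<omega>) x i (Suc k) =
    ev_level p \<omega> (x + p i * real_of_ereal (fst (d i)) - claim_at (d i) i) (fst (snd (d i))) k"
proof (induction k)
  case (Suc k)
  then show ?case using ev_state_case_nat[of d \<omega> i k] by simp
qed simp

lemma ruin_value_neg: "x < 0 \<Longrightarrow> ruin_value p q \<omega> x i j = (if i = j then 1 else 0)"
proof -
  assume x: "x < 0"
  then have "ruin_index p \<omega> x i = 0" unfolding ruin_index_def by (intro Least_equality) auto
  moreover have "\<exists>k. ev_level p \<omega> x i k < 0" using x by (intro exI[of _ 0]) simp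
  ultimately show ?thesis unfolding ruin_value_def by auto
qed

text \<open>For x >= 0 the index 0 is not ruinous, so the ruin index is a successor and shifts by
  one. Event times add, hence the discount factors multiply; an infinite first holding time makes
  both sides 0.\<close>

lemma ruin_value_step:
  assumes x: "0 \<le> x" and "pos_holds \<omega>" and h: "0 < fst (d i)"
  shows "ruin_value p q (case_nat d \<omega>) x i j =
    (if fst (d i) < \<infinity> then exp (- q * real_of_ereal (fst (d i))) else 0) *
    ruin_value p q \<omega> (x + p i * real_of_ereal (fst (d i)) - claim_at (d i) i) (fst (snd (d i))) j"
proof -
  let ?w = "case_nat d \<omega>" and ?y = "x + p i * real_of_ereal (fst (d i)) - claim_at (d i) i"
  let ?s = "fst (snd (d i))"
  have ex: "(\<exists>k. ev_level p ?w x i k < 0) \<longleftrightarrow> (\<exists>k. ev_level p \<omega> ?y ?s k < 0)"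
  proof
    assume "\<exists>k. ev_level p ?w x i k < 0"
    then obtain k where k: "ev_level p ?w x i k < 0" by blast
    then obtain k' where "k = Suc k'" using x by (cases k) auto
    then show "\<exists>k. ev_level p \<omega> ?y ?s k < 0" using k ev_level_case_nat by metis
  qed (metis ev_level_case_nat)
  show ?thesis
  proof (cases "\<exists>k. ev_level p \<omega> ?y ?s k < 0")
    case True
    then obtain k where "ev_level p ?w x i k < 0" using ex by blast
    then have "ruin_index p ?w x i = Suc (LEAST k. ev_level p ?w x i (Suc k) < 0)"
      unfolding ruin_index_def using x by (intro Least_Suc) auto
    then have K: "ruin_index p ?w x i = Suc (ruin_index p \<omega> ?y ?s)"
      unfolding ruin_index_def by (simp only: ev_level_case_nat)
    let ?T = "ev_time \<omega> ?s (ruin_index p \<omega> ?y ?s)"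
    have T: "0 \<le> ?T" by (rule ev_time_nonneg) fact
    have "fst (d i) + ?T < \<infinity> \<longleftrightarrow> fst (d i) < \<infinity> \<and> ?T < \<infinity>" by auto
    moreover have "exp (- q * real_of_ereal (fst (d i) + ?T)) =
        exp (- q * real_of_ereal (fst (d i))) * exp (- q * real_of_ereal ?T)"
      if "fst (d i) < \<infinity>" "?T < \<infinity>"
      using that T h by (cases "fst (d i)"; cases ?T) (auto simp: mult_exp_exp algebra_simps)
    ultimately show ?thesis
      unfolding ruin_value_def K ev_time_case_nat ev_state_case_nat using True ex by auto
  next
    case False
    then show ?thesis using ex unfolding ruin_value_def by auto
  qed
qed

lemma ruin_value_bounds:
  assumes "pos_holds \<omega>" "0 \<le> q"
  shows "0 \<le> ruin_value p q \<omega> x i j" "ruin_value p q \<omega> x i j \<le> 1"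
  using ev_time_nonneg[OF assms(1)] assms(2)
  by (auto simp: ruin_value_def real_of_ereal_pos)

text \<open>At time t the process is at least at the level left by the last event up to t, so no
  negative value precedes the first ruinous event. Non-explosion ensures that the
  \<open>LEAST\<close> in \<open>ev_index\<close> ranges over a nonempty set.\<close>

lemma ruin_value_eq_ruin_time:
  assumes x: "0 \<le> x" and pos: "pos_holds \<omega>" and p: "\<And>s. 0 < p s"
    and noexp: "\<And>t. \<exists>k. ereal t < ev_time \<omega> i (Suc k)"
  shows "(if ruin_time p \<omega> x i < \<infinity> \<and> Jproc \<omega> i (real_of_ereal (ruin_time p \<omega> x i)) = j
       then exp (- q * real_of_ereal (ruin_time p \<omega> x i)) else 0) = ruin_value p q \<omega> x i j"
proof -
  let ?T = "ev_time \<omega> i" and ?K = "ruin_index p \<omega> x i"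
  have idx: "?T (ev_index \<omega> i t) \<le> ereal t" "ereal t < ?T (Suc (ev_index \<omega> i t))" if "0 \<le> t" for t
  proof -
    show "ereal t < ?T (Suc (ev_index \<omega> i t))"
      unfolding ev_index_def by (rule LeastI_ex[OF noexp])
    show "?T (ev_index \<omega> i t) \<le> ereal t"
    proof (cases "ev_index \<omega> i t")
      case (Suc k)
      then have "k < (LEAST k. ereal t < ?T (Suc k))" unfolding ev_index_def by simp
      then have "\<not> ereal t < ?T (Suc k)" by (rule not_less_Least)
      then show ?thesis using Suc by simp
    qed (use that in simp)
  qed
  have X_ge: "ev_level p \<omega> x i (ev_index \<omega> i t) \<le> Xproc p \<omega> x i t" if "0 \<le> t" for t
  proof -
    have "0 \<le> ?T (ev_index \<omega> i t)" by (rule ev_time_nonneg[OF pos])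
    then have "real_of_ereal (?T (ev_index \<omega> i t)) \<le> t" using idx(1)[OF that]
      by (cases "?T (ev_index \<omega> i t)") auto
    then show ?thesis unfolding Xproc_def using p[of "Jproc \<omega> i t"] by simp
  qed
  show ?thesis
  proof (cases "(\<exists>k. ev_level p \<omega> x i k < 0) \<and> ?T ?K < \<infinity>")
    case True
    have "\<exists>k. ev_level p \<omega> x i k < 0" using True by blast
    from LeastI_ex[OF this] have K: "ev_level p \<omega> x i ?K < 0" unfolding ruin_index_def .
    define t0 where "t0 = real_of_ereal (?T ?K)"
    have "0 \<le> ?T ?K" by (rule ev_time_nonneg[OF pos])
    then have T: "?T ?K = ereal t0" "0 \<le> t0"
      using True unfolding t0_def by (auto simp: ereal_real real_of_ereal_pos)
    \<comment> \<open>Finite event times increase strictly, so the ruinous event is the last one at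
      or before its own time, and \<open>Jproc\<close> at ruin shows the state after that
      event.\<close>
    have idx_K: "ev_index \<omega> i t0 = ?K"
      unfolding ev_index_def
    proof (rule Least_equality)
      show "ereal t0 < ?T (Suc ?K)" using ev_time_Suc_gt[OF pos, of i ?K] True T by simp
      fix l assume "ereal t0 < ?T (Suc l)"
      then have "\<not> Suc l \<le> ?K" using ev_time_mono[OF pos, of "Suc l" ?K i] T by auto
      then show "?K \<le> l" by simp
    qed
    have "ruin_time p \<omega> x i = ereal t0"
      unfolding ruin_time_def
    proof (rule antisym)
      have "Xproc p \<omega> x i t0 < 0" using K T by (simp add: Xproc_def Jproc_def idx_K)
      then show "Inf (ereal ` {t. 0 \<le> t \<and> Xproc p \<omega> x i t < 0}) \<le> ereal t0"
        using T by (intro Inf_lower) auto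
      show "ereal t0 \<le> Inf (ereal ` {t. 0 \<le> t \<and> Xproc p \<omega> x i t < 0})"
      proof (intro Inf_greatest, clarify)
        fix t assume t: "0 \<le> t" "Xproc p \<omega> x i t < 0"
        then have "ev_level p \<omega> x i (ev_index \<omega> i t) < 0" using X_ge[of t] by simp
        then have "?K \<le> ev_index \<omega> i t" unfolding ruin_index_def by (rule Least_le)
        then have "?T ?K \<le> ?T (ev_index \<omega> i t)" by (rule ev_time_mono[OF pos])
        also have "\<dots> \<le> ereal t" by (rule idx(1)[OF t(1)])
        finally show "ereal t0 \<le> ereal t" unfolding T(1) .
      qed
    qed
    then show ?thesis using True T idx_K by (simp add: ruin_value_def Jproc_def)
  next
    case False
    have "\<not> (0 \<le> t \<and> Xproc p \<omega> x i t < 0)" for t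
    proof
      assume t: "0 \<le> t \<and> Xproc p \<omega> x i t < 0"
      then have neg: "ev_level p \<omega> x i (ev_index \<omega> i t) < 0" using X_ge[of t] by simp
      then have "?K \<le> ev_index \<omega> i t" unfolding ruin_index_def by (rule Least_le)
      then have "?T ?K \<le> ?T (ev_index \<omega> i t)" by (rule ev_time_mono[OF pos])
      also have "\<dots> \<le> ereal t" using t by (intro idx(1)) simp
      also have "\<dots> < \<infinity>" by simp
      finally show False using False neg by blast
    qed
    then have e: "{t. 0 \<le> t \<and> Xproc p \<omega> x i t < 0} = {}" by blast
    have "ruin_time p \<omega> x i = \<infinity>" unfolding ruin_time_def e by (simp add: top_ereal_def)
    then show ?thesis using False by (auto simp: ruin_value_def)
  qed
qed

section \<open>Measurability of paths and of the ruin time\<close>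

abbreviation draw_space :: "(ereal \<times> 'n::finite \<times> real \<times> ('n \<Rightarrow> real)) measure" where
  "draw_space \<equiv> borel \<Otimes>\<^sub>M (count_space UNIV \<Otimes>\<^sub>M (borel \<Otimes>\<^sub>M (\<Pi>\<^sub>M j\<in>UNIV. borel)))"

text \<open>Only the sigma-algebra is recorded, so that measurability of the paths is proved
  independently of rates and claim laws; \<open>sets_sample\<close> transfers it to the actual
  law.\<close>

abbreviation seq_space :: "'n::finite sample measure" where
  "seq_space \<equiv> \<Pi>\<^sub>M k\<in>UNIV. \<Pi>\<^sub>M i\<in>UNIV. draw_space"

lemma measurable_draw [measurable]: "(\<lambda>\<omega>. \<omega> k s) \<in> measurable seq_space draw_space"
  by (rule measurable_compose[where f = "\<lambda>\<omega>. \<omega> k" and g = "\<lambda>d. d s"])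
     (rule measurable_component_singleton; simp)+

lemma measurable_claim_at [measurable]:
  fixes s :: "'n::finite"
  shows "(\<lambda>d. claim_at d s) \<in> borel_measurable draw_space"
proof -
  have 1: "(\<lambda>d. snd (snd (snd d)) j) \<in> borel_measurable draw_space" for j :: 'n by measurable
  have "(\<lambda>d. snd (snd (snd d)) (fst (snd d) :: 'n)) \<in> borel_measurable draw_space"
    by (rule measurable_compose_countable[where f = "\<lambda>j d. snd (snd (snd d)) j", OF 1]) measurable
  note [measurable] = this
  have "(\<lambda>d. claim_at d s) = (\<lambda>d. if fst (snd d) = s then fst (snd (snd d)) else snd (snd (snd d)) (fst (snd d)))"
    by (auto simp: claim_at_def split: prod.split)
  then show ?thesis by simp
qed

lemma measurable_ev_state [measurable]:
  "(\<lambda>\<omega>. ev_state \<omega> i k) \<in> measurable seq_space (count_space UNIV)"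
proof (induction k)
  case (Suc k)
  have "(\<lambda>\<omega>. fst (snd (\<omega> k (ev_state \<omega> i k)))) \<in> measurable seq_space (count_space UNIV)"
    by (rule measurable_compose_countable[where f = "\<lambda>s \<omega>. fst (snd (\<omega> k s))", OF _ Suc]) measurable
  then show ?case by simp
qed simp

lemma measurable_current_draw [measurable]:
  "(\<lambda>\<omega>. \<omega> k (ev_state \<omega> i k)) \<in> measurable seq_space draw_space"
  by (rule measurable_compose_countable[where f = "\<lambda>s \<omega>. \<omega> k s"]) measurable

lemma measurable_ev_time [measurable]: "(\<lambda>\<omega>. ev_time \<omega> i k) \<in> borel_measurable seq_space"
  by (induction k) auto

lemma measurable_ev_level [measurable]: "(\<lambda>\<omega>. ev_level p \<omega> x i k) \<in> borel_measurable seq_space"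
proof (induction k)
  case (Suc k)
  have "(\<lambda>\<omega>. claim_at (\<omega> k (ev_state \<omega> i k)) (ev_state \<omega> i k)) \<in> borel_measurable seq_space"
    by (rule measurable_compose_countable[where f = "\<lambda>s \<omega>. claim_at (\<omega> k (ev_state \<omega> i k)) s"]) measurable
  moreover have "(\<lambda>\<omega>. p (ev_state \<omega> i k)) \<in> borel_measurable seq_space" by measurable
  ultimately show ?case using Suc by simp
qed simp

text \<open>Measurability is joint with the starting level, because phi must become a measurable
  function of x. The shift \<open>ev_level_start\<close> isolates x as a summand.\<close>

lemma measurable_ruin_value:
  "(\<lambda>z. ruin_value p q (snd z) (fst z) i j) \<in> borel_measurable (borel \<Otimes>\<^sub>M seq_space)"
proof -
  have lev [measurable]: "(\<lambda>z. ev_level p (snd z) (fst z) i k) \<in> borel_measurable (borel \<Otimes>\<^sub>M seq_space)" for k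
    by (subst ev_level_start) measurable
  have idx [measurable]: "(\<lambda>z. ruin_index p (snd z) (fst z) i) \<in> measurable (borel \<Otimes>\<^sub>M seq_space) (count_space UNIV)"
    unfolding ruin_index_def by measurable
  have [measurable]: "(\<lambda>z. ev_time (snd z) i (ruin_index p (snd z) (fst z) i)) \<in> borel_measurable (borel \<Otimes>\<^sub>M seq_space)"
    by (rule measurable_compose_countable[where f = "\<lambda>k z. ev_time (snd z) i k", OF _ idx]) measurable
  have [measurable]: "(\<lambda>z. ev_state (snd z) i (ruin_index p (snd z) (fst z) i)) \<in> measurable (borel \<Otimes>\<^sub>M seq_space) (count_space UNIV)"
    by (rule measurable_compose_countable[where f = "\<lambda>k z. ev_state (snd z) i k", OF _ idx]) measurable
  show ?thesis unfolding ruin_value_def by measurable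
qed

text \<open>As t grows fewer indices qualify, so the least one at t stays least for as long as it
  qualifies. If none qualifies at t, none does later, and both \<open>LEAST\<close> terms range over
  the same empty predicate; thus explosive paths are covered too.\<close>

lemma ev_index_right_constant:
  "\<exists>z>t. \<forall>t'. t \<le> t' \<and> t' < z \<longrightarrow> ev_index \<omega> i t' = ev_index \<omega> i t"
proof (cases "\<exists>k. ereal t < ev_time \<omega> i (Suc k)")
  case True
  let ?K = "ev_index \<omega> i t"
  have K: "ereal t < ev_time \<omega> i (Suc ?K)" unfolding ev_index_def by (rule LeastI_ex[OF True])
  then obtain z where z: "t < z" "ereal z < ev_time \<omega> i (Suc ?K)" using ereal_dense2[OF K] by (auto simp del: ev_time.simps)
  have "ev_index \<omega> i t' = ?K" if "t \<le> t'" "t' < z" for t'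
  proof -
    have "(LEAST k. ereal t' < ev_time \<omega> i (Suc k)) = ?K"
    proof (rule Least_equality)
      have "ereal t' < ereal z" using that by simp
      also have "\<dots> < ev_time \<omega> i (Suc ?K)" by (rule z(2))
      finally show "ereal t' < ev_time \<omega> i (Suc ?K)" .
      fix l assume l: "ereal t' < ev_time \<omega> i (Suc l)"
      have "ereal t \<le> ereal t'" using that by simp
      also note l
      finally show "?K \<le> l" unfolding ev_index_def by (rule Least_le)
    qed
    then show ?thesis unfolding ev_index_def[of \<omega> i t'] .
  qed
  then show ?thesis using z(1) by (intro exI[of _ z] conjI allI impI) (assumption, elim conjE)
next
  case False
  have "ev_index \<omega> i t' = ev_index \<omega> i t" if "t \<le> t'" for t'
  proof -
    have "\<not> ereal t' < ev_time \<omega> i (Suc k)" for k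
    proof
      have "ereal t \<le> ereal t'" using that by simp
      also assume "ereal t' < ev_time \<omega> i (Suc k)"
      finally show False using False by blast
    qed
    then have "(\<lambda>k. ereal t' < ev_time \<omega> i (Suc k)) = (\<lambda>k. ereal t < ev_time \<omega> i (Suc k))"
      using False by blast
    then show ?thesis unfolding ev_index_def by (rule arg_cong[where f = Least])
  qed
  then show ?thesis by (intro exI[of _ "t + 1"] conjI allI impI) (simp, elim conjE)
qed

text \<open>Right continuity of the paths makes the infimum over a countable set sufficient, so that the
  ruin time is measurable on the whole sample space, including its null sets.\<close>

lemma ruin_time_rational:
  "ruin_time p \<omega> x i = (INF t\<in>{t \<in> \<rat>. 0 \<le> t}. if Xproc p \<omega> x i t < 0 then ereal t else \<infinity>)"
    (is "_ = ?I")
proof (rule antisym)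
  show "ruin_time p \<omega> x i \<le> ?I"
    unfolding ruin_time_def by (intro INF_greatest) (auto intro!: Inf_lower)
  show "?I \<le> ruin_time p \<omega> x i"
    unfolding ruin_time_def
  proof (intro Inf_greatest, clarify)
    fix t assume t: "0 \<le> t" "Xproc p \<omega> x i t < 0"
    obtain z where z: "t < z" "\<And>t'. t \<le> t' \<Longrightarrow> t' < z \<Longrightarrow> ev_index \<omega> i t' = ev_index \<omega> i t"
      using ev_index_right_constant[of t \<omega> i] by blast
    \<comment> \<open>The slope at t is at most \<open>?c\<close>, so X stays negative for a time of
      -X / \<open>?c\<close>; the summand 1 keeps the divisor positive whatever the value of
      \<open>p\<close>.\<close>
    let ?c = "\<bar>p (Jproc \<omega> i t)\<bar> + 1"
    define w where "w = min z (t - Xproc p \<omega> x i t / ?c)"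
    have w: "t < w" using z(1) t(2) by (simp add: w_def divide_neg_pos)
    have X: "Xproc p \<omega> x i t' < 0" if "t < t'" "t' < w" for t'
    proof -
      have idx: "ev_index \<omega> i t' = ev_index \<omega> i t" using that by (intro z) (auto simp: w_def)
      have "Xproc p \<omega> x i t' = Xproc p \<omega> x i t + p (Jproc \<omega> i t) * (t' - t)"
        unfolding Xproc_def Jproc_def idx by (simp add: algebra_simps)
      also have "p (Jproc \<omega> i t) * (t' - t) \<le> ?c * (t' - t)" using that by (intro mult_right_mono) auto
      also have "?c * (t' - t) < ?c * (- Xproc p \<omega> x i t / ?c)"
        using that by (intro mult_strict_left_mono) (auto simp: w_def)
      also have "?c * (- Xproc p \<omega> x i t / ?c) = - Xproc p \<omega> x i t" by simp
      finally show ?thesis by simp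
    qed
    show "?I \<le> ereal t"
    proof (rule ccontr)
      assume "\<not> ?I \<le> ereal t"
      then have "ereal t < ?I" by (simp only: not_le)
      then obtain y where y: "ereal t < ereal y" "ereal y < ?I" using ereal_dense2 by blast
      then have "t < y" by simp
      obtain u where u: "u \<in> \<rat>" "t < u" "u < min w y" using Rats_dense_in_real[of t "min w y"] w \<open>t < y\<close> by auto
      then have "?I \<le> (if Xproc p \<omega> x i u < 0 then ereal u else \<infinity>)" using t(1) by (intro INF_lower) auto
      also have "\<dots> = ereal u" using X[of u] u by simp
      also have "\<dots> < ereal y" using u by simp
      finally show False using y(2) by (simp only: less_asym)
    qed
  qed
qed

lemma measurable_ev_index:
  assumes [measurable]: "\<tau> \<in> borel_measurable seq_space"
  shows "(\<lambda>\<omega>. ev_index \<omega> i (\<tau> \<omega>)) \<in> measurable seq_space (count_space UNIV)"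
  unfolding ev_index_def by measurable

lemma measurable_Jproc:
  assumes "\<tau> \<in> borel_measurable seq_space"
  shows "(\<lambda>\<omega>. Jproc \<omega> i (\<tau> \<omega>)) \<in> measurable seq_space (count_space UNIV)"
  unfolding Jproc_def
  by (rule measurable_compose_countable[where f = "\<lambda>k \<omega>. ev_state \<omega> i k", OF _ measurable_ev_index[OF assms]]) measurable

lemma measurable_Xproc [measurable]: "(\<lambda>\<omega>. Xproc p \<omega> x i t) \<in> borel_measurable seq_space"
proof -
  have idx: "(\<lambda>\<omega>. ev_index \<omega> i t) \<in> measurable seq_space (count_space UNIV)"
    by (rule measurable_ev_index) simp
  have [measurable]: "(\<lambda>\<omega>. ev_level p \<omega> x i (ev_index \<omega> i t)) \<in> borel_measurable seq_space"
    by (rule measurable_compose_countable[where f = "\<lambda>k \<omega>. ev_level p \<omega> x i k", OF _ idx]) measurable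
  have [measurable]: "(\<lambda>\<omega>. ev_time \<omega> i (ev_index \<omega> i t)) \<in> borel_measurable seq_space"
    by (rule measurable_compose_countable[where f = "\<lambda>k \<omega>. ev_time \<omega> i k", OF _ idx]) measurable
  have [measurable]: "(\<lambda>\<omega>. Jproc \<omega> i t) \<in> measurable seq_space (count_space UNIV)"
    by (rule measurable_Jproc) simp
  show ?thesis unfolding Xproc_def by measurable
qed

lemma measurable_ruin_time [measurable]: "(\<lambda>\<omega>. ruin_time p \<omega> x i) \<in> borel_measurable seq_space"
  unfolding ruin_time_rational
  by (intro borel_measurable_INF countable_subset[OF _ countable_rat]) (auto, measurable)

section \<open>Holding times and discounting\<close>

lemma prob_space_hold_dist: "prob_space (hold_dist r)"
proof (cases "0 < r")
  case True
  interpret prob_space "density lborel (\<lambda>x. ennreal (exponential_density r x))"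
    using prob_space_exponential_density[OF True] .
  show ?thesis using True unfolding hold_dist_def by (simp add: prob_space_distr)
qed (simp add: hold_dist_def prob_space_return)

lemma sets_hold_dist [measurable_cong, simp]: "sets (hold_dist r) = sets borel"
  by (simp add: hold_dist_def)

lemma AE_hold_pos: "AE h in hold_dist r. 0 < h"
proof (cases "0 < r")
  case True
  have "AE x in lborel. 0 < ennreal (exponential_density r x) \<longrightarrow> 0 < ereal x"
    using AE_lborel_singleton[of 0] by eventually_elim (auto simp: exponential_density_def)
  then show ?thesis using True unfolding hold_dist_def by (simp add: AE_distr_iff AE_density)
next
  case False
  then show ?thesis unfolding hold_dist_def by (simp add: AE_return)
qed

lemma nn_integral_component:
  assumes "\<And>i. prob_space (M i)" "f \<in> borel_measurable (M i)"
  shows "(\<integral>\<^sup>+d. f (d i) \<partial>(\<Pi>\<^sub>M i\<in>UNIV. M i)) = (\<integral>\<^sup>+x. f x \<partial>M i)"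
proof -
  have "(\<integral>\<^sup>+x. f x \<partial>M i) = (\<integral>\<^sup>+x. f x \<partial>distr (\<Pi>\<^sub>M i\<in>UNIV. M i) (M i) (\<lambda>d. d i))"
    using assms by (subst distr_PiM_component) auto
  also have "\<dots> = (\<integral>\<^sup>+d. f (d i) \<partial>(\<Pi>\<^sub>M i\<in>UNIV. M i))"
    using assms by (intro nn_integral_distr) auto
  finally show ?thesis by simp
qed

lemma nn_integral_hold_dist:
  assumes [measurable]: "f \<in> borel_measurable borel"
  shows "0 < r \<Longrightarrow> (\<integral>\<^sup>+h. f h \<partial>hold_dist r) = (\<integral>\<^sup>+t. ennreal (exponential_density r t) * f (ereal t) \<partial>lborel)"
    "\<not> 0 < r \<Longrightarrow> (\<integral>\<^sup>+h. f h \<partial>hold_dist r) = f \<infinity>"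
proof -
  show "(\<integral>\<^sup>+h. f h \<partial>hold_dist r) = (\<integral>\<^sup>+t. ennreal (exponential_density r t) * f (ereal t) \<partial>lborel)" if "0 < r"
    using that unfolding hold_dist_def by (simp add: nn_integral_distr nn_integral_density)
  show "(\<integral>\<^sup>+h. f h \<partial>hold_dist r) = f \<infinity>" if "\<not> 0 < r"
    using that unfolding hold_dist_def by (simp add: nn_integral_return)
qed

text \<open>At infinity the value is 0 even when q = 0, so the factor also records whether the event
  takes place.\<close>

definition discount :: "real \<Rightarrow> ereal \<Rightarrow> real" where
  "discount q h = (if h < \<infinity> then exp (- q * real_of_ereal h) else 0)"

lemma measurable_discount [measurable]: "discount q \<in> borel_measurable borel"
  unfolding discount_def[abs_def] by measurable

lemma discount_nonneg [simp]: "0 \<le> discount q h"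
  by (simp add: discount_def)

lemma discount_ereal [simp]: "discount q (ereal t) = exp (- q * t)"
  by (simp add: discount_def)

lemma discount_infinity [simp]: "discount q \<infinity> = 0"
  by (simp add: discount_def)

lemma pos_holds_discount_ev_time:
  assumes "pos_holds \<omega>" "0 < fst (d i)"
  shows "discount q (ev_time (case_nat d \<omega>) i (Suc n)) =
    discount q (fst (d i)) * discount q (ev_time \<omega> (fst (snd (d i))) n)"
proof -
  have "0 \<le> ev_time \<omega> (fst (snd (d i))) n" by (rule ev_time_nonneg[OF assms(1)])
  then show ?thesis unfolding ev_time_case_nat discount_def using assms(2)
    by (cases "fst (d i)"; cases "ev_time \<omega> (fst (snd (d i))) n") (auto simp: mult_exp_exp algebra_simps)
qed

section \<open>Conditioning on the first event\<close>

locale mmrp =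
  fixes p lam :: "'n::finite \<Rightarrow> real"
    and Q :: "real^'n^'n"
    and FC :: "'n \<Rightarrow> real measure"
    and FCC :: "'n \<Rightarrow> 'n \<Rightarrow> real measure"
  assumes Q_offdiag: "\<And>i j. i \<noteq> j \<Longrightarrow> 0 \<le> Q$i$j"
    and Q_rows: "\<And>i. (\<Sum>j\<in>UNIV. Q$i$j) = 0"
    and p_pos: "\<And>i. 0 < p i"
    and lam_nonneg: "\<And>i. 0 \<le> lam i"
    and FC_prob: "\<And>i. prob_space (FC i)"
    and FC_borel: "\<And>i. sets (FC i) = sets borel"
    and FC_nonneg: "\<And>i. AE c in FC i. 0 \<le> c"
    and FCC_prob: "\<And>i j. i \<noteq> j \<Longrightarrow> prob_space (FCC i j)"
    and FCC_borel: "\<And>i j. i \<noteq> j \<Longrightarrow> sets (FCC i j) = sets borel"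
    and FCC_nonneg: "\<And>i j. i \<noteq> j \<Longrightarrow> AE c in FCC i j. 0 \<le> c"
begin

text \<open>A choice equal to the current state encodes a claim without a jump. With the claim rate
  on the diagonal in place of q_ii, claims and jumps become a single kind of event.\<close>

definition intensity :: "'n \<Rightarrow> 'n \<Rightarrow> real" where
  "intensity i j = (if i = j then lam i else Q$i$j)"

definition claim_dist :: "'n \<Rightarrow> 'n \<Rightarrow> real measure" where
  "claim_dist i j = (if i = j then FC i else FCC i j)"

abbreviation "extra_dist i j \<equiv> (if j = i then return borel (0::real) else FCC i j)"
abbreviation "jump i \<equiv> jump_dist lam Q FC FCC i"
abbreviation "step_space \<equiv> \<Pi>\<^sub>M i\<in>UNIV. jump i"
abbreviation "sample \<equiv> sample_space lam Q FC FCC"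

section \<open>The sample space and its first step\<close>

lemma intensity_nonneg: "0 \<le> intensity i j"
  using Q_offdiag lam_nonneg by (simp add: intensity_def)

lemma sum_intensity: "(\<Sum>j\<in>UNIV. intensity i j) = rate lam Q i"
proof -
  have "intensity i j = Q$i$j + (if i = j then lam i - Q$i$i else 0)" for j
    by (simp add: intensity_def)
  then show ?thesis by (simp add: sum.distrib Q_rows rate_def)
qed

lemma rate_nonneg: "0 \<le> rate lam Q i"
  unfolding sum_intensity[symmetric] by (intro sum_nonneg intensity_nonneg)

lemma claim_dist: "prob_space (claim_dist i j)" "sets (claim_dist i j) = sets borel"
  "AE c in claim_dist i j. 0 \<le> c"
  unfolding claim_dist_def using FC_prob FC_borel FC_nonneg FCC_prob FCC_borel FCC_nonneg
  by (cases "i = j"; simp)+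

lemma sets_choice_dist [measurable_cong, simp]: "sets (choice_dist lam Q i) = sets (count_space UNIV)"
  by (simp add: choice_dist_def)

lemma nn_integral_choice_dist:
  "(\<integral>\<^sup>+j. f j \<partial>choice_dist lam Q i) =
    (if 0 < rate lam Q i then (\<Sum>j\<in>UNIV. ennreal (intensity i j / rate lam Q i) * f j) else f i)"
proof -
  have "(if j = i then lam i else Q $ i $ j) = intensity i j" for j by (simp add: intensity_def)
  then show ?thesis
    by (simp add: choice_dist_def nn_integral_density nn_integral_count_space_finite nn_integral_return)
qed

lemma prob_space_choice_dist: "prob_space (choice_dist lam Q i)"
proof
  have "emeasure (choice_dist lam Q i) (space (choice_dist lam Q i)) = (\<integral>\<^sup>+j. 1 \<partial>choice_dist lam Q i)"
    by simp
  also have "\<dots> = 1"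
  proof (cases "0 < rate lam Q i")
    case True
    have "(\<Sum>j\<in>UNIV. ennreal (intensity i j / rate lam Q i)) = ennreal (\<Sum>j\<in>UNIV. intensity i j / rate lam Q i)"
      using True intensity_nonneg by (intro sum_ennreal) auto
    also have "(\<Sum>j\<in>UNIV. intensity i j / rate lam Q i) = 1"
      using True by (simp add: sum_divide_distrib[symmetric] sum_intensity)
    finally show ?thesis using True unfolding nn_integral_choice_dist by simp
  next
    case False
    then show ?thesis unfolding nn_integral_choice_dist by simp
  qed
  finally show "emeasure (choice_dist lam Q i) (space (choice_dist lam Q i)) = 1" .
qed

lemma extra_dist: "prob_space (extra_dist i j)" "sets (extra_dist i j) = sets borel"
  using FCC_prob FCC_borel by (auto intro: prob_space_return)

lemma prob_space_extra: "prob_space (\<Pi>\<^sub>M j\<in>UNIV. extra_dist i j)"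
  by (intro prob_space_PiM extra_dist)

lemma sets_extra [measurable_cong]: "sets (\<Pi>\<^sub>M j\<in>UNIV. extra_dist i j) = sets (\<Pi>\<^sub>M j\<in>UNIV. borel)"
  by (intro sets_PiM_cong refl extra_dist)

lemma prob_space_jump: "prob_space (jump i)"
  unfolding jump_dist_def
  by (intro prob_space_pair prob_space_hold_dist prob_space_choice_dist FC_prob prob_space_extra)

lemma sets_jump [measurable_cong]: "sets (jump i) = sets draw_space"
  unfolding jump_dist_def by (intro sets_pair_measure_cong sets_extra FC_borel) auto

lemma prob_space_step: "prob_space step_space"
  by (intro prob_space_PiM prob_space_jump)

lemma sets_step [measurable_cong]: "sets step_space = sets (\<Pi>\<^sub>M i\<in>UNIV. draw_space)"
  by (intro sets_PiM_cong refl sets_jump)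

lemma prob_space_sample: "prob_space sample"
  unfolding sample_space_def by (intro prob_space_PiM prob_space_step)

lemma sets_sample [measurable_cong]: "sets sample = sets seq_space"
  unfolding sample_space_def by (intro sets_PiM_cong refl sets_step)

text \<open>The sample is an i.i.d. sequence of steps, so its law is that of one step prepended to
  an independent copy of the whole sequence.\<close>

lemma nn_integral_sample_step:
  assumes f: "f \<in> borel_measurable sample"
  shows "(\<integral>\<^sup>+\<omega>. f \<omega> \<partial>sample) = (\<integral>\<^sup>+d. (\<integral>\<^sup>+\<omega>. f (case_nat d \<omega>) \<partial>sample) \<partial>step_space)"
proof -
  interpret S: prob_space step_space by (rule prob_space_step)
  interpret sequence_space step_space by unfold_locales
  interpret sigma_finite_measure sample
    using prob_space_sample by (intro prob_space_imp_sigma_finite)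
  have eq: "distr (step_space \<Otimes>\<^sub>M sample) sample (\<lambda>(s, \<omega>). case_nat s \<omega>) = sample"
    unfolding sample_space_def by (rule PiM_iter)
  have m: "(\<lambda>(s, \<omega>). case_nat s \<omega>) \<in> measurable (step_space \<Otimes>\<^sub>M sample) sample"
    unfolding sample_space_def by measurable
  have "(\<integral>\<^sup>+\<omega>. f \<omega> \<partial>sample) = (\<integral>\<^sup>+z. f ((\<lambda>(s, \<omega>). case_nat s \<omega>) z) \<partial>(step_space \<Otimes>\<^sub>M sample))"
    by (subst (1) eq[symmetric]) (rule nn_integral_distr[OF m], simp add: f)
  also have "\<dots> = (\<integral>\<^sup>+d. (\<integral>\<^sup>+\<omega>. f ((\<lambda>(s, \<omega>). case_nat s \<omega>) (d, \<omega>)) \<partial>sample) \<partial>step_space)"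
    by (rule nn_integral_fst[symmetric]) (rule measurable_compose[OF m f])
  finally show ?thesis by simp
qed

text \<open>The claim is read from the claim coordinate or from one entry of the extra-claim vector,
  depending on the choice; the unread coordinates integrate to 1.\<close>

lemma nn_integral_claim:
  assumes [measurable]: "f \<in> borel_measurable borel"
  shows "(\<integral>\<^sup>+z. f (if j = i then fst z else snd z j) \<partial>(FC i \<Otimes>\<^sub>M (\<Pi>\<^sub>M j\<in>UNIV. extra_dist i j)))
    = (\<integral>\<^sup>+c. f c \<partial>claim_dist i j)"
proof -
  note [measurable_cong] = FC_borel
  interpret E: prob_space "\<Pi>\<^sub>M j\<in>UNIV. extra_dist i j" by (rule prob_space_extra)
  interpret F: prob_space "FC i" by (rule FC_prob)
  have [measurable]: "(\<lambda>z. f (if j = i then fst z else snd z j)) \<in> borel_measurable (FC i \<Otimes>\<^sub>M (\<Pi>\<^sub>M j\<in>UNIV. extra_dist i j))"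
    by measurable
  have "(\<integral>\<^sup>+z. f (if j = i then fst z else snd z j) \<partial>(FC i \<Otimes>\<^sub>M (\<Pi>\<^sub>M j\<in>UNIV. extra_dist i j))) =
    (\<integral>\<^sup>+c. (\<integral>\<^sup>+e. f (if j = i then c else e j) \<partial>(\<Pi>\<^sub>M j\<in>UNIV. extra_dist i j)) \<partial>FC i)"
    by (subst E.nn_integral_fst[symmetric]) (auto cong: if_cong)
  also have "\<dots> = (\<integral>\<^sup>+c. f c \<partial>claim_dist i j)"
  proof (cases "j = i")
    case True
    then show ?thesis by (simp add: claim_dist_def E.emeasure_space_1)
  next
    case False
    have "(\<integral>\<^sup>+e. f (e j) \<partial>(\<Pi>\<^sub>M j\<in>UNIV. extra_dist i j)) = (\<integral>\<^sup>+c. f c \<partial>extra_dist i j)"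
      by (rule nn_integral_component[OF extra_dist(1)])
         (simp add: measurable_cong_sets[OF extra_dist(2) refl] del: if_cancel)
    then show ?thesis using False by (simp add: claim_dist_def F.emeasure_space_1)
  qed
  finally show ?thesis .
qed

lemma nn_integral_step:
  assumes [measurable]: "(\<lambda>(h, j, c). g h j c) \<in> borel_measurable (borel \<Otimes>\<^sub>M (count_space UNIV \<Otimes>\<^sub>M borel))"
  shows "(\<integral>\<^sup>+d. g (fst (d i)) (fst (snd (d i))) (claim_at (d i) i) \<partial>step_space) =
    (\<integral>\<^sup>+h. (\<integral>\<^sup>+j. (\<integral>\<^sup>+c. g h j c \<partial>claim_dist i j) \<partial>choice_dist lam Q i) \<partial>hold_dist (rate lam Q i))"
proof -
  note [measurable_cong] = FC_borel
  let ?C = "FC i \<Otimes>\<^sub>M (\<Pi>\<^sub>M j\<in>UNIV. extra_dist i j)"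
  interpret H: prob_space "hold_dist (rate lam Q i)" by (rule prob_space_hold_dist)
  interpret Ch: prob_space "choice_dist lam Q i" by (rule prob_space_choice_dist)
  interpret C: prob_space ?C by (intro prob_space_pair FC_prob prob_space_extra)
  interpret CC: prob_space "choice_dist lam Q i \<Otimes>\<^sub>M ?C"
    by (intro prob_space_pair FC_prob prob_space_extra prob_space_choice_dist)
  have f: "(\<lambda>d. g (fst d) (fst (snd d)) (claim_at d i)) \<in> borel_measurable draw_space"
  proof -
    have "(\<lambda>d. (fst d, fst (snd d), claim_at d i)) \<in> measurable draw_space (borel \<Otimes>\<^sub>M (count_space UNIV \<Otimes>\<^sub>M borel))"
      by measurable
    from measurable_compose[OF this assms] show ?thesis by simp
  qed
  then have f': "(\<lambda>d. g (fst d) (fst (snd d)) (claim_at d i)) \<in> borel_measurable (jump i)"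
    by (simp add: measurable_cong_sets[OF sets_jump refl])
  have gm: "g h j \<in> borel_measurable borel" for h j
  proof -
    have "(\<lambda>c. (h, j, c)) \<in> measurable borel (borel \<Otimes>\<^sub>M (count_space UNIV \<Otimes>\<^sub>M borel))" by measurable
    from measurable_compose[OF this assms] show ?thesis by simp
  qed
  have "(\<integral>\<^sup>+d. g (fst (d i)) (fst (snd (d i))) (claim_at (d i) i) \<partial>step_space) =
      (\<integral>\<^sup>+d. g (fst d) (fst (snd d)) (claim_at d i) \<partial>jump i)"
    by (rule nn_integral_component[where M = jump and i = i, OF prob_space_jump f'])
  also have "\<dots> = (\<integral>\<^sup>+h. (\<integral>\<^sup>+z. g h (fst z) (claim_at (h, z) i) \<partial>(choice_dist lam Q i \<Otimes>\<^sub>M ?C)) \<partial>hold_dist (rate lam Q i))"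
    using CC.nn_integral_fst[OF f'[unfolded jump_dist_def]] by (simp add: jump_dist_def)
  also have "\<dots> = (\<integral>\<^sup>+h. (\<integral>\<^sup>+j. (\<integral>\<^sup>+c. g h j c \<partial>claim_dist i j) \<partial>choice_dist lam Q i) \<partial>hold_dist (rate lam Q i))"
  proof (intro nn_integral_cong)
    fix h
    have m: "(\<lambda>z. g h (fst z) (claim_at (h, z) i)) \<in> borel_measurable (choice_dist lam Q i \<Otimes>\<^sub>M ?C)"
      using measurable_compose[OF measurable_Pair1' f'[unfolded jump_dist_def], of h] by simp
    have "(\<integral>\<^sup>+z. g h (fst z) (claim_at (h, z) i) \<partial>(choice_dist lam Q i \<Otimes>\<^sub>M ?C)) =
        (\<integral>\<^sup>+j. (\<integral>\<^sup>+z. g h j (claim_at (h, j, z) i) \<partial>?C) \<partial>choice_dist lam Q i)"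
      using C.nn_integral_fst[OF m] by simp
    also have "\<dots> = (\<integral>\<^sup>+j. (\<integral>\<^sup>+c. g h j c \<partial>claim_dist i j) \<partial>choice_dist lam Q i)"
    proof (intro nn_integral_cong)
      fix j
      have "claim_at (h, j, z) i = (if j = i then fst z else snd z j)" for z
        by (cases z) (simp add: claim_at_def)
      then show "(\<integral>\<^sup>+z. g h j (claim_at (h, j, z) i) \<partial>?C) = (\<integral>\<^sup>+c. g h j c \<partial>claim_dist i j)"
        using nn_integral_claim[where f = "g h j" and i = i and j = j, OF gm] by simp
    qed
    finally show "(\<integral>\<^sup>+z. g h (fst z) (claim_at (h, z) i) \<partial>(choice_dist lam Q i \<Otimes>\<^sub>M ?C)) =
      (\<integral>\<^sup>+j. (\<integral>\<^sup>+c. g h j c \<partial>claim_dist i j) \<partial>choice_dist lam Q i)" .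
  qed
  finally show ?thesis .
qed

lemma AE_step_hold_pos: "AE d in step_space. 0 < fst (d i)"
proof -
  let ?N = "choice_dist lam Q i \<Otimes>\<^sub>M (FC i \<Otimes>\<^sub>M (\<Pi>\<^sub>M j\<in>UNIV. extra_dist i j))"
  have "prob_space ?N"
    by (intro prob_space_pair FC_prob prob_space_extra prob_space_choice_dist)
  then have eq: "distr (hold_dist (rate lam Q i) \<Otimes>\<^sub>M ?N) (hold_dist (rate lam Q i)) fst = hold_dist (rate lam Q i)"
    by (rule prob_space.distr_pair_fst)
  have "AE h in distr (hold_dist (rate lam Q i) \<Otimes>\<^sub>M ?N) (hold_dist (rate lam Q i)) fst. 0 < h"
    unfolding eq by (rule AE_hold_pos)
  from AE_distrD[OF measurable_fst this] have "AE d in jump i. 0 < fst d"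
    unfolding jump_dist_def .
  then show ?thesis by (intro AE_PiM_component prob_space_jump) auto
qed

lemma AE_pos_holds: "AE \<omega> in sample. pos_holds \<omega>"
proof -
  have "AE \<omega> in sample. 0 < fst (\<omega> k s)" for k s
    unfolding sample_space_def using AE_step_hold_pos[of s]
    by (intro AE_PiM_component[where P = "\<lambda>d. 0 < fst (d s)"] prob_space_step) auto
  then show ?thesis unfolding pos_holds_def by (simp add: AE_all_countable)
qed


text \<open>Shared by the ruin equation and the non-explosion estimate. The divisor r_i of the
  choice probabilities cancels the factor r_i of the exponential density, leaving plain event rates
  and the weight e^(-(r_i + q) t).\<close>

lemma nn_integral_first_step:
  assumes f: "f \<in> borel_measurable sample"
    and g: "(\<lambda>(h, j, c). g h j c) \<in> borel_measurable (borel \<Otimes>\<^sub>M (count_space UNIV \<Otimes>\<^sub>M borel))"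
    and step: "\<And>d. 0 < fst (d i) \<Longrightarrow> (\<integral>\<^sup>+\<omega>. f (case_nat d \<omega>) \<partial>sample) =
       ennreal (discount q (fst (d i))) * g (fst (d i)) (fst (snd (d i))) (claim_at (d i) i)"
  shows "(\<integral>\<^sup>+\<omega>. f \<omega> \<partial>sample) = (\<integral>\<^sup>+t. (if 0 \<le> t then ennreal (exp (- (rate lam Q i + q) * t)) *
     (\<Sum>j\<in>UNIV. ennreal (intensity i j) * (\<integral>\<^sup>+c. g (ereal t) j c \<partial>claim_dist i j)) else 0) \<partial>lborel)"
proof -
  let ?r = "rate lam Q i" and ?I = "\<lambda>h j. \<integral>\<^sup>+c. g h j c \<partial>claim_dist i j"
  have gI: "(\<lambda>h. ?I h j) \<in> borel_measurable borel" for j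
  proof -
    interpret prob_space "claim_dist i j" by (rule claim_dist)
    have "(\<lambda>(h, c). (h, j, c)) \<in> measurable (borel \<Otimes>\<^sub>M claim_dist i j) (borel \<Otimes>\<^sub>M (count_space UNIV \<Otimes>\<^sub>M borel))"
      using claim_dist(2)[measurable_cong] by measurable
    from measurable_compose[OF this g]
    show ?thesis by (intro borel_measurable_nn_integral) (simp add: case_prod_unfold)
  qed
  note [measurable] = g gI
  have "(\<integral>\<^sup>+\<omega>. f \<omega> \<partial>sample) = (\<integral>\<^sup>+d. (\<integral>\<^sup>+\<omega>. f (case_nat d \<omega>) \<partial>sample) \<partial>step_space)"
    by (rule nn_integral_sample_step[OF f])
  also have "\<dots> = (\<integral>\<^sup>+d. ennreal (discount q (fst (d i))) * g (fst (d i)) (fst (snd (d i))) (claim_at (d i) i) \<partial>step_space)"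
    using AE_step_hold_pos[of i] by (intro nn_integral_cong_AE) (auto simp: step)
  also have "\<dots> = (\<integral>\<^sup>+h. (\<integral>\<^sup>+j. (\<integral>\<^sup>+c. ennreal (discount q h) * g h j c \<partial>claim_dist i j) \<partial>choice_dist lam Q i) \<partial>hold_dist ?r)"
  proof (rule nn_integral_step)
    have "(\<lambda>z. ennreal (discount q (fst z)) * (\<lambda>(h, j, c). g h j c) z) \<in>
        borel_measurable (borel \<Otimes>\<^sub>M (count_space UNIV \<Otimes>\<^sub>M borel))" by measurable
    then show "(\<lambda>(h, j, c). ennreal (discount q h) * g h j c) \<in>
        borel_measurable (borel \<Otimes>\<^sub>M (count_space UNIV \<Otimes>\<^sub>M borel))" by (simp add: case_prod_unfold)
  qed
  also have "\<dots> = (\<integral>\<^sup>+h. ennreal (discount q h) * (\<integral>\<^sup>+j. ?I h j \<partial>choice_dist lam Q i) \<partial>hold_dist ?r)"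
  proof (intro nn_integral_cong)
    fix h
    have "(\<integral>\<^sup>+c. ennreal (discount q h) * g h j c \<partial>claim_dist i j) = ennreal (discount q h) * ?I h j" for j
    proof (rule nn_integral_cmult)
      have "(\<lambda>c. (h, j, c)) \<in> measurable (claim_dist i j) (borel \<Otimes>\<^sub>M (count_space UNIV \<Otimes>\<^sub>M borel))"
        using claim_dist(2)[measurable_cong] by measurable
      from measurable_compose[OF this g] show "g h j \<in> borel_measurable (claim_dist i j)" by simp
    qed
    then show "(\<integral>\<^sup>+j. (\<integral>\<^sup>+c. ennreal (discount q h) * g h j c \<partial>claim_dist i j) \<partial>choice_dist lam Q i) =
       ennreal (discount q h) * (\<integral>\<^sup>+j. ?I h j \<partial>choice_dist lam Q i)"
      by (simp add: nn_integral_cmult)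
  qed
  also have "\<dots> = (\<integral>\<^sup>+t. (if 0 \<le> t then ennreal (exp (- (?r + q) * t)) *
     (\<Sum>j\<in>UNIV. ennreal (intensity i j) * ?I (ereal t) j) else 0) \<partial>lborel)"
  proof (cases "0 < ?r")
    case True
    have "(\<integral>\<^sup>+h. ennreal (discount q h) * (\<integral>\<^sup>+j. ?I h j \<partial>choice_dist lam Q i) \<partial>hold_dist ?r) =
      (\<integral>\<^sup>+t. ennreal (exponential_density ?r t) * (ennreal (discount q (ereal t)) *
        (\<Sum>j\<in>UNIV. ennreal (intensity i j / ?r) * ?I (ereal t) j)) \<partial>lborel)"
      unfolding nn_integral_choice_dist using True
      by (subst nn_integral_hold_dist) (simp_all cong: measurable_cong_simp)
    also have "\<dots> = (\<integral>\<^sup>+t. (if 0 \<le> t then ennreal (exp (- (?r + q) * t)) *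
     (\<Sum>j\<in>UNIV. ennreal (intensity i j) * ?I (ereal t) j) else 0) \<partial>lborel)"
    proof (intro nn_integral_cong)
      fix t :: real
      have "ennreal (intensity i j / ?r) = ennreal (1 / ?r) * ennreal (intensity i j)" for j
        using True intensity_nonneg by (simp add: ennreal_mult[symmetric])
      then have 1: "(\<Sum>j\<in>UNIV. ennreal (intensity i j / ?r) * ?I (ereal t) j) =
          ennreal (1 / ?r) * (\<Sum>j\<in>UNIV. ennreal (intensity i j) * ?I (ereal t) j)"
        by (simp add: sum_distrib_left mult.assoc)
      have 2: "ennreal (exponential_density ?r t) * ennreal (discount q (ereal t)) * ennreal (1 / ?r) =
          (if 0 \<le> t then ennreal (exp (- (?r + q) * t)) else 0)"
        using True by (auto simp: exponential_density_def ennreal_mult[symmetric] mult_exp_exp algebra_simps)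
      show "ennreal (exponential_density ?r t) * (ennreal (discount q (ereal t)) *
        (\<Sum>j\<in>UNIV. ennreal (intensity i j / ?r) * ?I (ereal t) j)) =
        (if 0 \<le> t then ennreal (exp (- (?r + q) * t)) * (\<Sum>j\<in>UNIV. ennreal (intensity i j) * ?I (ereal t) j) else 0)"
        unfolding 1 mult.assoc[symmetric] 2 by simp
    qed
    finally show ?thesis .
  next
    \<comment> \<open>Without events the holding time is infinite and its discount is 0. The
      intensities are nonnegative with sum 0, so the right-hand side vanishes as well.\<close>
    case False
    then have "?r = 0" using rate_nonneg[of i] by simp
    then have "intensity i j = 0" for j
      using sum_nonneg_eq_0_iff[of UNIV "intensity i"] intensity_nonneg by (simp add: sum_intensity)
    then have 0: "(\<integral>\<^sup>+t. (if 0 \<le> t then ennreal (exp (- (?r + q) * t)) *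
     (\<Sum>j\<in>UNIV. ennreal (intensity i j) * ?I (ereal t) j) else 0) \<partial>lborel) = 0"
      by (simp cong: if_cong)
    show ?thesis unfolding 0 nn_integral_choice_dist using False
      by (subst nn_integral_hold_dist) simp_all
  qed
  finally show ?thesis .
qed

text \<open>One holding time of rate r has discounted mean r/(r + 1), which increases in r. With R
  the sum of all rates, each event therefore contributes a factor of at most R/(R + 1), whatever the
  state.\<close>

lemma nn_integral_discount_ev_time:
  "\<exists>\<rho>. 0 \<le> \<rho> \<and> \<rho> < 1 \<and> (\<forall>n i. (\<integral>\<^sup>+\<omega>. ennreal (discount 1 (ev_time \<omega> i n)) \<partial>sample) \<le> ennreal (\<rho> ^ n))"
proof -
  define R where "R = (\<Sum>i\<in>UNIV. rate lam Q i)"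
  have R: "rate lam Q i \<le> R" "0 \<le> R" for i
    unfolding R_def using rate_nonneg by (auto intro!: member_le_sum sum_nonneg)
  define \<rho> where "\<rho> = R / (R + 1)"
  have \<rho>: "0 \<le> \<rho>" "\<rho> < 1" using R by (auto simp: \<rho>_def)
  interpret prob_space sample by (rule prob_space_sample)
  have "(\<integral>\<^sup>+\<omega>. ennreal (discount 1 (ev_time \<omega> i n)) \<partial>sample) \<le> ennreal (\<rho> ^ n)" for n i
  proof (induction n arbitrary: i)
    case 0
    have "discount 1 0 = 1" by (simp add: discount_def)
    then show ?case by (simp add: emeasure_space_1)
  next
    case (Suc n)
    let ?E = "\<lambda>j. \<integral>\<^sup>+\<omega>. ennreal (discount 1 (ev_time \<omega> j n)) \<partial>sample"
    have "(\<integral>\<^sup>+\<omega>. ennreal (discount 1 (ev_time \<omega> i (Suc n))) \<partial>sample) =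
      (\<integral>\<^sup>+t. (if 0 \<le> t then ennreal (exp (- (rate lam Q i + 1) * t)) *
        (\<Sum>j\<in>UNIV. ennreal (intensity i j) * (\<integral>\<^sup>+c. ?E j \<partial>claim_dist i j)) else 0) \<partial>lborel)"
    proof (rule nn_integral_first_step[where g = "\<lambda>h j c. ?E j"])
      show "(\<lambda>\<omega>. ennreal (discount 1 (ev_time \<omega> i (Suc n)))) \<in> borel_measurable sample"
        by measurable
      show "(\<lambda>(h, j, c). ?E j) \<in> borel_measurable (borel \<Otimes>\<^sub>M (count_space UNIV \<Otimes>\<^sub>M borel))"
        by measurable
      fix d :: "'n \<Rightarrow> ereal \<times> 'n \<times> real \<times> ('n \<Rightarrow> real)" assume d: "0 < fst (d i)"
      have "(\<integral>\<^sup>+\<omega>. ennreal (discount 1 (ev_time (case_nat d \<omega>) i (Suc n))) \<partial>sample) =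
        (\<integral>\<^sup>+\<omega>. ennreal (discount 1 (fst (d i))) * ennreal (discount 1 (ev_time \<omega> (fst (snd (d i))) n)) \<partial>sample)"
      proof (rule nn_integral_cong_AE)
        show "AE \<omega> in sample. ennreal (discount 1 (ev_time (case_nat d \<omega>) i (Suc n))) =
          ennreal (discount 1 (fst (d i))) * ennreal (discount 1 (ev_time \<omega> (fst (snd (d i))) n))"
          using AE_pos_holds
        proof eventually_elim
          case (elim \<omega>)
          show ?case unfolding pos_holds_discount_ev_time[where d = d and i = i and n = n, OF elim d]
            by (simp add: ennreal_mult)
        qed
      qed
      also have "\<dots> = ennreal (discount 1 (fst (d i))) * ?E (fst (snd (d i)))"
        by (intro nn_integral_cmult) measurable
      finally show "(\<integral>\<^sup>+\<omega>. ennreal (discount 1 (ev_time (case_nat d \<omega>) i (Suc n))) \<partial>sample) =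
        ennreal (discount 1 (fst (d i))) * ?E (fst (snd (d i)))" .
    qed
    also have "\<dots> \<le> (\<integral>\<^sup>+t. ennreal (rate lam Q i * \<rho> ^ n) * ennreal (if 0 \<le> t then exp (- (rate lam Q i + 1) * (t - 0)) else 0) \<partial>lborel)"
    proof (rule nn_integral_mono)
      fix t :: real
      have "(\<Sum>j\<in>UNIV. ennreal (intensity i j) * (\<integral>\<^sup>+c. ?E j \<partial>claim_dist i j)) \<le>
          (\<Sum>j\<in>UNIV. ennreal (intensity i j) * ennreal (\<rho> ^ n))"
      proof (intro sum_mono mult_left_mono)
        fix j
        interpret C: prob_space "claim_dist i j" by (rule claim_dist)
        show "(\<integral>\<^sup>+c. ?E j \<partial>claim_dist i j) \<le> ennreal (\<rho> ^ n)"
          using Suc by (simp add: C.emeasure_space_1)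
      qed auto
      also have "\<dots> = ennreal (rate lam Q i * \<rho> ^ n)"
        using \<rho> intensity_nonneg
        by (simp add: ennreal_mult[symmetric] sum_ennreal sum_distrib_right[symmetric] sum_intensity)
      finally have "(\<Sum>j\<in>UNIV. ennreal (intensity i j) * (\<integral>\<^sup>+c. ?E j \<partial>claim_dist i j)) \<le> ennreal (rate lam Q i * \<rho> ^ n)" .
      then show "(if 0 \<le> t then ennreal (exp (- (rate lam Q i + 1) * t)) *
          (\<Sum>j\<in>UNIV. ennreal (intensity i j) * (\<integral>\<^sup>+c. ?E j \<partial>claim_dist i j)) else 0) \<le>
          ennreal (rate lam Q i * \<rho> ^ n) * ennreal (if 0 \<le> t then exp (- (rate lam Q i + 1) * (t - 0)) else 0)"
        by (auto simp: mult.commute[of "ennreal (rate lam Q i * \<rho> ^ n)"] intro: mult_left_mono)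
    qed
    also have "\<dots> = ennreal (rate lam Q i * \<rho> ^ n) * (\<integral>\<^sup>+t. ennreal (if 0 \<le> t then exp (- (rate lam Q i + 1) * (t - 0)) else 0) \<partial>lborel)"
      by (rule nn_integral_cmult) measurable
    also have "(\<integral>\<^sup>+t. ennreal (if 0 \<le> t then exp (- (rate lam Q i + 1) * (t - 0)) else 0) \<partial>lborel) = ennreal (1 / (rate lam Q i + 1))"
      using has_bochner_integral_exp_tail[of "rate lam Q i + 1" 0] rate_nonneg[of i]
      by (subst nn_integral_eq_integral) (auto simp: has_bochner_integral_iff)
    also have "ennreal (rate lam Q i * \<rho> ^ n) * ennreal (1 / (rate lam Q i + 1)) = ennreal (rate lam Q i / (rate lam Q i + 1) * \<rho> ^ n)"
      using rate_nonneg[of i] \<rho> by (subst ennreal_mult[symmetric]) auto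
    also have "\<dots> \<le> ennreal (\<rho> * \<rho> ^ n)"
    proof (intro ennreal_leI mult_right_mono)
      have "rate lam Q i * (R + 1) \<le> R * (rate lam Q i + 1)" using R(1)[of i] by (simp add: algebra_simps)
      then show "rate lam Q i / (rate lam Q i + 1) \<le> \<rho>"
        unfolding \<rho>_def using rate_nonneg[of i] R(2)
        by (simp add: pos_divide_le_eq pos_le_divide_eq)
    qed (use \<rho> in auto)
    also have "\<rho> * \<rho> ^ n = \<rho> ^ Suc n" by simp
    finally show ?case .
  qed
  then show ?thesis using \<rho> by blast
qed

text \<open>Markov's inequality: if all event times stay below N, each discount is at least e^(-N),
  so this event has probability at most e^N times any power of \<rho>. Integer horizons then suffice
  for all t.\<close>

lemma AE_nonexplosive: "AE \<omega> in sample. \<forall>t. \<exists>k. ereal t < ev_time \<omega> i (Suc k)"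
proof -
  interpret prob_space sample by (rule prob_space_sample)
  obtain \<rho> where \<rho>: "0 \<le> \<rho>" "\<rho> < 1"
    and E: "\<And>n i. (\<integral>\<^sup>+\<omega>. ennreal (discount 1 (ev_time \<omega> i n)) \<partial>sample) \<le> ennreal (\<rho> ^ n)"
    using nn_integral_discount_ev_time by blast
  have "AE \<omega> in sample. \<exists>k. ereal (real N) < ev_time \<omega> i (Suc k)" for N :: nat
  proof -
    define A where "A = {\<omega> \<in> space sample. \<forall>k. ev_time \<omega> i (Suc k) \<le> ereal (real N)}"
    have A [measurable]: "A \<in> sets sample" unfolding A_def by measurable
    have le: "ennreal (exp (- real N)) * emeasure sample A \<le> ennreal (\<rho> ^ Suc n)" for n
    proof -
      have "ennreal (exp (- real N)) * emeasure sample A = (\<integral>\<^sup>+\<omega>. ennreal (exp (- real N)) * indicator A \<omega> \<partial>sample)"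
        by (simp add: nn_integral_cmult_indicator)
      also have "\<dots> \<le> (\<integral>\<^sup>+\<omega>. ennreal (discount 1 (ev_time \<omega> i (Suc n))) \<partial>sample)"
      proof (rule nn_integral_mono_AE)
        show "AE \<omega> in sample. ennreal (exp (- real N)) * indicator A \<omega> \<le> ennreal (discount 1 (ev_time \<omega> i (Suc n)))"
          using AE_pos_holds
        proof eventually_elim
          case (elim \<omega>)
          show ?case
          proof (cases "\<omega> \<in> A")
            case True
            then have "ev_time \<omega> i (Suc n) \<le> ereal (real N)" by (auto simp: A_def simp del: ev_time.simps)
            moreover have "0 \<le> ev_time \<omega> i (Suc n)" by (rule ev_time_nonneg[OF elim])
            ultimately obtain t where t: "ev_time \<omega> i (Suc n) = ereal t" "t \<le> real N"
              by (cases "ev_time \<omega> i (Suc n)") (auto simp del: ev_time.simps)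
            show ?thesis using True unfolding t(1) by (simp add: t(2) ennreal_leI)
          qed simp
        qed
      qed
      also have "\<dots> \<le> ennreal (\<rho> ^ Suc n)" by (rule E)
      finally show ?thesis .
    qed
    have "(\<lambda>n. ennreal (\<rho> ^ Suc n)) \<longlonglongrightarrow> ennreal 0"
      using \<rho> by (intro tendsto_ennrealI LIMSEQ_Suc LIMSEQ_realpow_zero) auto
    then have "ennreal (exp (- real N)) * emeasure sample A \<le> 0"
      using le by (intro LIMSEQ_le_const[of "\<lambda>n. ennreal (\<rho> ^ Suc n)"]) auto
    then have "emeasure sample A = 0" by simp
    then have "A \<in> null_sets sample" using A by auto
    from AE_not_in[OF this] AE_space show ?thesis
      by eventually_elim (auto simp: A_def not_le simp del: ev_time.simps)
  qed
  then have "AE \<omega> in sample. \<forall>N::nat. \<exists>k. ereal (real N) < ev_time \<omega> i (Suc k)"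
    by (simp add: AE_all_countable del: ev_time.simps)
  then show ?thesis
  proof eventually_elim
    case (elim \<omega>)
    show ?case
    proof
      fix t :: real
      obtain N :: nat where "t \<le> real N" using real_arch_simple by blast
      moreover obtain k where "ereal (real N) < ev_time \<omega> i (Suc k)" using elim by blast
      ultimately show "\<exists>k. ereal t < ev_time \<omega> i (Suc k)"
        by (metis ereal_less_eq(3) order_le_less_trans)
    qed
  qed
qed

end

sublocale mmrp \<subseteq> volterra p intensity claim_dist
  by (rule volterra.intro) (simp_all only: p_pos intensity_nonneg claim_dist)

context mmrp begin

section \<open>The ruin transform as a solution of the equation\<close>

lemma r_eq_rate: "r i = rate lam Q i"
  by (simp add: r_def sum_intensity)

text \<open>Defined by \<open>ruin_value\<close> instead of \<open>phi1\<close>, since conditioning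
  on the first event acts on the embedded chain and needs values at negative levels too.\<close>

definition phi :: "real \<Rightarrow> 'n \<Rightarrow> 'n \<Rightarrow> real \<Rightarrow> real" where
  "phi q i j x = (\<integral>\<omega>. ruin_value p q \<omega> x i j \<partial>sample)"

lemma ruin_value_measurable [measurable]: "(\<lambda>\<omega>. ruin_value p q \<omega> x i j) \<in> borel_measurable sample"
proof -
  have "(\<lambda>\<omega>. (x, \<omega>)) \<in> measurable sample (borel \<Otimes>\<^sub>M seq_space)" by measurable
  from measurable_compose[OF this measurable_ruin_value] show ?thesis by simp
qed

lemma AE_ruin_value_bounds:
  "0 \<le> q \<Longrightarrow> AE \<omega> in sample. 0 \<le> ruin_value p q \<omega> x i j \<and> ruin_value p q \<omega> x i j \<le> 1"
  using AE_pos_holds by eventually_elim (simp add: ruin_value_bounds)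

lemma integrable_ruin_value: "0 \<le> q \<Longrightarrow> integrable sample (\<lambda>\<omega>. ruin_value p q \<omega> x i j)"
proof -
  assume q: "0 \<le> q"
  interpret prob_space sample by (rule prob_space_sample)
  have "AE \<omega> in sample. norm (ruin_value p q \<omega> x i j) \<le> 1"
    using AE_ruin_value_bounds[OF q, of x i j] by eventually_elim auto
  then show ?thesis by (rule integrable_const_bound) measurable
qed

lemma phi_bounds:
  assumes q: "0 \<le> q"
  shows "0 \<le> phi q i j x \<and> phi q i j x \<le> 1"
proof -
  interpret prob_space sample by (rule prob_space_sample)
  have "phi q i j x \<le> (\<integral>\<omega>. 1 \<partial>sample)"
    unfolding phi_def using AE_ruin_value_bounds[OF q, of x i j]
    by (intro integral_mono_AE integrable_ruin_value q) auto
  moreover have "0 \<le> phi q i j x"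
    unfolding phi_def using AE_ruin_value_bounds[OF q, of x i j] by (intro integral_nonneg_AE) auto
  ultimately show ?thesis by (simp add: prob_space)
qed

lemma phi_neg: "x < 0 \<Longrightarrow> phi q i j x = (if i = j then 1 else 0)"
proof -
  interpret prob_space sample by (rule prob_space_sample)
  show "x < 0 \<Longrightarrow> phi q i j x = (if i = j then 1 else 0)"
    by (simp add: phi_def ruin_value_neg prob_space)
qed

lemma ennreal_phi: "0 \<le> q \<Longrightarrow> ennreal (phi q i j x) = (\<integral>\<^sup>+\<omega>. ennreal (ruin_value p q \<omega> x i j) \<partial>sample)"
  unfolding phi_def using AE_ruin_value_bounds[of q x i j]
  by (intro nn_integral_eq_integral[symmetric] integrable_ruin_value) auto

lemma phi_measurable [measurable]: "phi q i j \<in> borel_measurable borel"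
proof -
  interpret prob_space sample by (rule prob_space_sample)
  have "(\<lambda>(x, \<omega>). ruin_value p q \<omega> x i j) \<in> borel_measurable (borel \<Otimes>\<^sub>M sample)"
    using measurable_ruin_value[of p q i j]
    by (simp add: case_prod_unfold measurable_cong_sets[OF sets_pair_measure_cong[OF refl sets_sample] refl])
  then show ?thesis unfolding phi_def[abs_def] by (rule borel_measurable_lebesgue_integral)
qed

lemma exp_bounded_phi: "0 \<le> q \<Longrightarrow> exp_bounded (phi q i j)"
  using phi_bounds by (intro exp_boundedI[of _ 0 1]) auto

text \<open>Here x + p_i t is the level just before a first event at time t. Stating the identity
  with nonnegative integrals allows rearrangement before any integrability is known.\<close>

lemma phi_first_step:
  assumes q: "0 \<le> q" and x: "0 \<le> x"
  shows "ennreal (phi q i j x) = (\<integral>\<^sup>+t. (if 0 \<le> t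
     then ennreal (exp (- (r i + q) * t) * G (\<lambda>k. phi q k j) i (x + p i * t)) else 0) \<partial>lborel)"
proof -
  let ?g = "\<lambda>h s c. ennreal (phi q s j (x + p i * real_of_ereal h - c))"
  have "ennreal (phi q i j x) = (\<integral>\<^sup>+\<omega>. ennreal (ruin_value p q \<omega> x i j) \<partial>sample)"
    by (rule ennreal_phi[OF q])
  also have "\<dots> = (\<integral>\<^sup>+t. (if 0 \<le> t then ennreal (exp (- (rate lam Q i + q) * t)) *
     (\<Sum>s\<in>UNIV. ennreal (intensity i s) * (\<integral>\<^sup>+c. ?g (ereal t) s c \<partial>claim_dist i s)) else 0) \<partial>lborel)"
  proof (rule nn_integral_first_step)
    show "(\<lambda>\<omega>. ennreal (ruin_value p q \<omega> x i j)) \<in> borel_measurable sample" by measurable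
    have "(\<lambda>z. ?g (fst z) (fst (snd z)) (snd (snd z))) \<in> borel_measurable (borel \<Otimes>\<^sub>M (count_space UNIV \<Otimes>\<^sub>M borel))"
      by (rule measurable_compose_countable[where f = "\<lambda>s z. ?g (fst z) s (snd (snd z))"]) measurable
    then show "(\<lambda>(h, s, c). ?g h s c) \<in> borel_measurable (borel \<Otimes>\<^sub>M (count_space UNIV \<Otimes>\<^sub>M borel))"
      by (simp add: case_prod_unfold)
    fix d :: "'n \<Rightarrow> ereal \<times> 'n \<times> real \<times> ('n \<Rightarrow> real)" assume d: "0 < fst (d i)"
    let ?y = "x + p i * real_of_ereal (fst (d i)) - claim_at (d i) i"
    have "(\<integral>\<^sup>+\<omega>. ennreal (ruin_value p q (case_nat d \<omega>) x i j) \<partial>sample) =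
      (\<integral>\<^sup>+\<omega>. ennreal (discount q (fst (d i))) * ennreal (ruin_value p q \<omega> ?y (fst (snd (d i))) j) \<partial>sample)"
    proof (rule nn_integral_cong_AE)
      show "AE \<omega> in sample. ennreal (ruin_value p q (case_nat d \<omega>) x i j) =
          ennreal (discount q (fst (d i))) * ennreal (ruin_value p q \<omega> ?y (fst (snd (d i))) j)"
        using AE_pos_holds
      proof eventually_elim
        case (elim \<omega>)
        show ?case
          unfolding ruin_value_step[where d = d and i = i, OF x elim d] discount_def[symmetric]
          using ruin_value_bounds(1)[OF elim q] by (simp add: ennreal_mult)
      qed
    qed
    also have "\<dots> = ennreal (discount q (fst (d i))) * (\<integral>\<^sup>+\<omega>. ennreal (ruin_value p q \<omega> ?y (fst (snd (d i))) j) \<partial>sample)"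
      by (intro nn_integral_cmult) measurable
    finally show "(\<integral>\<^sup>+\<omega>. ennreal (ruin_value p q (case_nat d \<omega>) x i j) \<partial>sample) =
       ennreal (discount q (fst (d i))) * ?g (fst (d i)) (fst (snd (d i))) (claim_at (d i) i)"
      unfolding ennreal_phi[OF q] .
  qed
  also have "\<dots> = (\<integral>\<^sup>+t. (if 0 \<le> t
     then ennreal (exp (- (r i + q) * t) * G (\<lambda>k. phi q k j) i (x + p i * t)) else 0) \<partial>lborel)"
  proof (intro nn_integral_cong)
    fix t :: real
    let ?y = "x + p i * t"
    have nn: "0 \<le> (\<integral>c. phi q s j (?y - c) \<partial>claim_dist i s)" for s
      using phi_bounds[OF q] by (intro integral_nonneg_AE) auto
    have "(\<integral>\<^sup>+c. ?g (ereal t) s c \<partial>claim_dist i s) = ennreal (\<integral>c. phi q s j (?y - c) \<partial>claim_dist i s)" for s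
      using phi_bounds[OF q]
      by (simp, intro nn_integral_eq_integral translate_integrable exp_bounded_phi q) auto
    then have "(\<Sum>s\<in>UNIV. ennreal (intensity i s) * (\<integral>\<^sup>+c. ?g (ereal t) s c \<partial>claim_dist i s)) =
        (\<Sum>s\<in>UNIV. ennreal (intensity i s * (\<integral>c. phi q s j (?y - c) \<partial>claim_dist i s)))"
      using intensity_nonneg nn by (simp add: ennreal_mult)
    also have "\<dots> = ennreal (G (\<lambda>k. phi q k j) i ?y)"
      unfolding G_def using intensity_nonneg nn by (intro sum_ennreal) auto
    finally have eq: "(\<Sum>s\<in>UNIV. ennreal (intensity i s) * (\<integral>\<^sup>+c. ?g (ereal t) s c \<partial>claim_dist i s)) =
        ennreal (G (\<lambda>k. phi q k j) i ?y)" .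
    have "0 \<le> G (\<lambda>k. phi q k j) i ?y"
      unfolding G_def by (intro sum_nonneg mult_nonneg_nonneg intensity_nonneg nn)
    then show "(if 0 \<le> t then ennreal (exp (- (rate lam Q i + q) * t)) *
       (\<Sum>s\<in>UNIV. ennreal (intensity i s) * (\<integral>\<^sup>+c. ?g (ereal t) s c \<partial>claim_dist i s)) else 0) =
       (if 0 \<le> t then ennreal (exp (- (r i + q) * t) * G (\<lambda>k. phi q k j) i ?y) else 0)"
      unfolding eq r_eq_rate by (simp add: ennreal_mult)
  qed
  finally show ?thesis .
qed

text \<open>With y = x + p_i t the first-step identity says that p_i e^(-\<kappa> x) phi(x) is the
  integral of e^(-\<kappa> y) G phi over [x, infinity). Its difference from the same identity at 0
  is an integral over [0, x], and solving for phi(x) gives the forward equation.\<close>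

lemma sol_phi:
  assumes q: "0 \<le> q"
  shows "sol q (\<lambda>i. phi q i j)"
  unfolding sol_def
proof safe
  fix i
  show "exp_bounded (phi q i j)" by (rule exp_bounded_phi[OF q])
  let ?G = "G (\<lambda>k. phi q k j) i" and ?k = "\<kappa> q i"
  have ebG: "exp_bounded ?G" by (intro exp_bounded_G exp_bounded_phi q)
  then have [measurable]: "?G \<in> borel_measurable borel" by (rule exp_bounded_measurable)
  have G_nonneg: "0 \<le> ?G y" for y
    unfolding G_def using phi_bounds[OF q]
    by (intro sum_nonneg mult_nonneg_nonneg intensity_nonneg integral_nonneg_AE) auto
  define g where "g y = exp (- ?k * y) * ?G y" for y
  have g_nonneg: "0 \<le> g y" for y unfolding g_def using G_nonneg by simp
  have [measurable]: "g \<in> borel_measurable borel" unfolding g_def by measurable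
  have tail: "ennreal (p i * exp (- ?k * x) * phi q i j x) = (\<integral>\<^sup>+y. (if x \<le> y then ennreal (g y) else 0) \<partial>lborel)"
    if x: "0 \<le> x" for x
  proof -
    have "(\<integral>\<^sup>+y. (if x \<le> y then ennreal (g y) else 0) \<partial>lborel) =
        ennreal (p i) * (\<integral>\<^sup>+t. (if x \<le> x + p i * t then ennreal (g (x + p i * t)) else 0) \<partial>lborel)"
      using p_pos[of i] by (subst nn_integral_real_affine[where c = "p i" and t = x]) auto
    also have "(\<lambda>t. if x \<le> x + p i * t then ennreal (g (x + p i * t)) else 0) =
      (\<lambda>t. ennreal (exp (- ?k * x)) * (if 0 \<le> t then ennreal (exp (- (r i + q) * t) * ?G (x + p i * t)) else 0))"
    proof
      fix t
      have "?k * p i = r i + q" using p_pos[of i] by (simp add: \<kappa>_def)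
      then have "exp (- ?k * (x + p i * t)) = exp (- ?k * x) * exp (- (r i + q) * t)"
        by (simp add: mult_exp_exp distrib_left flip: mult.assoc)
      then have "g (x + p i * t) = exp (- ?k * x) * (exp (- (r i + q) * t) * ?G (x + p i * t))"
        unfolding g_def by simp
      moreover have "x \<le> x + p i * t \<longleftrightarrow> 0 \<le> t" using p_pos[of i] by (simp add: zero_le_mult_iff)
      ultimately show "(if x \<le> x + p i * t then ennreal (g (x + p i * t)) else 0) =
        ennreal (exp (- ?k * x)) * (if 0 \<le> t then ennreal (exp (- (r i + q) * t) * ?G (x + p i * t)) else 0)"
        using G_nonneg by (simp add: ennreal_mult[symmetric])
    qed
    also have "(\<integral>\<^sup>+t. ennreal (exp (- ?k * x)) * (if 0 \<le> t then ennreal (exp (- (r i + q) * t) * ?G (x + p i * t)) else 0) \<partial>lborel)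
      = ennreal (exp (- ?k * x)) * ennreal (phi q i j x)"
      unfolding phi_first_step[OF q x] by (intro nn_integral_cmult) measurable
    finally show ?thesis
      using p_pos[of i] phi_bounds[OF q] by (simp add: ennreal_mult[symmetric] mult.assoc less_imp_le)
  qed
  fix x :: real assume x: "0 \<le> x"
  have int: "integrable lborel (\<lambda>y. if 0 \<le> y \<and> y \<le> x then g y else 0)"
    using exp_bounded_integrable_Icc[OF ebG, of 0 x "- ?k" 0] unfolding g_def by (simp cong: if_cong)
  \<comment> \<open>The ranges [0, x] and [x, infinity) overlap in the single point x, hence
    equality only almost everywhere.\<close>
  have "(\<integral>\<^sup>+y. (if 0 \<le> y then ennreal (g y) else 0) \<partial>lborel) =
      (\<integral>\<^sup>+y. ennreal (if 0 \<le> y \<and> y \<le> x then g y else 0) + (if x \<le> y then ennreal (g y) else 0) \<partial>lborel)"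
  proof (rule nn_integral_cong_AE)
    show "AE y in lborel. (if 0 \<le> y then ennreal (g y) else 0) =
        ennreal (if 0 \<le> y \<and> y \<le> x then g y else 0) + (if x \<le> y then ennreal (g y) else 0)"
      using AE_lborel_singleton[of x] by eventually_elim (use x in auto)
  qed
  also have "\<dots> = (\<integral>\<^sup>+y. ennreal (if 0 \<le> y \<and> y \<le> x then g y else 0) \<partial>lborel) + (\<integral>\<^sup>+y. (if x \<le> y then ennreal (g y) else 0) \<partial>lborel)"
    by (intro nn_integral_add) measurable
  also have "(\<integral>\<^sup>+y. ennreal (if 0 \<le> y \<and> y \<le> x then g y else 0) \<partial>lborel) = ennreal (integral {0..x} g)"
    using nn_integral_eq_integral[OF int] g_nonneg by (simp add: integral_Icc_eq_HK(2)[OF int])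
  finally have "ennreal (p i * exp (- ?k * 0) * phi q i j 0) =
      ennreal (integral {0..x} g) + ennreal (p i * exp (- ?k * x) * phi q i j x)"
    unfolding tail[OF x, symmetric] tail[OF order_refl, symmetric] .
  also have "\<dots> = ennreal (integral {0..x} g + p i * exp (- ?k * x) * phi q i j x)"
    using g_nonneg integral_Icc_eq_HK(1)[OF int] p_pos[of i] phi_bounds[OF q]
    by (intro ennreal_plus[symmetric] integral_nonneg) (auto simp: less_imp_le)
  finally have "p i * phi q i j 0 = integral {0..x} g + p i * exp (- ?k * x) * phi q i j x"
    using g_nonneg integral_Icc_eq_HK(1)[OF int] p_pos[of i] phi_bounds[OF q]
    by (subst (asm) ennreal_inj) (auto simp: less_imp_le intro!: add_nonneg_nonneg integral_nonneg)
  then have "phi q i j 0 = integral {0..x} g / p i + exp (- ?k * x) * phi q i j x"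
    using p_pos[of i] by (simp add: field_simps)
  then have "exp (?k * x) * phi q i j 0 = exp (?k * x) * integral {0..x} g / p i + (exp (?k * x) * exp (- ?k * x)) * phi q i j x"
    by (simp add: algebra_simps)
  also have "exp (?k * x) * exp (- ?k * x) = 1" by (simp add: mult_exp_exp)
  finally show "phi q i j x = exp (?k * x) * phi q i j 0 - econv ?k ?G x / p i"
    unfolding econv_eq_HK(1)[OF ebG] g_def by simp
qed

text \<open>Dominated convergence with bound 1. It includes q = 0 because \<open>ruin_value\<close>
  is 0 for every rate when ruin never occurs, instead of jumping to 1 in the limit.\<close>

lemma phi_tendsto:
  assumes q: "0 \<le> q"
  shows "(\<lambda>n. phi (q + inverse (real (Suc n))) i j x) \<longlonglongrightarrow> phi q i j x"
  unfolding phi_def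
proof (rule integral_dominated_convergence[where w = "\<lambda>_. 1"])
  interpret prob_space sample by (rule prob_space_sample)
  show "integrable sample (\<lambda>_. 1 :: real)" by simp
  have "(\<lambda>n. q + inverse (real (Suc n))) \<longlonglongrightarrow> q + 0" by (intro tendsto_intros LIMSEQ_inverse_real_of_nat)
  then have lim: "(\<lambda>n. q + inverse (real (Suc n))) \<longlonglongrightarrow> q" by simp
  show "AE \<omega> in sample. (\<lambda>n. ruin_value p (q + inverse (real (Suc n))) \<omega> x i j) \<longlonglongrightarrow> ruin_value p q \<omega> x i j"
  proof (rule AE_I2)
    fix \<omega>
    show "(\<lambda>n. ruin_value p (q + inverse (real (Suc n))) \<omega> x i j) \<longlonglongrightarrow> ruin_value p q \<omega> x i j"
    proof (cases "(\<exists>k. ev_level p \<omega> x i k < 0) \<and> ev_time \<omega> i (ruin_index p \<omega> x i) < \<infinity> \<and>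
         ev_state \<omega> i (ruin_index p \<omega> x i) = j")
      case True
      then show ?thesis unfolding ruin_value_def by (simp only: simp_thms if_True) (intro tendsto_intros lim)
    next
      case False
      then show ?thesis unfolding ruin_value_def by (simp only: if_False) simp
    qed
  qed
  fix n
  have "0 \<le> q + inverse (real (Suc n))" using q by (auto intro!: add_nonneg_nonneg)
  from AE_ruin_value_bounds[OF this, of x i j]
  show "AE \<omega> in sample. norm (ruin_value p (q + inverse (real (Suc n))) \<omega> x i j) \<le> 1"
    by eventually_elim auto
qed measurable

text \<open>The two integrands agree only almost surely, off the null sets of explosive paths and of
  zero holding times. Equality of the integrals then requires the integrand of \<open>phi1\<close>
  to be measurable, which is what the measurability of \<open>ruin_time\<close> and
  \<open>Jproc\<close> is for.\<close>

lemma phi1_eq_phi: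
  assumes x: "0 \<le> x"
  shows "phi1 p lam Q FC FCC q x $ i $ j = phi q i j x"
proof -
  let ?f = "\<lambda>\<omega>. if ruin_time p \<omega> x i < \<infinity> \<and> Jproc \<omega> i (real_of_ereal (ruin_time p \<omega> x i)) = j
       then exp (- q * real_of_ereal (ruin_time p \<omega> x i)) else 0"
  have [measurable]: "(\<lambda>\<omega>. Jproc \<omega> i (real_of_ereal (ruin_time p \<omega> x i))) \<in> measurable seq_space (count_space UNIV)"
    by (rule measurable_Jproc) measurable
  have "(\<integral>\<omega>. ?f \<omega> \<partial>sample) = (\<integral>\<omega>. ruin_value p q \<omega> x i j \<partial>sample)"
  proof (rule integral_cong_AE)
    have "?f \<in> borel_measurable seq_space" by measurable
    then show "?f \<in> borel_measurable sample" by (simp only: measurable_cong_sets[OF sets_sample refl])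
    show "AE \<omega> in sample. ?f \<omega> = ruin_value p q \<omega> x i j"
      using AE_pos_holds AE_nonexplosive[of i]
    proof eventually_elim
      case (elim \<omega>)
      show ?case by (rule ruin_value_eq_ruin_time[OF x elim(1) p_pos]) (use elim(2) in blast)
    qed
  qed measurable
  then show ?thesis by (simp add: phi1_def phi_def)
qed

end

section \<open>Scale matrices\<close>

lemma has_integral_matrix_iff:
  fixes f :: "real \<Rightarrow> real^'n^'m"
  shows "(f has_integral A) S \<longleftrightarrow> (\<forall>i j. ((\<lambda>x. f x $ i $ j) has_integral A $ i $ j) S)"
  unfolding has_integral_componentwise_iff[of f]
  by (auto simp: Basis_vec_def inner_axis)

context mmrp begin

lemma Fexp_eq_Fm: "Fexp p lam Q FC FCC \<alpha> - q *\<^sub>R mat 1 = Fm q \<alpha>"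
proof -
  have "(Fexp p lam Q FC FCC \<alpha> - q *\<^sub>R mat 1) $ i $ j = Fm q \<alpha> $ i $ j" for i j
    by (simp add: Fexp_def Fm_def r_eq_rate rate_def mat_def intensity_def claim_dist_def algebra_simps)
  then show ?thesis by (simp add: vec_eq_iff)
qed

lemma Q_eq_Qm: "Q - q *\<^sub>R mat 1 = Qm q"
proof -
  have "(Q - q *\<^sub>R mat 1) $ i $ j = Qm q $ i $ j" for i j
    by (simp add: Qm_def r_eq_rate rate_def mat_def intensity_def)
  then show ?thesis by (simp add: vec_eq_iff)
qed

lemma W_continuous_on: "0 \<le> q \<Longrightarrow> continuous_on {0..} (W q)"
  using continuous_on_vec_lambda[of "{0..}" "\<lambda>i x. \<chi> j. W q x $ i $ j"]
    continuous_on_vec_lambda[of "{0..}" "\<lambda>j x. W q x $ _ $ j"] W_continuous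
  by simp

text \<open>A competitor is compared with \<open>W\<close> entry by entry through Lerch's theorem.
  The clause on x < 0 in \<open>scaleW\<close> pins the function down where the transform says
  nothing, so that the description is unique.\<close>

lemma scaleW_eq_W:
  assumes q: "0 \<le> q"
  shows "scaleW p lam Q FC FCC q = W q"
  unfolding scaleW_def Fexp_eq_Fm
proof (rule the_equality)
  have "\<forall>\<^sub>F \<alpha> in at_top. \<forall>i\<in>UNIV. \<forall>j\<in>UNIV. ((\<lambda>x. exp (- \<alpha> * x) * W q x $ i $ j) has_integral LT (\<lambda>x. W q x $ i $ j) \<alpha>) {0..}"
    by (intro eventually_ball_finite ballI LT_has_integral exp_bounded_W q) auto
  then have W_lap: "\<forall>\<^sub>F \<alpha> in at_top. invertible (Fm q \<alpha>) \<and>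
      ((\<lambda>x. exp (- \<alpha> * x) *\<^sub>R W q x) has_integral matrix_inv (Fm q \<alpha>)) {0..}"
    using LTW[OF q]
  proof eventually_elim
    case (elim \<alpha>)
    then have "matrix_inv (Fm q \<alpha>) = LTW q \<alpha>" by (intro matrix_inv_eqI) auto
    moreover have "invertible (Fm q \<alpha>)" using elim unfolding invertible_def by blast
    ultimately show ?case using elim by (simp add: has_integral_matrix_iff LTW_def)
  qed
  then show "continuous_on {0..} (W q) \<and> (\<forall>x<0. W q x = 0) \<and>
     (\<forall>\<^sub>F \<alpha> in at_top. invertible (Fm q \<alpha>) \<and>
      ((\<lambda>x. exp (- \<alpha> * x) *\<^sub>R W q x) has_integral matrix_inv (Fm q \<alpha>)) {0..})"
    using W_continuous_on[OF q] W_neg[OF q] by blast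
  fix V
  assume V: "continuous_on {0..} V \<and> (\<forall>x<0. V x = 0) \<and>
     (\<forall>\<^sub>F \<alpha> in at_top. invertible (Fm q \<alpha>) \<and>
      ((\<lambda>x. exp (- \<alpha> * x) *\<^sub>R V x) has_integral matrix_inv (Fm q \<alpha>)) {0..})"
  show "V = W q"
  proof
    fix x
    show "V x = W q x"
    proof (cases "x < 0")
      case True
      then show ?thesis using V W_neg[OF q] by simp
    next
      case False
      have "V x $ i $ j - W q x $ i $ j = 0" for i j
      proof (rule Laplace_transform_eq_0_imp_eq_0[where f = "\<lambda>x. V x $ i $ j - W q x $ i $ j"])
        show "continuous_on {0..} (\<lambda>x. V x $ i $ j - W q x $ i $ j)"
          using V W_continuous_on[OF q] by (intro continuous_intros) auto
        from V have "\<forall>\<^sub>F \<alpha> in at_top. invertible (Fm q \<alpha>) \<and>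
            ((\<lambda>x. exp (- \<alpha> * x) *\<^sub>R V x) has_integral matrix_inv (Fm q \<alpha>)) {0..}" by blast
        then show "\<forall>\<^sub>F \<alpha> in at_top. ((\<lambda>x. exp (- \<alpha> * x) * (V x $ i $ j - W q x $ i $ j)) has_integral 0) {0..}"
          using W_lap
        proof eventually_elim
          case (elim \<alpha>)
          then have "((\<lambda>x. exp (- \<alpha> * x) *\<^sub>R V x - exp (- \<alpha> * x) *\<^sub>R W q x) has_integral
              (matrix_inv (Fm q \<alpha>) - matrix_inv (Fm q \<alpha>))) {0..}"
            by (intro has_integral_diff) auto
          then show ?case by (simp add: has_integral_matrix_iff right_diff_distrib)
        qed
      qed (use False in auto)
      then show ?thesis by (simp add: vec_eq_iff)
    qed
  qed
qed

lemma scaleZ_eq: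
  assumes q: "0 \<le> q" and x: "0 \<le> x"
  shows "scaleZ p lam Q FC FCC q x $ i $ j =
    (if i = j then 1 else 0) - (\<Sum>k\<in>UNIV. integral {0..x} (\<lambda>y. W q y $ i $ k) * Qm q $ k $ j)"
proof -
  have "W q integrable_on {0..x}"
    by (intro integrable_continuous_real continuous_on_subset[OF W_continuous_on[OF q]]) auto
  then have "(W q has_integral integral {0..x} (W q)) {0..x}" by (rule integrable_integral)
  then have "integral {0..x} (W q) $ i $ k = integral {0..x} (\<lambda>y. W q y $ i $ k)" for k
    unfolding has_integral_matrix_iff by (auto intro!: integral_unique[symmetric])
  then show ?thesis
    unfolding scaleZ_def scaleW_eq_W[OF q] Q_eq_Qm by (simp add: mat_def matrix_matrix_mult_def)
qed

definition limC :: "real \<Rightarrow> real^'n^'n" where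
  "limC q = (\<chi> k j. p k * ((if k = j then 1 else 0) - phi q k j 0))"

lemma phi_eq_scale:
  assumes q: "0 \<le> q" and x: "0 \<le> x"
  shows "(\<chi> i j. phi q i j x) = scaleZ p lam Q FC FCC q x - W q x ** limC q"
proof -
  have "phi q i j x = (scaleZ p lam Q FC FCC q x - W q x ** limC q) $ i $ j" for i j
  proof -
    let ?b = "axis j 1 :: real^'n"
    have "phi q i j x = ?b $ i + (W q x *v (\<chi> k. p k * (phi q k j 0 - ?b $ k))) $ i
      - (\<Sum>k\<in>UNIV. integral {0..x} (\<lambda>y. W q y $ i $ k) * (Qm q *v ?b) $ k)"
    proof (rule sol_representation[OF sol_phi[OF q] _ q x])
      show "phi q k j y = ?b $ k" if "y < 0" for k y using phi_neg[OF that] by (simp add: axis_def)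
    qed
    moreover have "(Qm q *v ?b) $ k = Qm q $ k $ j" for k
      by (simp add: matrix_vector_mult_def axis_def if_distrib cong: if_cong)
    moreover have "(W q x *v (\<chi> k. p k * (phi q k j 0 - ?b $ k))) $ i = - ((W q x ** limC q) $ i $ j)"
      by (simp add: matrix_vector_mult_def matrix_matrix_mult_def limC_def axis_def algebra_simps
          flip: sum_negf)
    moreover have "?b $ i = (if i = j then 1 else 0)" by (simp add: axis_def)
    ultimately show ?thesis by (simp add: scaleZ_eq[OF q x])
  qed
  then show ?thesis by (simp add: vec_eq_iff)
qed

lemma tendsto_limC:
  assumes q: "0 \<le> q"
  shows "((\<lambda>a. matrix_inv (W q a) ** scaleZ p lam Q FC FCC q a) \<longlongrightarrow> limC q) at_top"
proof -
  have col: "((\<lambda>a. matrix_inv (W q a) *v (\<chi> i. phi q i j a)) \<longlongrightarrow> 0) at_top" for j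
  proof (rule matrix_inv_W_tendsto_0[OF q, where \<phi> = "\<lambda>s i. phi s i j"])
    show "\<And>s i x. 0 \<le> s \<Longrightarrow> x < 0 \<Longrightarrow> phi s i j x = (if i = j then 1 else 0)" by (rule phi_neg)
  qed (simp_all only: sol_phi phi_bounds phi_tendsto[OF q] simp_thms)
  have "((\<lambda>a. matrix_inv (W q a) ** (\<chi> i j. phi q i j a)) \<longlongrightarrow> 0) at_top"
  proof (intro vec_tendstoI)
    fix i j
    have "(matrix_inv (W q a) ** (\<chi> i j. phi q i j a)) $ i $ j = (matrix_inv (W q a) *v (\<chi> i. phi q i j a)) $ i" for a
      by (simp add: matrix_matrix_mult_def matrix_vector_mult_def)
    then show "((\<lambda>a. (matrix_inv (W q a) ** (\<chi> i j. phi q i j a)) $ i $ j) \<longlongrightarrow> 0 $ i $ j) at_top"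
      using tendsto_vec_nth[OF col[of j], of i] by simp
  qed
  then have "((\<lambda>a. matrix_inv (W q a) ** (\<chi> i j. phi q i j a) + limC q) \<longlongrightarrow> 0 + limC q) at_top"
    by (intro tendsto_intros)
  moreover have "\<forall>\<^sub>F a in at_top. matrix_inv (W q a) ** (\<chi> i j. phi q i j a) + limC q =
      matrix_inv (W q a) ** scaleZ p lam Q FC FCC q a"
    using eventually_ge_at_top[of 0]
  proof eventually_elim
    case (elim a)
    have "scaleZ p lam Q FC FCC q a = (\<chi> i j. phi q i j a) + W q a ** limC q"
      unfolding phi_eq_scale[OF q elim] by simp
    then show ?case
      using matrix_inv_inverse(2)[OF W_invertible[OF q elim]]
      by (simp add: matrix_add_ldistrib matrix_mul_assoc)
  qed
  ultimately show ?thesis by (simp add: tendsto_cong)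
qed

end

theorem theorem3:
  fixes p lam :: "'n::finite \<Rightarrow> real"
    and Q :: "real^'n^'n"
    and FC :: "'n \<Rightarrow> real measure"
    and FCC :: "'n \<Rightarrow> 'n \<Rightarrow> real measure"
    and q :: real
  assumes Q_offdiag: "\<And>i j. i \<noteq> j \<Longrightarrow> 0 \<le> Q$i$j"
    and Q_rows: "\<And>i. (\<Sum>j\<in>UNIV. Q$i$j) = 0"
    and p_pos: "\<And>i. 0 < p i"
    and lam_nonneg: "\<And>i. 0 \<le> lam i"
    and FC_prob: "\<And>i. prob_space (FC i)"
    and FC_borel: "\<And>i. sets (FC i) = sets borel"
    and FC_nonneg: "\<And>i. AE c in FC i. 0 \<le> c"
    and FCC_prob: "\<And>i j. i \<noteq> j \<Longrightarrow> prob_space (FCC i j)"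
    and FCC_borel: "\<And>i j. i \<noteq> j \<Longrightarrow> sets (FCC i j) = sets borel"
    and FCC_nonneg: "\<And>i j. i \<noteq> j \<Longrightarrow> AE c in FCC i j. 0 \<le> c"
    and profit: "net_profit p lam Q FC FCC"
    and q_nonneg: "0 \<le> q"
  shows "(\<forall>\<^sub>F a in at_top. invertible (scaleW p lam Q FC FCC q a)) \<and>
         (\<exists>C. ((\<lambda>a. matrix_inv (scaleW p lam Q FC FCC q a) ** scaleZ p lam Q FC FCC q a)
                  \<longlongrightarrow> C) at_top \<and>
              (\<forall>x\<ge>0. phi1 p lam Q FC FCC q x
                      = scaleZ p lam Q FC FCC q x - scaleW p lam Q FC FCC q x ** C))"
proof -
  interpret mmrp p lam Q FC FCC
    by (rule mmrp.intro; fact)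
  have phi1: "phi1 p lam Q FC FCC q x = (\<chi> i j. phi q i j x)" if "0 \<le> x" for x
    by (simp add: vec_eq_iff phi1_eq_phi[OF that])
  show ?thesis
    unfolding scaleW_eq_W[OF q_nonneg]
  proof (intro conjI exI[of _ "limC q"] allI impI)
    show "\<forall>\<^sub>F a in at_top. invertible (W q a)"
      using eventually_ge_at_top[of 0] by eventually_elim (rule W_invertible[OF q_nonneg])
    show "((\<lambda>a. matrix_inv (W q a) ** scaleZ p lam Q FC FCC q a) \<longlongrightarrow> limC q) at_top"
      by (rule tendsto_limC[OF q_nonneg])
    show "phi1 p lam Q FC FCC q x = scaleZ p lam Q FC FCC q x - W q x ** limC q" if "0 \<le> x" for x
      unfolding phi1[OF that] by (rule phi_eq_scale[OF q_nonneg that])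
  qed
qed

end
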